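(* Let $p>1$ and fix $M>0$. For each $q>1$ and $0<\lambda<1$ let $a^{\star;q,\lambda}\in\mathscr{U}^M_{\rm ad}$ be an arbitrary optimal control of $J^{q,\lambda}$ in $\mathscr{U}^M_{\rm ad}$, i.e. $J^{q,\lambda}(a^{\star;q,\lambda})=\min_{a\in\mathscr{U}^M_{\rm ad}}J^{q,\lambda}(a)$. Then, regardless of the choice of these optimal controls, the family $\{a^{\star;q,\lambda}\}_{q>1,\,0<\lambda<1}$ is uniformly bounded in $W^{1,2}(0,T;\mathbb{R}^N)$ and possesses a subsequence $\{a^{\star;q^i,\lambda^i}\}_{i\in\mathbb{N}}$ with $q^i\to\infty$, $\lambda^i\to0$ which converges strongly in $C([0,T];\mathbb{R}^N)$ as $i\to\infty$ to an optimal control of the original cost function $J$ in $\mathscr{U}^M_{\rm ad}$, i.e. to a minimizer of $J$ over $\mathscr{U}^M_{\rm ad}$.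
   Context: Weighted hypergraph: $G=(V,E,w)$ with $V=\{1,\dots,N\}$, $E\subset 2^V$ a family of subsets with $\#e\ge 2$ for every $e\in E$, and $w:E\to(0,\infty)$. Here $N=n+m$, $0<T<\infty$, and $\|\cdot\|$ is the Euclidean norm of $\mathbb{R}^N$. For $x\in\mathbb{R}^N$, $f_e(x)=\max_{i,j\in e}|x_i-x_j|$, $\varphi_{G,p}(x)=\frac1p\sum_{e\in E}w(e)(f_e(x))^p$. For $q\ge1$, $f_{e,q}(x)=\big(\frac12\sum_{i,j\in e}|x_i-x_j|^q\big)^{1/q}$, $\varphi_{G,p,q}(x)=\frac1p\sum_{e\in E}w(e)(f_{e,q}(x))^p$; for $p,q>1$ the convex function $\varphi_{G,p,q}$ is $C^1$ with gradient $D\varphi_{G,p,q}$. For a proper lower semicontinuous convex $\phi:\mathbb{R}^N\to(-\infty,+\infty]$, $\partial\phi(x)=\{\eta\in\mathbb{R}^N:\ \eta\cdot(z-x)\le\phi(z)-\phi(x)\ \forall z\in\mathbb{R}^N\}$. $\mathscr{C}=\{a\in W^{1,2}(0,T;\mathbb{R}^N):\ a(\cdot)=(0,\dots,0,a_1(\cdot),\dots,a_m(\cdot))\}$ (first $n$ components vanish), $\mathscr{U}^M_{\rm ad}=\{a\in\mathscr{C}:\int_0^T\|a'(t)\|^2dt\le M\}$. For $a\in\mathscr{C}$, $K_a(t)=\{x\in\mathbb{R}^N: x_{n+j}=a_j(t),\ j=1,\dots,m\}$ with indicator function $I_{K_a(t)}$ ($0$ on $K_a(t)$, $+\infty$ elsewhere).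 $Hz=(0,\dots,0,z_{n+1},\dots,z_{n+m})$ for $z\in\mathbb{R}^N$. Fix $h\in L^2(0,T;\mathbb{R}^N)$, real numbers $x_{01},\dots,x_{0n}$, and targets $x_\ast\in L^2(0,T;\mathbb{R}^N)$, $z_\ast\in\mathbb{R}^N$. For $a\in\mathscr{C}$ put $x_0=(x_{01},\dots,x_{0n},a_1(0),\dots,a_m(0))\in K_a(0)$. $\Lambda(a)$ is the (known to exist and be unique) $x\in W^{1,2}(0,T;\mathbb{R}^N)$ with $x(t)\in K_a(t)$ for all $t\in[0,T]$, $x(0)=x_0$ and $x'(t)+\partial\varphi_{G,p}(x(t))+\partial I_{K_a(t)}(x(t))\ni h(t)$ for a.e. $t\in(0,T)$. For $q>1,\lambda>0$, $\Lambda^{q,\lambda}(a)\in W^{1,2}(0,T;\mathbb{R}^N)$ is the unique solution of $x'(t)+D\varphi_{G,p,q}(x(t))+\frac1\lambda(Hx(t)-a(t))=h(t)$ for a.e. $t\in(0,T)$, $x(0)=x_0$. The cost functions on $\mathscr{C}$ are $$J(a)=\frac12\int_0^T\|\Lambda(a)(t)-x_\ast(t)\|^2dt+\frac12\int_0^T\|a(t)\|^2dt,$$ $$J^{q,\lambda}(a)=\frac12\int_0^T\|\Lambda^{q,\lambda}(a)(t)-x_\ast(t)\|^2dt+\frac12\int_0^T\|a(t)\|^2dt+\frac\lambda2\|\Lambda^{q,\lambda}(a)(T)-z_\ast\|^2+\frac\lambda2\|a(0)\|^2 .$$ *)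

theory Defs
  imports "HOL-Analysis.Analysis"
begin

section \<open>Sobolev functions on an interval\<close>

text \<open>
  Functions on the time interval are total functions on the reals; only their values on
  \<open>{0..T}\<close> matter.  Integrals are Lebesgue integrals over \<open>{0..T}\<close>; the two end points are
  null sets, so this is the same as working on the open interval.
\<close>

definition L2_fun :: "real \<Rightarrow> (real \<Rightarrow> 'a::euclidean_space) \<Rightarrow> bool" where
  "L2_fun T f \<longleftrightarrow> f \<in> borel_measurable (lebesgue_on {0..T}) \<and>
     integrable (lebesgue_on {0..T}) (\<lambda>t. (norm (f t))\<^sup>2)"

definition test_fun :: "real \<Rightarrow> (real \<Rightarrow> real) \<Rightarrow> bool" where
  "test_fun T \<psi> \<longleftrightarrow> \<psi> C1_differentiable_on UNIV \<and> closure {t. \<psi> t \<noteq> 0} \<subseteq> {0<..<T}"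

definition weak_deriv :: "real \<Rightarrow> (real \<Rightarrow> 'a::euclidean_space) \<Rightarrow> (real \<Rightarrow> 'a) \<Rightarrow> bool" where
  "weak_deriv T u g \<longleftrightarrow>
     (\<forall>\<psi>. test_fun T \<psi> \<longrightarrow>
        (LINT t|lebesgue_on {0..T}. deriv \<psi> t *\<^sub>R u t) = - (LINT t|lebesgue_on {0..T}. \<psi> t *\<^sub>R g t))"

text \<open>
  An element of \<open>W\<^sup>1\<^sup>,\<^sup>2(0,T)\<close> is represented by its continuous representative on \<open>{0..T}\<close>, so that
  point values make sense.  Square integrability of \<open>u\<close> itself follows from continuity.
\<close>

definition W12 :: "real \<Rightarrow> (real \<Rightarrow> 'a::euclidean_space) \<Rightarrow> bool" where
  "W12 T u \<longleftrightarrow> continuous_on {0..T} u \<and> (\<exists>g. L2_fun T g \<and> weak_deriv T u g)"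

text \<open>The weak derivative is unique up to null sets; every use below is insensitive to null sets.\<close>

definition wderiv :: "real \<Rightarrow> (real \<Rightarrow> 'a::euclidean_space) \<Rightarrow> real \<Rightarrow> 'a" where
  "wderiv T u = (SOME g. L2_fun T g \<and> weak_deriv T u g)"

definition W12_norm :: "real \<Rightarrow> (real \<Rightarrow> 'a::euclidean_space) \<Rightarrow> real" where
  "W12_norm T u = sqrt ((LINT t|lebesgue_on {0..T}. (norm (u t))\<^sup>2)
                      + (LINT t|lebesgue_on {0..T}. (norm (wderiv T u t))\<^sup>2))"


section \<open>Convex analysis\<close>

text \<open>
  With the conventions of \<^typ>\<open>ereal\<close>, the subdifferential of a proper function is empty at points
  where the function is infinite, as it should be.
\<close>

definition subdiff :: "('a::euclidean_space \<Rightarrow> ereal) \<Rightarrow> 'a \<Rightarrow> 'a set" where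
  "subdiff \<phi> x = {\<eta>. \<forall>z. ereal (\<eta> \<bullet> (z - x)) \<le> \<phi> z - \<phi> x}"

definition ind_fun :: "'a set \<Rightarrow> 'a \<Rightarrow> ereal" where
  "ind_fun K x = (if x \<in> K then 0 else \<infinity>)"

definition gradient :: "('a::euclidean_space \<Rightarrow> real) \<Rightarrow> 'a \<Rightarrow> 'a" where
  "gradient \<phi> x = (THE D. GDERIV \<phi> x :> D)"


section \<open>Weighted hypergraphs and their energies\<close>

text \<open>The vertex set is the finite type \<open>'v\<close>, of cardinality \<open>N\<close>; the state space is \<open>real ^ 'v\<close>.\<close>

definition weighted_hypergraph :: "'v::finite set set \<Rightarrow> ('v set \<Rightarrow> real) \<Rightarrow> bool" where
  "weighted_hypergraph E w \<longleftrightarrow> (\<forall>e\<in>E. 2 \<le> card e \<and> 0 < w e)"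

definition f_edge :: "'v::finite set \<Rightarrow> real ^ 'v \<Rightarrow> real" where
  "f_edge e x = Max {\<bar>x $ i - x $ j\<bar> | i j. i \<in> e \<and> j \<in> e}"

definition energy :: "'v::finite set set \<Rightarrow> ('v set \<Rightarrow> real) \<Rightarrow> real \<Rightarrow> real ^ 'v \<Rightarrow> real" where
  "energy E w p x = 1 / p * (\<Sum>e\<in>E. w e * f_edge e x powr p)"

text \<open>The sum over \<open>i, j \<in> e\<close> runs over ordered pairs, whence the factor one half.\<close>

definition f_edge_q :: "'v::finite set \<Rightarrow> real \<Rightarrow> real ^ 'v \<Rightarrow> real" where
  "f_edge_q e q x = (1 / 2 * (\<Sum>i\<in>e. \<Sum>j\<in>e. \<bar>x $ i - x $ j\<bar> powr q)) powr (1 / q)"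

definition energy_q ::
    "'v::finite set set \<Rightarrow> ('v set \<Rightarrow> real) \<Rightarrow> real \<Rightarrow> real \<Rightarrow> real ^ 'v \<Rightarrow> real" where
  "energy_q E w p q x = 1 / p * (\<Sum>e\<in>E. w e * f_edge_q e q x powr p)"


section \<open>Controls and constraints\<close>

text \<open>
  \<open>C\<close> is the set of controlled vertices.  With the vertices numbered \<open>1, \<dots>, n + m\<close> it consists of
  the last \<open>m\<close> of them, and its complement of the first \<open>n\<close>; the numbering plays no other role.
  Both \<open>C\<close> and its complement may be empty.
\<close>

definition controls :: "real \<Rightarrow> 'v::finite set \<Rightarrow> (real \<Rightarrow> real ^ 'v) set" where
  "controls T C = {a. W12 T a \<and> (\<forall>t\<in>{0..T}. \<forall>i. i \<notin> C \<longrightarrow> a t $ i = 0)}"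

definition adm_controls :: "real \<Rightarrow> 'v::finite set \<Rightarrow> real \<Rightarrow> (real \<Rightarrow> real ^ 'v) set" where
  "adm_controls T C M =
     {a \<in> controls T C. (LINT t|lebesgue_on {0..T}. (norm (wderiv T a t))\<^sup>2) \<le> M}"

definition K_set :: "'v::finite set \<Rightarrow> (real \<Rightarrow> real ^ 'v) \<Rightarrow> real \<Rightarrow> (real ^ 'v) set" where
  "K_set C a t = {x. \<forall>i\<in>C. x $ i = a t $ i}"

definition H_proj :: "'v::finite set \<Rightarrow> real ^ 'v \<Rightarrow> real ^ 'v" where
  "H_proj C z = (\<chi> i. if i \<in> C then z $ i else 0)"

text \<open>Only the values of \<open>\<xi>\<close> outside \<open>C\<close> (the numbers \<open>x\<^sub>0\<^sub>1, \<dots>, x\<^sub>0\<^sub>n\<close>) are used.\<close>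

definition init_state ::
    "'v::finite set \<Rightarrow> ('v \<Rightarrow> real) \<Rightarrow> (real \<Rightarrow> real ^ 'v) \<Rightarrow> real ^ 'v" where
  "init_state C \<xi> a = (\<chi> i. if i \<in> C then a 0 $ i else \<xi> i)"


section \<open>State equations and cost functions\<close>

definition is_state ::
    "real \<Rightarrow> 'v::finite set \<Rightarrow> 'v set set \<Rightarrow> ('v set \<Rightarrow> real) \<Rightarrow> real \<Rightarrow> (real \<Rightarrow> real ^ 'v) \<Rightarrow>
     ('v \<Rightarrow> real) \<Rightarrow> (real \<Rightarrow> real ^ 'v) \<Rightarrow> (real \<Rightarrow> real ^ 'v) \<Rightarrow> bool" where
  "is_state T C E w p h \<xi> a x \<longleftrightarrow>
     W12 T x \<and> (\<forall>t\<in>{0..T}. x t \<in> K_set C a t) \<and> x 0 = init_state C \<xi> a \<and>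
     (AE t in lebesgue_on {0..T}.
        \<exists>\<eta>\<in>subdiff (\<lambda>z. ereal (energy E w p z)) (x t). \<exists>\<zeta>\<in>subdiff (ind_fun (K_set C a t)) (x t).
          wderiv T x t + \<eta> + \<zeta> = h t)"

definition is_state_q ::
    "real \<Rightarrow> 'v::finite set \<Rightarrow> 'v set set \<Rightarrow> ('v set \<Rightarrow> real) \<Rightarrow> real \<Rightarrow> (real \<Rightarrow> real ^ 'v) \<Rightarrow>
     ('v \<Rightarrow> real) \<Rightarrow> real \<Rightarrow> real \<Rightarrow> (real \<Rightarrow> real ^ 'v) \<Rightarrow> (real \<Rightarrow> real ^ 'v) \<Rightarrow> bool" where
  "is_state_q T C E w p h \<xi> q lam a x \<longleftrightarrow>
     W12 T x \<and> x 0 = init_state C \<xi> a \<and>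
     (AE t in lebesgue_on {0..T}.
        wderiv T x t + gradient (energy_q E w p q) (x t) + (1 / lam) *\<^sub>R (H_proj C (x t) - a t) = h t)"

text \<open>
  Solutions exist and are unique as functions on \<open>{0..T}\<close>.  They are selected with \<open>SOME\<close> rather
  than \<open>THE\<close> because the predicates do not constrain values outside \<open>{0..T}\<close>.
\<close>

definition state ::
    "real \<Rightarrow> 'v::finite set \<Rightarrow> 'v set set \<Rightarrow> ('v set \<Rightarrow> real) \<Rightarrow> real \<Rightarrow> (real \<Rightarrow> real ^ 'v) \<Rightarrow>
     ('v \<Rightarrow> real) \<Rightarrow> (real \<Rightarrow> real ^ 'v) \<Rightarrow> (real \<Rightarrow> real ^ 'v)" where
  "state T C E w p h \<xi> a = (SOME x. is_state T C E w p h \<xi> a x)"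

definition state_q ::
    "real \<Rightarrow> 'v::finite set \<Rightarrow> 'v set set \<Rightarrow> ('v set \<Rightarrow> real) \<Rightarrow> real \<Rightarrow> (real \<Rightarrow> real ^ 'v) \<Rightarrow>
     ('v \<Rightarrow> real) \<Rightarrow> real \<Rightarrow> real \<Rightarrow> (real \<Rightarrow> real ^ 'v) \<Rightarrow> (real \<Rightarrow> real ^ 'v)" where
  "state_q T C E w p h \<xi> q lam a = (SOME x. is_state_q T C E w p h \<xi> q lam a x)"

definition cost ::
    "real \<Rightarrow> 'v::finite set \<Rightarrow> 'v set set \<Rightarrow> ('v set \<Rightarrow> real) \<Rightarrow> real \<Rightarrow> (real \<Rightarrow> real ^ 'v) \<Rightarrow>
     ('v \<Rightarrow> real) \<Rightarrow> (real \<Rightarrow> real ^ 'v) \<Rightarrow> (real \<Rightarrow> real ^ 'v) \<Rightarrow> real" where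
  "cost T C E w p h \<xi> xs a =
     1 / 2 * (LINT t|lebesgue_on {0..T}. (norm (state T C E w p h \<xi> a t - xs t))\<^sup>2)
   + 1 / 2 * (LINT t|lebesgue_on {0..T}. (norm (a t))\<^sup>2)"

definition cost_q ::
    "real \<Rightarrow> 'v::finite set \<Rightarrow> 'v set set \<Rightarrow> ('v set \<Rightarrow> real) \<Rightarrow> real \<Rightarrow> (real \<Rightarrow> real ^ 'v) \<Rightarrow>
     ('v \<Rightarrow> real) \<Rightarrow> (real \<Rightarrow> real ^ 'v) \<Rightarrow> real ^ 'v \<Rightarrow> real \<Rightarrow> real \<Rightarrow>
     (real \<Rightarrow> real ^ 'v) \<Rightarrow> real" where
  "cost_q T C E w p h \<xi> xs zs q lam a =
     1 / 2 * (LINT t|lebesgue_on {0..T}. (norm (state_q T C E w p h \<xi> q lam a t - xs t))\<^sup>2)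
   + 1 / 2 * (LINT t|lebesgue_on {0..T}. (norm (a t))\<^sup>2)
   + lam / 2 * (norm (state_q T C E w p h \<xi> q lam a T - zs))\<^sup>2
   + lam / 2 * (norm (a 0))\<^sup>2"

end

theory Submission
  imports Defs "HOL-Complex_Analysis.Great_Picard"
begin

text \<open>
  The theorem follows from a continuity property of the costs, \<open>cost_q_tendsto\<close>: if admissible
  controls \<open>a k\<close> converge uniformly to \<open>b\<close> while \<open>q\<close> tends to infinity and \<open>lam\<close> to zero, then the
  penalised costs of the \<open>a k\<close> converge to the original cost of \<open>b\<close>.  Apply this to a convergent
  sequence of optimal controls, and to the constant sequence given by an arbitrary competitor;
  optimality is an inequality between the two sequences of costs, and survives in the limit.
  Convergent sequences of optimal controls exist by compactness (\<open>adm_controls_compact\<close>).  The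
  penalised cost of the zero control is bounded independently of \<open>q\<close> and \<open>lam\<close>, hence so is the mean
  square of every optimal control; together with the bound on the derivative this gives
  equicontinuity and a uniform bound.

  The continuity of the costs is a statement about the states (\<open>state_q_converges\<close>).  Writing \<open>x\<close> for
  the penalised state of the control \<open>a\<close> and \<open>H\<close> for the projection onto the controlled vertices, the
  following bounds hold uniformly in \<open>q\<close> and \<open>lam\<close> (\<open>state_q_estimates\<close>).  Testing the equation with
  \<open>x - a\<close> bounds \<open>x\<close>.  The energies are bounded on balls uniformly in \<open>q\<close>, so by convexity their
  gradients are bounded along \<open>x\<close>.  Testing the controlled components with the derivative of \<open>H x - a\<close>
  shows that the constraint is violated by at most a multiple of \<open>sqrt lam\<close>, and that the penalty force
  \<open>(H x - a) / lam\<close> is bounded in mean square.  With these bounds the penalised states can be compared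
  directly with the constrained state of the limit control: the gradient of \<open>energy_q\<close> and the
  subgradient of \<open>energy\<close> are monotone up to the difference of the two energies, which vanishes in the
  limit because the energies agree up to a factor \<open>(N\<^sup>2) powr (p / q)\<close> for \<open>N\<close> vertices; the penalty force
  is paired with the difference of the controls, and the normal vector of the constraint with the
  violation of the constraint.

  The existence of both kinds of states is part of the argument.  The gradient of \<open>energy_q\<close> is
  continuous but in general not Lipschitz continuous, so the penalised equation is solved by Euler
  polygons (\<open>Peano_bounded\<close>), the a priori bound allowing a truncation.  The constrained state arises
  from the penalised states of a fixed control as \<open>q\<close> tends to infinity and \<open>lam\<close> to zero
  (\<open>state_exists\<close>).

  Sobolev functions are handled as primitives of square integrable functions, which is justified by
  the lemma of du Bois-Reymond.  Weak compactness in the space of square integrable functions is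
  replaced by a convexity argument (\<open>L2_primitive_uniform_limit\<close>).  Inclusions and equations that hold
  almost everywhere are recovered from their integrals over intervals by Lebesgue's differentiation
  theorem.
\<close>



section \<open>Square integrable functions on an interval\<close>

lemma L2_fun_iff_integrable_on:
  fixes f :: "real \<Rightarrow> 'a::euclidean_space"
  shows "L2_fun T f \<longleftrightarrow>
    f \<in> borel_measurable (lebesgue_on {0..T}) \<and> (\<lambda>t. (norm (f t))\<^sup>2) integrable_on {0..T}"
proof -
  have "integrable (lebesgue_on {0..T}) (\<lambda>t. (norm (f t))\<^sup>2)"
    if "(\<lambda>t. (norm (f t))\<^sup>2) integrable_on {0..T}"
    using nonnegative_absolutely_integrable_1[OF that]
    by (intro absolutely_integrable_imp_integrable) auto
  then show ?thesis
    unfolding L2_fun_def by (auto intro: integrable_on_lebesgue_on)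
qed

lemma L2_fun_dominated:
  fixes f :: "real \<Rightarrow> 'a::euclidean_space"
  assumes f: "f \<in> borel_measurable (lebesgue_on {0..T})" and g: "g integrable_on {0..T}"
    and le: "\<And>t. t \<in> {0..T} \<Longrightarrow> (norm (f t))\<^sup>2 \<le> g t"
  shows "L2_fun T f"
  unfolding L2_fun_iff_integrable_on
proof
  show "(\<lambda>t. (norm (f t))\<^sup>2) integrable_on {0..T}"
    by (rule measurable_bounded_by_integrable_imp_integrable_real[OF _ g])
       (use f le in \<open>auto\<close>)
qed (use f in auto)

lemma L2_fun_measurable: "L2_fun T f \<Longrightarrow> f \<in> borel_measurable (lebesgue_on {0..T})"
  by (simp add: L2_fun_def)

lemma L2_fun_sq_integrable_on: "L2_fun T f \<Longrightarrow> (\<lambda>t. (norm (f t))\<^sup>2) integrable_on {0..T}"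
  by (simp add: L2_fun_iff_integrable_on)

lemma LINT_sq_eq_integral:
  "L2_fun T f \<Longrightarrow> (LINT t|lebesgue_on {0..T}. (norm (f t))\<^sup>2) = integral {0..T} (\<lambda>t. (norm (f t))\<^sup>2)"
  by (auto simp: L2_fun_def intro: lebesgue_integral_eq_integral)

lemma L2_fun_absolutely_integrable:
  assumes "L2_fun T f" shows "f absolutely_integrable_on {0..T}"
proof (rule measurable_bounded_by_integrable_imp_absolutely_integrable)
  show "(\<lambda>t. 1 + (norm (f t))\<^sup>2) integrable_on {0..T}"
    by (intro integrable_add L2_fun_sq_integrable_on assms) auto
  show "norm (f t) \<le> 1 + (norm (f t))\<^sup>2" for t
    using zero_le_power2[of "norm (f t) - 1"] norm_ge_zero[of "f t"] unfolding power2_diff one_power2 mult_1_right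
    by linarith
qed (use assms in \<open>auto simp: L2_fun_def\<close>)

lemma L2_fun_integrable_on: "L2_fun T f \<Longrightarrow> f integrable_on {0..T}"
  using L2_fun_absolutely_integrable absolutely_integrable_on_def by blast

lemma L2_fun_norm_integrable_on: "L2_fun T f \<Longrightarrow> (\<lambda>t. norm (f t)) integrable_on {0..T}"
  using L2_fun_absolutely_integrable absolutely_integrable_on_def by blast

lemma integrable_on_subsegment:
  fixes f :: "real \<Rightarrow> 'a::banach"
  shows "f integrable_on {0..T} \<Longrightarrow> 0 \<le> s \<Longrightarrow> t \<le> T \<Longrightarrow> f integrable_on {s..t}"
  by (erule integrable_on_subinterval) auto

lemma L2_fun_continuous:
  fixes f :: "real \<Rightarrow> 'a::euclidean_space"
  assumes "continuous_on {0..T} f" shows "L2_fun T f"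
  unfolding L2_fun_iff_integrable_on
  using assms by (auto intro!: integrable_continuous_real continuous_intros
      continuous_imp_measurable_on_sets_lebesgue)

lemma L2_fun_linear:
  fixes f :: "real \<Rightarrow> 'a::euclidean_space" and A :: "'a \<Rightarrow> 'b::euclidean_space"
  assumes f: "L2_fun T f" and A: "bounded_linear A"
  shows "L2_fun T (\<lambda>t. A (f t))"
proof -
  interpret bounded_linear A by fact
  obtain K where K: "\<And>x. norm (A x) \<le> norm x * K" using bounded by auto
  show ?thesis
  proof (rule L2_fun_dominated)
    show "(\<lambda>t. A (f t)) \<in> borel_measurable (lebesgue_on {0..T})"
      using borel_measurable_continuous_on[OF linear_continuous_on[OF A] L2_fun_measurable[OF f]]
      by simp
    show "(\<lambda>t. K\<^sup>2 * (norm (f t))\<^sup>2) integrable_on {0..T}"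
      using L2_fun_sq_integrable_on[OF f] by (rule integrable_on_mult_right)
    show "(norm (A (f t)))\<^sup>2 \<le> K\<^sup>2 * (norm (f t))\<^sup>2" for t
      using power_mono[OF K[of "f t"], of 2] by (simp add: power_mult_distrib mult.commute)
  qed
qed

lemma L2_fun_scaleR:
  fixes f :: "real \<Rightarrow> 'a::euclidean_space"
  shows "L2_fun T f \<Longrightarrow> L2_fun T (\<lambda>t. c *\<^sub>R f t)"
  by (rule L2_fun_linear) (auto intro: bounded_linear_scaleR_right)

lemma norm_add_sq_le:
  fixes x y :: "'a::real_inner"
  shows "(norm (x + y))\<^sup>2 \<le> 2 * (norm x)\<^sup>2 + 2 * (norm y)\<^sup>2"
proof -
  have "(norm (x + y))\<^sup>2 \<le> (norm x + norm y)\<^sup>2" by (intro power_mono norm_triangle_ineq) auto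
  then show ?thesis using zero_le_power2[of "norm x - norm y"]
    by (simp add: power2_eq_square algebra_simps)
qed

lemma L2_fun_add:
  fixes f g :: "real \<Rightarrow> 'a::euclidean_space"
  assumes "L2_fun T f" "L2_fun T g" shows "L2_fun T (\<lambda>t. f t + g t)"
proof (rule L2_fun_dominated)
  show "(\<lambda>t. f t + g t) \<in> borel_measurable (lebesgue_on {0..T})"
    by (intro borel_measurable_add L2_fun_measurable assms)
  show "(\<lambda>t. 2 * (norm (f t))\<^sup>2 + 2 * (norm (g t))\<^sup>2) integrable_on {0..T}"
    using L2_fun_sq_integrable_on assms by (intro integrable_add) auto
qed (rule norm_add_sq_le)

lemma L2_fun_diff:
  fixes f g :: "real \<Rightarrow> 'a::euclidean_space"
  assumes "L2_fun T f" "L2_fun T g" shows "L2_fun T (\<lambda>t. f t - g t)"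
  using L2_fun_add[OF assms(1) L2_fun_scaleR[OF assms(2), of "-1"]] by simp

lemma L2_fun_inner_integrable:
  fixes f g :: "real \<Rightarrow> 'a::euclidean_space"
  assumes "L2_fun T f" "L2_fun T g" shows "(\<lambda>t. f t \<bullet> g t) absolutely_integrable_on {0..T}"
proof (rule measurable_bounded_by_integrable_imp_absolutely_integrable)
  show "(\<lambda>t. f t \<bullet> g t) \<in> borel_measurable (lebesgue_on {0..T})"
    by (intro borel_measurable_inner L2_fun_measurable assms)
  show "(\<lambda>t. (norm (f t))\<^sup>2 + (norm (g t))\<^sup>2) integrable_on {0..T}"
    by (intro integrable_add L2_fun_sq_integrable_on assms)
  show "norm (f t \<bullet> g t) \<le> (norm (f t))\<^sup>2 + (norm (g t))\<^sup>2" for t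
  proof -
    have "norm (f t \<bullet> g t) \<le> norm (f t) * norm (g t)" using Cauchy_Schwarz_ineq2 by auto
    also have "\<dots> \<le> (norm (f t))\<^sup>2 + (norm (g t))\<^sup>2"
      using zero_le_power2[of "norm (f t) - norm (g t)"] zero_le_power2[of "norm (f t)"]
        zero_le_power2[of "norm (g t)"]
      unfolding power2_diff by linarith
    finally show ?thesis .
  qed
qed auto

text \<open>The Cauchy-Schwarz inequality against the constant function: expand the square of
  \<open>norm (f r) - m\<close>, where \<open>m\<close> is the mean value of \<open>norm f\<close>.\<close>

lemma integral_norm_sq_le:
  fixes f :: "real \<Rightarrow> 'a::euclidean_space"
  assumes f: "L2_fun T f" and st: "0 \<le> s" "s \<le> t" "t \<le> T"
  shows "(integral {s..t} (\<lambda>r. norm (f r)))\<^sup>2 \<le> (t - s) * integral {s..t} (\<lambda>r. (norm (f r))\<^sup>2)"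
proof (cases "s = t")
  case False
  define m where "m = integral {s..t} (\<lambda>r. norm (f r)) / (t - s)"
  have i1: "(\<lambda>r. norm (f r)) integrable_on {s..t}"
    using integrable_on_subsegment[OF L2_fun_norm_integrable_on[OF f]] st by auto
  have i2: "(\<lambda>r. (norm (f r))\<^sup>2) integrable_on {s..t}"
    using integrable_on_subsegment[OF L2_fun_sq_integrable_on[OF f]] st by auto
  have eq: "(norm (f r) - m)\<^sup>2 = (norm (f r))\<^sup>2 + m\<^sup>2 - 2 * m * norm (f r)" for r
    by (simp add: power2_eq_square algebra_simps)
  have "(\<lambda>r. (norm (f r) - m)\<^sup>2) integrable_on {s..t}"
    unfolding eq by (intro integrable_diff integrable_add integrable_on_mult_right i1 i2) auto
  then have "0 \<le> integral {s..t} (\<lambda>r. (norm (f r) - m)\<^sup>2)"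
    by (rule integral_nonneg) auto
  also have "\<dots> = integral {s..t} (\<lambda>r. (norm (f r))\<^sup>2) + m\<^sup>2 * (t - s)
      - 2 * m * integral {s..t} (\<lambda>r. norm (f r))"
    unfolding eq
    by (intro integral_unique has_integral_diff has_integral_add has_integral_mult_right
        integrable_integral i1 i2) (use st has_integral_const_real[of "m\<^sup>2" s t] in \<open>simp add: mult.commute\<close>)
  also have "integral {s..t} (\<lambda>r. norm (f r)) = m * (t - s)" using False by (simp add: m_def)
  finally have "m\<^sup>2 * (t - s) \<le> integral {s..t} (\<lambda>r. (norm (f r))\<^sup>2)"
    by (simp add: power2_eq_square algebra_simps)
  then have "(t - s) * (m\<^sup>2 * (t - s)) \<le> (t - s) * integral {s..t} (\<lambda>r. (norm (f r))\<^sup>2)"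
    using st by (intro mult_left_mono) auto
  moreover have "(t - s) * (m\<^sup>2 * (t - s)) = (integral {s..t} (\<lambda>r. norm (f r)))\<^sup>2"
    using False by (simp add: m_def power2_eq_square)
  ultimately show ?thesis by simp
qed auto


section \<open>Primitives of square integrable functions\<close>

text \<open>For \<open>0 < T\<close> this says that \<open>u\<close> belongs to \<open>W\<^sup>1\<^sup>,\<^sup>2\<close> and has the weak derivative \<open>g\<close>.  Stated with
  integrals, product rule and energy identities can be proved by integration alone.\<close>

definition L2_primitive ::
    "real \<Rightarrow> (real \<Rightarrow> 'a::euclidean_space) \<Rightarrow> (real \<Rightarrow> 'a) \<Rightarrow> bool" where
  "L2_primitive T g u \<longleftrightarrow> L2_fun T g \<and> (\<forall>t\<in>{0..T}. u t = u 0 + integral {0..t} g)"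

lemma L2_primitive_fun: "L2_primitive T g u \<Longrightarrow> L2_fun T g"
  unfolding L2_primitive_def by blast

lemma L2_primitiveI:
  "L2_fun T g \<Longrightarrow> (\<And>t. t \<in> {0..T} \<Longrightarrow> u t = u 0 + integral {0..t} g) \<Longrightarrow> L2_primitive T g u"
  unfolding L2_primitive_def by blast

lemma L2_primitive_eq: "L2_primitive T g u \<Longrightarrow> t \<in> {0..T} \<Longrightarrow> u t = u 0 + integral {0..t} g"
  unfolding L2_primitive_def by blast

lemma L2_primitive_increment:
  assumes u: "L2_primitive T g u" and st: "0 \<le> s" "s \<le> t" "t \<le> T"
  shows "u t - u s = integral {s..t} g"
proof -
  have "integral {0..s} g + integral {s..t} g = integral {0..t} g"
    using st by (intro Henstock_Kurzweil_Integration.integral_combine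
        integrable_on_subsegment[OF L2_fun_integrable_on[OF L2_primitive_fun[OF u]]]) auto
  moreover have "u t = u 0 + integral {0..t} g" "u s = u 0 + integral {0..s} g"
    using L2_primitive_eq[OF u, of t] L2_primitive_eq[OF u, of s] st by simp_all
  ultimately show ?thesis by (metis add_diff_cancel_left add_diff_cancel_left')
qed

lemma L2_primitive_continuous:
  assumes u: "L2_primitive T g u" shows "continuous_on {0..T} u"
proof -
  have "continuous_on {0..T} (\<lambda>t. u 0 + integral {0..t} g)"
    by (intro continuous_intros indefinite_integral_continuous_1 L2_fun_integrable_on L2_primitive_fun[OF u])
  then show ?thesis by (rule continuous_on_eq) (rule L2_primitive_eq[OF u, symmetric])
qed

lemma L2_primitive_integral:
  "L2_fun T g \<Longrightarrow> L2_primitive T g (\<lambda>t. c + integral {0..t} g)"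
  by (rule L2_primitiveI) auto

lemma L2_primitive_linear:
  fixes A :: "'a::euclidean_space \<Rightarrow> 'b::euclidean_space"
  assumes u: "L2_primitive T g u" and A: "bounded_linear A"
  shows "L2_primitive T (\<lambda>t. A (g t)) (\<lambda>t. A (u t))"
proof -
  interpret bounded_linear A by fact
  have "integral {0..t} (\<lambda>t. A (g t)) = A (integral {0..t} g)" if "t \<in> {0..T}" for t
    using integral_linear[OF integrable_on_subsegment[OF L2_fun_integrable_on[OF L2_primitive_fun[OF u]], of 0 t] A]
      that by (auto simp: o_def)
  then show ?thesis
    by (intro L2_primitiveI L2_fun_linear[OF L2_primitive_fun[OF u] A]) (metis L2_primitive_eq[OF u] add)
qed

lemma L2_primitive_add:
  assumes u: "L2_primitive T f u" and v: "L2_primitive T g v"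
  shows "L2_primitive T (\<lambda>t. f t + g t) (\<lambda>t. u t + v t)"
proof -
  have eq: "integral {0..t} (\<lambda>t. f t + g t) = integral {0..t} f + integral {0..t} g" if "t \<in> {0..T}" for t
    using that by (intro integral_add integrable_on_subsegment[OF L2_fun_integrable_on[OF L2_primitive_fun[OF u]]]
        integrable_on_subsegment[OF L2_fun_integrable_on[OF L2_primitive_fun[OF v]]]) auto
  show ?thesis
  proof (rule L2_primitiveI)
    show "u t + v t = u 0 + v 0 + integral {0..t} (\<lambda>t. f t + g t)" if "t \<in> {0..T}" for t
      using L2_primitive_eq[OF u that] L2_primitive_eq[OF v that] eq[OF that] by simp
  qed (intro L2_fun_add L2_primitive_fun[OF u] L2_primitive_fun[OF v])
qed

lemma L2_primitive_scaleR:
  "L2_primitive T g u \<Longrightarrow> L2_primitive T (\<lambda>t. c *\<^sub>R g t) (\<lambda>t. c *\<^sub>R u t)"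
  by (rule L2_primitive_linear) (auto intro: bounded_linear_scaleR_right)

lemma L2_primitive_diff:
  assumes "L2_primitive T f u" "L2_primitive T g v"
  shows "L2_primitive T (\<lambda>t. f t - g t) (\<lambda>t. u t - v t)"
  using L2_primitive_add[OF assms(1) L2_primitive_scaleR[OF assms(2), of "-1"]] by simp

text \<open>By the Cauchy-Schwarz inequality, primitives whose derivatives are bounded in mean square are
  uniformly Hoelder continuous with exponent one half.\<close>

lemma L2_primitive_increment_sq_le:
  assumes u: "L2_primitive T g u" and st: "0 \<le> s" "s \<le> t" "t \<le> T"
  shows "(norm (u t - u s))\<^sup>2 \<le> (t - s) * integral {0..T} (\<lambda>r. (norm (g r))\<^sup>2)"
proof -
  note g = L2_primitive_fun[OF u]
  have "norm (u t - u s) \<le> integral {s..t} (\<lambda>r. norm (g r))"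
    unfolding L2_primitive_increment[OF u st] using st g
    by (intro integral_norm_bound_integral integrable_on_subsegment[OF L2_fun_integrable_on]
         integrable_on_subsegment[OF L2_fun_norm_integrable_on]) auto
  then have "(norm (u t - u s))\<^sup>2 \<le> (integral {s..t} (\<lambda>r. norm (g r)))\<^sup>2"
    by (intro power_mono) auto
  also have "\<dots> \<le> (t - s) * integral {s..t} (\<lambda>r. (norm (g r))\<^sup>2)"
    by (rule integral_norm_sq_le[OF g st])
  also have "\<dots> \<le> (t - s) * integral {0..T} (\<lambda>r. (norm (g r))\<^sup>2)"
    using st L2_fun_sq_integrable_on[OF g] integrable_on_subsegment[OF L2_fun_sq_integrable_on[OF g]]
    by (intro mult_left_mono integral_subset_le) auto
  finally show ?thesis .
qed

text \<open>Summing the hypothesis over a fine partition bounds the total increment of \<open>D\<close> by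
  \<open>e\<close> times that of \<open>K\<close>, for every \<open>e\<close>.\<close>

lemma locally_small_increments_imp_eq:
  fixes D :: "real \<Rightarrow> 'b::real_normed_vector" and K :: "real \<Rightarrow> real"
  assumes ab: "a \<le> b"
    and loc: "\<And>e. e > 0 \<Longrightarrow> \<exists>d>0. \<forall>s t. a \<le> s \<longrightarrow> s \<le> t \<longrightarrow> t \<le> b \<longrightarrow> t - s < d \<longrightarrow>
                norm (D t - D s) \<le> e * (K t - K s)"
  shows "D b = D a"
proof -
  have *: "norm (D b - D a) \<le> e * (K b - K a)" if e: "e > 0" for e
  proof -
    obtain d where d: "d > 0" "\<And>s t. a \<le> s \<Longrightarrow> s \<le> t \<Longrightarrow> t \<le> b \<Longrightarrow> t - s < d \<Longrightarrow>
        norm (D t - D s) \<le> e * (K t - K s)" using loc[OF e] by blast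
    obtain n :: nat where n: "n > 0" "(b - a) / d < real n"
      using reals_Archimedean2[of "max 1 ((b - a) / d)"]
      by (metis less_trans max_less_iff_conj of_nat_0_less_iff zero_less_one)
    define P where "P i = a + real i * ((b - a) / real n)" for i
    have "(b - a) / real n < d" "0 \<le> (b - a) / real n"
      using n d(1) ab by (auto simp: field_simps)
    moreover have "P (Suc i) = P i + (b - a) / real n" for i
      unfolding P_def of_nat_Suc distrib_right by linarith
    moreover have "a \<le> P i" for i using ab by (simp add: P_def)
    ultimately have step: "P (Suc i) - P i < d" "P i \<le> P (Suc i)" "a \<le> P i" for i
      by simp_all
    have Pb: "P i \<le> b" if "i \<le> n" for i
    proof -
      have "real i * ((b - a) / real n) \<le> real n * ((b - a) / real n)"
        using that ab by (intro mult_right_mono) auto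
      then show ?thesis using n by (simp add: P_def)
    qed
    have "norm (D (P i) - D a) \<le> e * (K (P i) - K a)" if "i \<le> n" for i
      using that
    proof (induction i)
      case (Suc i)
      have "norm (D (P (Suc i)) - D (P i)) \<le> e * (K (P (Suc i)) - K (P i))"
        using step Pb[of "Suc i"] Suc.prems by (intro d) auto
      moreover have "norm (D (P i) - D a) \<le> e * (K (P i) - K a)" using Suc by simp
      moreover have "norm (D (P (Suc i)) - D a) \<le> norm (D (P (Suc i)) - D (P i)) + norm (D (P i) - D a)"
        using norm_triangle_ineq[of "D (P (Suc i)) - D (P i)" "D (P i) - D a"] by simp
      ultimately show ?case by (simp add: algebra_simps)
    qed (simp add: P_def)
    from this[of n] show ?thesis using n by (simp add: P_def)
  qed
  have "norm (D b - D a) \<le> 0 + e" if "e > 0" for e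
  proof -
    have "norm (D b - D a) \<le> e / (1 + \<bar>K b - K a\<bar>) * (K b - K a)" by (rule *) (use that in auto)
    also have "\<dots> \<le> e / (1 + \<bar>K b - K a\<bar>) * (1 + \<bar>K b - K a\<bar>)"
      using that by (intro mult_left_mono) auto
    finally show ?thesis by simp
  qed
  then have "norm (D b - D a) \<le> 0" by (rule field_le_epsilon)
  then show ?thesis by simp
qed

text \<open>On a short interval the two sides differ by integrals of the derivatives against oscillations
  of \<open>u\<close> and \<open>v\<close>, which uniform continuity makes small.\<close>

lemma L2_primitive_product_rule:
  fixes u :: "real \<Rightarrow> 'a::euclidean_space" and v :: "real \<Rightarrow> 'b::euclidean_space"
    and prod :: "'a \<Rightarrow> 'b \<Rightarrow> 'c::euclidean_space"
  assumes "bounded_bilinear prod" and u: "L2_primitive T f u" and v: "L2_primitive T g v"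
  shows "(\<lambda>r. prod (f r) (v r) + prod (u r) (g r)) integrable_on {0..T}"
    and "0 \<le> t \<Longrightarrow> t \<le> T \<Longrightarrow>
      prod (u t) (v t) - prod (u 0) (v 0) = integral {0..t} (\<lambda>r. prod (f r) (v r) + prod (u r) (g r))"
proof -
  interpret bounded_bilinear prod by fact
  have bl: "bilinear prod" by (simp add: bilinear_conv_bounded_bilinear bounded_bilinear_axioms)
  have bl': "bilinear (\<lambda>x y. prod y x)"
    by (simp add: bilinear_conv_bounded_bilinear bounded_bilinear.flip bounded_bilinear_axioms)
  obtain B where B: "\<And>a b. norm (prod a b) \<le> norm a * norm b * B" "B > 0" using pos_bounded by blast
  note f = L2_primitive_fun[OF u] and g = L2_primitive_fun[OF v]
  note cu = L2_primitive_continuous[OF u] and cv = L2_primitive_continuous[OF v]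
  have bdd: "bounded (u ` {0..T})" "bounded (v ` {0..T})"
    using cu cv by (auto intro!: compact_imp_bounded compact_continuous_image)
  have i1: "(\<lambda>r. prod (f r) (v r)) integrable_on {0..T}"
    using absolutely_integrable_bounded_measurable_product[OF bl' _ _ bdd(2) L2_fun_absolutely_integrable[OF f]]
      L2_fun_measurable[OF L2_fun_continuous[OF cv]] by (auto simp: absolutely_integrable_on_def)
  have i2: "(\<lambda>r. prod (u r) (g r)) integrable_on {0..T}"
    using absolutely_integrable_bounded_measurable_product[OF bl _ _ bdd(1) L2_fun_absolutely_integrable[OF g]]
      L2_fun_measurable[OF L2_fun_continuous[OF cu]] by (auto simp: absolutely_integrable_on_def)
  show int: "(\<lambda>r. prod (f r) (v r) + prod (u r) (g r)) integrable_on {0..T}"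
    by (intro integrable_add i1 i2)
  define N where "N = (\<lambda>r. norm (f r) + norm (g r))"
  have iN: "N integrable_on {0..T}"
    unfolding N_def by (intro integrable_add L2_fun_norm_integrable_on f g)
  define D where "D = (\<lambda>t. prod (u t) (v t) - integral {0..t} (\<lambda>r. prod (f r) (v r) + prod (u r) (g r)))"
  define K where "K = (\<lambda>t. B * integral {0..t} N)"
  assume t: "0 \<le> t" "t \<le> T"
  have "D t = D 0"
  proof (rule locally_small_increments_imp_eq[where K = K])
    fix e :: real assume "e > 0"
    obtain d1 where d1: "d1 > 0" "\<And>x y. x \<in> {0..T} \<Longrightarrow> y \<in> {0..T} \<Longrightarrow> dist y x < d1 \<Longrightarrow> dist (u y) (u x) < e"
      using compact_uniformly_continuous[OF cu] \<open>e > 0\<close> unfolding uniformly_continuous_on_def by force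
    obtain d2 where d2: "d2 > 0" "\<And>x y. x \<in> {0..T} \<Longrightarrow> y \<in> {0..T} \<Longrightarrow> dist y x < d2 \<Longrightarrow> dist (v y) (v x) < e"
      using compact_uniformly_continuous[OF cv] \<open>e > 0\<close> unfolding uniformly_continuous_on_def by force
    show "\<exists>d>0. \<forall>s r. 0 \<le> s \<longrightarrow> s \<le> r \<longrightarrow> r \<le> t \<longrightarrow> r - s < d \<longrightarrow> norm (D r - D s) \<le> e * (K r - K s)"
    proof (intro exI[of _ "min d1 d2"] conjI allI impI)
      fix s r assume sr: "0 \<le> s" "s \<le> r" "r \<le> t" "r - s < min d1 d2"
      have sub: "{s..r} \<subseteq> {0..T}" using sr t by auto
      have ii: "f integrable_on {s..r}" "g integrable_on {s..r}" "N integrable_on {s..r}"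
        "(\<lambda>q. prod (f q) (v q)) integrable_on {s..r}" "(\<lambda>q. prod (u q) (g q)) integrable_on {s..r}"
        "(\<lambda>r. prod (f r) (v r) + prod (u r) (g r)) integrable_on {s..r}"
        using integrable_on_subinterval[OF _ sub] L2_fun_integrable_on[OF f] L2_fun_integrable_on[OF g]
          iN i1 i2 int by blast+
      have iA: "(\<lambda>q. prod (f q) (v r)) integrable_on {s..r}" "(\<lambda>q. prod (u s) (g q)) integrable_on {s..r}"
        using integrable_linear[OF ii(1) bounded_linear_left] integrable_linear[OF ii(2) bounded_linear_right]
        by (auto simp: o_def)
      have "prod (u r) (v r) - prod (u s) (v s) = prod (u r - u s) (v r) + prod (u s) (v r - v s)"
        by (simp add: diff_left diff_right)
      also have "\<dots> = integral {s..r} (\<lambda>q. prod (f q) (v r)) + integral {s..r} (\<lambda>q. prod (u s) (g q))"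
        using L2_primitive_increment[OF u, of s r] L2_primitive_increment[OF v, of s r] sr t
          integral_linear[OF ii(1) bounded_linear_left] integral_linear[OF ii(2) bounded_linear_right]
        by (simp add: o_def)
      finally have e1: "prod (u r) (v r) - prod (u s) (v s) = \<dots>" .
      have "integral {0..s} (\<lambda>r. prod (f r) (v r) + prod (u r) (g r))
          + integral {s..r} (\<lambda>r. prod (f r) (v r) + prod (u r) (g r))
          = integral {0..r} (\<lambda>r. prod (f r) (v r) + prod (u r) (g r))"
        using sr t by (intro Henstock_Kurzweil_Integration.integral_combine integrable_on_subsegment[OF int]) auto
      then have "D r - D s = integral {s..r} (\<lambda>q. prod (f q) (v r)) + integral {s..r} (\<lambda>q. prod (u s) (g q))
          - integral {s..r} (\<lambda>r. prod (f r) (v r) + prod (u r) (g r))"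
        unfolding D_def using e1 by (simp add: algebra_simps)
      also have "\<dots> = integral {s..r} (\<lambda>q. (prod (f q) (v r) + prod (u s) (g q)) - (prod (f q) (v q) + prod (u q) (g q)))"
        using ii iA by (simp add: integral_diff integral_add integrable_add)
      also have "norm \<dots> \<le> integral {s..r} (\<lambda>q. e * B * N q)"
      proof (rule integral_norm_bound_integral)
        show "(\<lambda>q. (prod (f q) (v r) + prod (u s) (g q)) - (prod (f q) (v q) + prod (u q) (g q))) integrable_on {s..r}"
          by (intro integrable_diff integrable_add ii iA)
        show "(\<lambda>q. e * B * N q) integrable_on {s..r}" using ii(3) by (rule integrable_on_mult_right)
        fix q assume q: "q \<in> {s..r}"
        have nv: "norm (v r - v q) \<le> e" "norm (u s - u q) \<le> e"
          using d1(2)[of q s] d2(2)[of q r] q sr t by (auto simp: dist_norm norm_minus_commute)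
        have "(prod (f q) (v r) + prod (u s) (g q)) - (prod (f q) (v q) + prod (u q) (g q))
            = prod (f q) (v r - v q) + prod (u s - u q) (g q)"
          by (simp add: diff_left diff_right)
        also have "norm \<dots> \<le> norm (f q) * norm (v r - v q) * B + norm (u s - u q) * norm (g q) * B"
          by (intro order_trans[OF norm_triangle_ineq] add_mono B)
        also have "\<dots> \<le> norm (f q) * e * B + e * norm (g q) * B"
          using nv B by (intro add_mono mult_right_mono mult_left_mono) auto
        finally show "norm ((prod (f q) (v r) + prod (u s) (g q)) - (prod (f q) (v q) + prod (u q) (g q)))
            \<le> e * B * N q" by (simp add: N_def algebra_simps)
      qed
      also have "\<dots> = e * (B * integral {s..r} N)" by simp
      also have "\<dots> = e * (K r - K s)"
      proof -
        have "integral {0..s} N + integral {s..r} N = integral {0..r} N"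
          using sr t by (intro Henstock_Kurzweil_Integration.integral_combine integrable_on_subsegment[OF iN]) auto
        then show ?thesis unfolding K_def by (simp add: algebra_simps flip: \<open>_ = integral {0..r} N\<close>)
      qed
      finally show "norm (D r - D s) \<le> e * (K r - K s)" .
    qed (use d1 d2 in auto)
  qed (use t in auto)
  then show "prod (u t) (v t) - prod (u 0) (v 0) = integral {0..t} (\<lambda>r. prod (f r) (v r) + prod (u r) (g r))"
    by (simp add: D_def algebra_simps)
qed

lemma L2_primitive_norm_sq:
  fixes u :: "real \<Rightarrow> 'a::euclidean_space"
  assumes u: "L2_primitive T f u" and t: "0 \<le> t" "t \<le> T"
  shows "(norm (u t))\<^sup>2 - (norm (u 0))\<^sup>2 = 2 * integral {0..t} (\<lambda>r. f r \<bullet> u r)"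
proof -
  have "u t \<bullet> u t - u 0 \<bullet> u 0 = integral {0..t} (\<lambda>r. f r \<bullet> u r + u r \<bullet> f r)"
    by (rule L2_primitive_product_rule(2)[OF bounded_bilinear_inner u u t])
  also have "\<dots> = integral {0..t} (\<lambda>r. 2 * (f r \<bullet> u r))" by (simp add: inner_commute)
  finally show ?thesis by (simp add: power2_norm_eq_inner)
qed


section \<open>Weak derivatives of functions of one variable\<close>

text \<open>Test with the primitive of \<open>\<rho> (w - m)\<close>, where \<open>\<rho>\<close> is a tent vanishing near both end
  points and \<open>m\<close> is the \<open>\<rho>\<close>-weighted mean of \<open>w\<close>: the outcome is that the \<open>\<rho>\<close>-weighted
  variance of \<open>w\<close> is zero.\<close>

lemma du_Bois_Reymond:
  fixes w :: "real \<Rightarrow> real"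
  assumes T: "0 < T" and cw: "continuous_on {0..T} w"
    and orth: "\<And>\<psi>. test_fun T \<psi> \<Longrightarrow> integral {0..T} (\<lambda>t. deriv \<psi> t * w t) = 0"
    and t: "t \<in> {0..T}"
  shows "w t = w 0"
proof -
  define W where "W = (\<lambda>t. w (max 0 (min t T)))"
  have cW: "continuous_on UNIV W"
    unfolding W_def by (rule continuous_on_compose2[OF cw]) (use T in \<open>auto intro!: continuous_intros\<close>)
  have Ww: "W t = w t" if "t \<in> {0..T}" for t using that by (simp add: W_def)
  have interior: "\<exists>m. \<forall>t. \<delta> < t \<longrightarrow> t < T - \<delta> \<longrightarrow> W t = m" if \<delta>: "0 < \<delta>" "2 * \<delta> < T" for \<delta>
  proof -
    define \<rho> where "\<rho> = (\<lambda>t. max 0 (min (t - \<delta>) (T - \<delta> - t)))"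
    have c\<rho>: "continuous_on A \<rho>" for A unfolding \<rho>_def by (intro continuous_intros)
    have cWA: "continuous_on A W" for A using cW continuous_on_subset by blast
    have \<rho>0: "\<rho> t \<ge> 0" for t by (simp add: \<rho>_def)
    have I: "f integrable_on {a..b}" if "continuous_on UNIV f" for a b and f :: "real \<Rightarrow> real"
      using that by (meson continuous_on_subset integrable_continuous_real subset_UNIV)
    have pos: "integral {0..T} \<rho> > 0"
    proof -
      have "integral {0..T} \<rho> \<noteq> 0"
      proof
        assume "integral {0..T} \<rho> = 0"
        then have "\<forall>x\<in>{0..T}. \<rho> x = 0"
          using integral_cbox_eq_0_iff[of 0 T \<rho>] c\<rho> \<rho>0 T by auto
        then have "\<rho> (T / 2) = 0" using T by auto
        then show False using \<delta> by (simp add: \<rho>_def)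
      qed
      moreover have "integral {0..T} \<rho> \<ge> 0" by (rule integral_nonneg) (auto intro: I c\<rho> \<rho>0)
      ultimately show ?thesis by simp
    qed
    define m where "m = integral {0..T} (\<lambda>t. \<rho> t * W t) / integral {0..T} \<rho>"
    define \<theta> where "\<theta> = (\<lambda>t. \<rho> t * (W t - m))"
    have c\<theta>: "continuous_on A \<theta>" for A unfolding \<theta>_def by (intro continuous_intros c\<rho> cWA)
    have i1: "(\<lambda>t. \<rho> t * W t) integrable_on {0..T}" "(\<lambda>t. \<rho> t * m) integrable_on {0..T}"
      by (intro I continuous_intros c\<rho> cWA)+
    have int\<theta>: "integral {0..T} \<theta> = 0"
    proof -
      have "integral {0..T} \<theta> = integral {0..T} (\<lambda>t. \<rho> t * W t - \<rho> t * m)"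
        by (simp add: \<theta>_def right_diff_distrib)
      also have "\<dots> = integral {0..T} (\<lambda>t. \<rho> t * W t) - integral {0..T} \<rho> * m"
        using i1 by (simp add: integral_diff)
      finally show ?thesis using pos by (simp add: m_def)
    qed
    have \<theta>0: "\<theta> t = 0" if "t \<le> \<delta> \<or> T - \<delta> \<le> t" for t using that by (auto simp: \<theta>_def \<rho>_def)
    define \<psi> where "\<psi> t = integral {0..t} \<theta>" for t
    have \<psi>l: "\<psi> t = 0" if "t \<le> \<delta>" for t
    proof -
      have "integral {0..t} \<theta> = integral {0..t} (\<lambda>x. 0)"
        using that \<theta>0 by (intro integral_cong) auto
      then show ?thesis by (simp add: \<psi>_def)
    qed
    have \<psi>r: "\<psi> t = 0" if "T - \<delta> \<le> t" for t
    proof (cases "t \<le> T")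
      case True
      have "integral {0..t} \<theta> + integral {t..T} \<theta> = integral {0..T} \<theta>"
        using that \<delta> True by (intro Henstock_Kurzweil_Integration.integral_combine I c\<theta>) auto
      moreover have "integral {t..T} \<theta> = integral {t..T} (\<lambda>x. 0)"
        using that \<theta>0 by (intro integral_cong) auto
      ultimately show ?thesis by (simp add: \<psi>_def int\<theta>)
    next
      case False
      have "integral {0..T} \<theta> + integral {T..t} \<theta> = integral {0..t} \<theta>"
        using T False by (intro Henstock_Kurzweil_Integration.integral_combine I c\<theta>) auto
      moreover have "integral {T..t} \<theta> = integral {T..t} (\<lambda>x. 0)"
        using \<delta> \<theta>0 by (intro integral_cong) auto
      ultimately show ?thesis by (simp add: \<psi>_def int\<theta>)
    qed
    have der: "(\<psi> has_real_derivative \<theta> t) (at t)" for t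
    proof (cases "t < \<delta>")
      case True
      have "((\<lambda>_. 0) has_real_derivative \<theta> t) (at t)" using \<theta>0[of t] True by simp
      then show ?thesis
        by (rule DERIV_cong_ev[OF refl _ refl, THEN iffD1, rotated])
           (use True \<psi>l eventually_nhds_in_open[of "{..<\<delta>}" t] in \<open>auto elim!: eventually_mono\<close>)
    next
      case False
      then have "(\<psi> has_real_derivative \<theta> t) (at t within {0..t+1})"
        unfolding \<psi>_def using \<delta> by (intro integral_has_real_derivative c\<theta>) auto
      then show ?thesis
        using False \<delta> by (subst (asm) at_within_Icc_at) auto
    qed
    have "test_fun T \<psi>"
      unfolding test_fun_def
    proof
      show "\<psi> C1_differentiable_on UNIV"
        unfolding C1_differentiable_on_def
        using der c\<theta> by (auto simp: has_real_derivative_iff_has_vector_derivative)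
      have "{t. \<psi> t \<noteq> 0} \<subseteq> {\<delta>..T-\<delta>}"
      proof
        fix t assume "t \<in> {t. \<psi> t \<noteq> 0}"
        then have "\<not> t \<le> \<delta>" "\<not> T - \<delta> \<le> t" using \<psi>l[of t] \<psi>r[of t] by auto
        then show "t \<in> {\<delta>..T-\<delta>}" by simp
      qed
      then have "closure {t. \<psi> t \<noteq> 0} \<subseteq> {\<delta>..T-\<delta>}" by (intro closure_minimal) auto
      then show "closure {t. \<psi> t \<noteq> 0} \<subseteq> {0<..<T}" using \<delta> by auto
    qed
    from orth[OF this] have "integral {0..T} (\<lambda>t. \<theta> t * w t) = 0"
      using ext[of "deriv \<psi>" \<theta>, OF DERIV_imp_deriv[OF der]] by simp
    then have "integral {0..T} (\<lambda>t. \<theta> t * W t) = 0"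
      by (rule trans[OF integral_cong, rotated]) (simp add: Ww)
    then have "integral {0..T} (\<lambda>t. \<theta> t * W t - \<theta> t * m) = 0"
      using int\<theta> by (subst integral_diff) (auto intro!: I continuous_intros c\<theta> cWA)
    then have "integral {0..T} (\<lambda>t. \<rho> t * (W t - m)\<^sup>2) = 0"
      by (simp add: \<theta>_def power2_eq_square algebra_simps)
    moreover have "continuous_on (cbox 0 T) (\<lambda>t. \<rho> t * (W t - m)\<^sup>2)"
      by (intro continuous_intros c\<rho> cWA)
    ultimately have "\<forall>t\<in>{0..T}. \<rho> t * (W t - m)\<^sup>2 = 0"
      using integral_cbox_eq_0_iff[of 0 T "\<lambda>t. \<rho> t * (W t - m)\<^sup>2"] T \<rho>0
      by (simp add: mult_nonneg_nonneg)
    moreover have "\<rho> t \<noteq> 0" "t \<in> {0..T}" if "\<delta> < t" "t < T - \<delta>" for t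
      using that \<delta> by (auto simp: \<rho>_def)
    ultimately show ?thesis by (intro exI[of _ m] allI impI) (metis mult_eq_0_iff power_eq_0_iff right_minus_eq)
  qed
  have const: "W s = W (T / 2)" if "s \<in> {0<..<T}" for s
  proof -
    define \<delta> where "\<delta> = min s (T - s) / 2"
    have d: "0 < \<delta>" "2 * \<delta> < T" "\<delta> < s" "s < T - \<delta>" "\<delta> < T / 2" "T / 2 < T - \<delta>"
      using that by (auto simp: \<delta>_def min_def field_simps)
    obtain m where m: "\<forall>t. \<delta> < t \<longrightarrow> t < T - \<delta> \<longrightarrow> W t = m" using interior[OF d(1,2)] by blast
    show ?thesis
      using m[rule_format, of s, OF d(3,4)] m[rule_format, of "T / 2", OF d(5,6)] by (rule trans[OF _ sym])
  qed
  have "W s = W (T / 2)" if "s \<in> {0..T}" for s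
  proof (rule continuous_constant_on_closure[of "{0<..<T}" W])
    show "continuous_on (closure {0<..<T}) W" using cW continuous_on_subset by blast
    show "s \<in> closure {0<..<T}" using that T by simp
  qed (rule const)
  then show ?thesis using Ww t T by (metis atLeastAtMost_iff less_imp_le order_refl)
qed

lemma test_fun_primitive:
  assumes T: "0 < T" and \<psi>: "test_fun T \<psi>"
  shows "L2_primitive T (deriv \<psi>) \<psi>" "\<psi> 0 = 0" "\<psi> T = 0"
proof -
  from \<psi> obtain D where D: "\<And>x. (\<psi> has_vector_derivative D x) (at x)" "continuous_on UNIV D"
    unfolding test_fun_def C1_differentiable_on_def by auto
  have dD: "deriv \<psi> = D"
    using D(1) by (auto intro!: DERIV_imp_deriv simp: has_real_derivative_iff_has_vector_derivative)
  have cD: "continuous_on {0..T} D" using D(2) continuous_on_subset by blast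
  show "\<psi> 0 = 0" "\<psi> T = 0"
  proof -
    have "0 \<notin> closure {t. \<psi> t \<noteq> 0}" "T \<notin> closure {t. \<psi> t \<noteq> 0}"
      using \<psi> unfolding test_fun_def by auto
    then show "\<psi> 0 = 0" "\<psi> T = 0" using closure_subset[of "{t. \<psi> t \<noteq> 0}"] by auto
  qed
  show "L2_primitive T (deriv \<psi>) \<psi>"
    unfolding dD
  proof (rule L2_primitiveI[OF L2_fun_continuous[OF cD]])
    fix t assume t: "t \<in> {0..T}"
    have "(D has_integral (\<psi> t - \<psi> 0)) {0..t}"
      using t by (intro fundamental_theorem_of_calculus) (auto intro: has_vector_derivative_at_within D)
    then show "\<psi> t = \<psi> 0 + integral {0..t} D" by (simp add: integral_unique)
  qed
qed

lemma L2_primitive_imp_weak_deriv: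
  fixes u :: "real \<Rightarrow> 'a::euclidean_space"
  assumes T: "0 < T" and u: "L2_primitive T g u"
  shows "weak_deriv T u g"
  unfolding weak_deriv_def
proof (intro allI impI)
  fix \<psi> assume \<psi>: "test_fun T \<psi>"
  note p = test_fun_primitive[OF T \<psi>]
  have bl: "bounded_bilinear (scaleR :: real \<Rightarrow> 'a \<Rightarrow> 'a)" by (rule bounded_bilinear_scaleR)
  have bl1: "bilinear (\<lambda>x y. y *\<^sub>R x :: 'a)"
    by (simp add: bilinear_conv_bounded_bilinear bounded_bilinear.flip[OF bl])
  have bl2: "bilinear (scaleR :: real \<Rightarrow> 'a \<Rightarrow> 'a)"
    by (simp add: bilinear_conv_bounded_bilinear bl)
  have A1: "(\<lambda>t. deriv \<psi> t *\<^sub>R u t) absolutely_integrable_on {0..T}"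
    by (rule absolutely_integrable_bounded_measurable_product[OF bl1])
       (use L2_primitive_continuous[OF u] L2_fun_absolutely_integrable[OF L2_primitive_fun[OF p(1)]]
         L2_fun_measurable[OF L2_fun_continuous[OF L2_primitive_continuous[OF u]]] in
         \<open>auto intro: compact_imp_bounded compact_continuous_image\<close>)
  have A2: "(\<lambda>t. \<psi> t *\<^sub>R g t) absolutely_integrable_on {0..T}"
    by (rule absolutely_integrable_bounded_measurable_product[OF bl2])
       (use L2_primitive_continuous[OF p(1)] L2_fun_absolutely_integrable[OF L2_primitive_fun[OF u]]
         L2_fun_measurable[OF L2_fun_continuous[OF L2_primitive_continuous[OF p(1)]]] in
         \<open>auto intro: compact_imp_bounded compact_continuous_image\<close>)
  have "integral {0..T} (\<lambda>r. deriv \<psi> r *\<^sub>R u r + \<psi> r *\<^sub>R g r) = 0"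
    using L2_primitive_product_rule(2)[OF bl p(1) u, of T] p T by simp
  then have "integral {0..T} (\<lambda>r. deriv \<psi> r *\<^sub>R u r) = - integral {0..T} (\<lambda>r. \<psi> r *\<^sub>R g r)"
    using A1 A2 by (subst (asm) integral_add) (auto simp: absolutely_integrable_on_def add_eq_0_iff2)
  then show "(LINT t|lebesgue_on {0..T}. deriv \<psi> t *\<^sub>R u t) = - (LINT t|lebesgue_on {0..T}. \<psi> t *\<^sub>R g t)"
    using A1 A2 by (simp add: lebesgue_integral_eq_integral absolutely_integrable_imp_integrable)
qed

text \<open>Subtracting the primitive of \<open>g\<close> from \<open>u\<close> leaves a function with weak derivative zero, to whose
  components the lemma of du Bois-Reymond applies.\<close>

lemma weak_deriv_imp_L2_primitive:
  fixes u :: "real \<Rightarrow> 'a::euclidean_space"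
  assumes T: "0 < T" and cu: "continuous_on {0..T} u" and g: "L2_fun T g" and ug: "weak_deriv T u g"
  shows "L2_primitive T g u"
proof -
  define G where "G = (\<lambda>t. (0::'a) + integral {0..t} g)"
  have G: "L2_primitive T g G" unfolding G_def by (rule L2_primitive_integral[OF g])
  define v where "v = (\<lambda>t. u t - G t)"
  have cG: "continuous_on {0..T} G" by (rule L2_primitive_continuous[OF G])
  have cv: "continuous_on {0..T} v" unfolding v_def by (intro continuous_intros cu cG)
  have bl1: "bilinear (\<lambda>x y. y *\<^sub>R x :: 'a)"
    by (simp add: bilinear_conv_bounded_bilinear bounded_bilinear.flip[OF bounded_bilinear_scaleR])
  have v0: "v t = v 0" if t: "t \<in> {0..T}" for t
  proof (rule euclidean_eqI)
    fix b :: 'a assume b: "b \<in> Basis"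
    show "v t \<bullet> b = v 0 \<bullet> b"
    proof (rule du_Bois_Reymond[OF T _ _ t, of "\<lambda>t. v t \<bullet> b"])
      show "continuous_on {0..T} (\<lambda>t. v t \<bullet> b)" by (intro continuous_intros cv)
      fix \<psi> assume \<psi>: "test_fun T \<psi>"
      note p = test_fun_primitive[OF T \<psi>]
      have A: "(\<lambda>t. deriv \<psi> t *\<^sub>R z t) absolutely_integrable_on {0..T}"
        if "continuous_on {0..T} z" for z :: "real \<Rightarrow> 'a"
        by (rule absolutely_integrable_bounded_measurable_product[OF bl1])
          (use that L2_fun_absolutely_integrable[OF L2_primitive_fun[OF p(1)]]
           L2_fun_measurable[OF L2_fun_continuous[OF that]] in
           \<open>auto intro: compact_imp_bounded compact_continuous_image\<close>)
      note Ai = A[THEN absolutely_integrable_imp_integrable]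
      have "(LINT t|lebesgue_on {0..T}. deriv \<psi> t *\<^sub>R u t) = (LINT t|lebesgue_on {0..T}. deriv \<psi> t *\<^sub>R G t)"
        using ug L2_primitive_imp_weak_deriv[OF T G] \<psi> unfolding weak_deriv_def by simp
      then have e: "integral {0..T} (\<lambda>t. deriv \<psi> t *\<^sub>R u t) = integral {0..T} (\<lambda>t. deriv \<psi> t *\<^sub>R G t)"
        using Ai[OF cu] Ai[OF cG] by (simp add: lebesgue_integral_eq_integral)
      have "integral {0..T} (\<lambda>t. deriv \<psi> t *\<^sub>R v t)
          = integral {0..T} (\<lambda>t. deriv \<psi> t *\<^sub>R u t) - integral {0..T} (\<lambda>t. deriv \<psi> t *\<^sub>R G t)"
        unfolding v_def scaleR_diff_right
        using A[OF cu] A[OF cG] by (intro integral_diff) (auto simp: absolutely_integrable_on_def)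
      then have "integral {0..T} (\<lambda>t. deriv \<psi> t *\<^sub>R v t) = 0" using e by simp
      moreover have "integral {0..T} (\<lambda>t. (deriv \<psi> t *\<^sub>R v t) \<bullet> b) = integral {0..T} (\<lambda>t. deriv \<psi> t *\<^sub>R v t) \<bullet> b"
        using integral_linear[OF _ bounded_linear_inner_left, of "\<lambda>t. deriv \<psi> t *\<^sub>R v t" "{0..T}" b] A[OF cv]
        by (simp add: o_def absolutely_integrable_on_def)
      ultimately show "integral {0..T} (\<lambda>t. deriv \<psi> t * (v t \<bullet> b)) = 0" by simp
    qed
  qed
  then have "u t = u 0 + integral {0..t} g" if "t \<in> {0..T}" for t
  proof -
    have "u t - integral {0..t} g = u 0" using v0[OF that] by (simp add: v_def G_def)
    then show ?thesis by (simp add: diff_eq_eq)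
  qed
  then show ?thesis by (rule L2_primitiveI[OF g])
qed

lemma W12_imp_L2_primitive:
  assumes "0 < T" "W12 T u" shows "L2_primitive T (wderiv T u) u"
proof -
  have "\<exists>g. L2_fun T g \<and> weak_deriv T u g" using assms by (simp add: W12_def)
  then have "L2_fun T (wderiv T u) \<and> weak_deriv T u (wderiv T u)"
    unfolding wderiv_def by (rule someI_ex)
  moreover have "continuous_on {0..T} u" using assms by (simp add: W12_def)
  ultimately show ?thesis using weak_deriv_imp_L2_primitive[OF assms(1)] by blast
qed

lemma L2_primitive_imp_W12:
  assumes "0 < T" "L2_primitive T g u" shows "W12 T u"
  unfolding W12_def
  using assms L2_primitive_imp_weak_deriv L2_primitive_continuous L2_primitive_fun by blast


section \<open>Recovering an integrand from its integrals over intervals\<close>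

lemma AE_lebesgue_onI_negligible:
  fixes P :: "real \<Rightarrow> bool"
  shows "negligible N \<Longrightarrow> (\<And>t. t \<in> {0..T} \<Longrightarrow> t \<notin> N \<Longrightarrow> P t) \<Longrightarrow> AE t in lebesgue_on {0..T}. P t"
  by (auto simp: AE_restrict_space_iff negligible_iff_null_sets intro!: AE_I'[of N])

text \<open>At almost every point, \<open>f\<close> is the limit of its means over short intervals to the right.\<close>

lemma AE_nonneg_if_integrals_nonneg:
  fixes f :: "real \<Rightarrow> real"
  assumes f: "f integrable_on {0..T}"
    and nn: "\<And>s t. 0 \<le> s \<Longrightarrow> s \<le> t \<Longrightarrow> t \<le> T \<Longrightarrow> 0 \<le> integral {s..t} f"
  shows "AE t in lebesgue_on {0..T}. 0 \<le> f t"
proof -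
  define F where "F = (\<lambda>t. if t \<in> {0..T} then f t else 0)"
  have "F integrable_on UNIV" unfolding F_def using f integrable_restrict_UNIV by blast
  then have "F integrable_on cbox a b" for a b using integrable_on_subcbox by blast
  then obtain N where N: "negligible N" "\<And>x e. \<lbrakk>x \<notin> N; 0 < e\<rbrakk> \<Longrightarrow>
      \<exists>d>0. \<forall>h. 0 < h \<and> h < d \<longrightarrow> norm (integral (cbox x (x + h *\<^sub>R One)) F /\<^sub>R h ^ DIM(real) - F x) < e"
    using integrable_ccontinuous_explicit[of F] by metis
  show ?thesis
  proof (rule AE_lebesgue_onI_negligible[of "insert T N"])
    show "negligible (insert T N)" using N(1) by simp
    fix x assume x: "x \<in> {0..T}" "x \<notin> insert T N"
    show "0 \<le> f x"
    proof (rule ccontr)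
      assume neg: "\<not> 0 \<le> f x"
      then obtain d where d: "d > 0" "\<And>h. 0 < h \<Longrightarrow> h < d \<Longrightarrow>
          norm (integral (cbox x (x + h *\<^sub>R One)) F /\<^sub>R h ^ DIM(real) - F x) < - f x"
        using N(2)[of x "- f x"] x by auto
      define h where "h = min d (T - x) / 2"
      have h: "0 < h" "h < d" "x + h \<le> T" using d(1) x by (auto simp: h_def min_def field_simps)
      have "integral {x..x+h} F = integral {x..x+h} f"
        using h x by (intro integral_cong) (auto simp: F_def)
      then have "0 \<le> integral {x..x+h} F" using nn[of x "x + h"] h x by simp
      moreover have "\<bar>integral {x..x+h} F / h - f x\<bar> < - f x"
        using d(2)[OF h(1,2)] x by (simp add: F_def divide_inverse mult.commute)
      ultimately show False using h(1) by (smt (verit) divide_nonneg_pos)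
    qed
  qed
qed

lemma AE_zero_if_integrals_zero:
  fixes f :: "real \<Rightarrow> 'a::euclidean_space"
  assumes f: "f integrable_on {0..T}" and z: "\<And>t. 0 \<le> t \<Longrightarrow> t \<le> T \<Longrightarrow> integral {0..t} f = 0"
  shows "AE t in lebesgue_on {0..T}. f t = 0"
proof -
  have zz: "integral {s..t} f = 0" if "0 \<le> s" "s \<le> t" "t \<le> T" for s t
    using Henstock_Kurzweil_Integration.integral_combine[OF that(1,2) integrable_on_subsegment[OF f]] z[of s] z[of t] that by simp
  have comp: "AE t in lebesgue_on {0..T}. 0 \<le> c * (f t \<bullet> b)" for b c
  proof (rule AE_nonneg_if_integrals_nonneg)
    show "(\<lambda>t. c * (f t \<bullet> b)) integrable_on {0..T}"
      using integrable_linear[OF f bounded_linear_inner_left, of b] by (auto simp: o_def intro: integrable_on_mult_right)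
    show "0 \<le> integral {s..t} (\<lambda>t. c * (f t \<bullet> b))" if "0 \<le> s" "s \<le> t" "t \<le> T" for s t
      using integral_linear[OF integrable_on_subsegment[OF f that(1,3)] bounded_linear_inner_left, of b] zz[OF that]
      by (simp add: o_def)
  qed
  have "AE t in lebesgue_on {0..T}. 0 \<le> 1 * (f t \<bullet> b) \<and> 0 \<le> -1 * (f t \<bullet> b)" for b
    using comp[of 1 b] comp[of "-1" b] by eventually_elim blast
  then have "AE t in lebesgue_on {0..T}. \<forall>b\<in>Basis. 0 \<le> 1 * (f t \<bullet> b) \<and> 0 \<le> -1 * (f t \<bullet> b)"
    by (intro AE_finite_allI) (rule finite_Basis)
  then show ?thesis
  proof eventually_elim
    case (elim t)
    show ?case by (rule euclidean_eqI) (use elim in force)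
  qed
qed

lemma L2_primitive_unique_AE:
  fixes u :: "real \<Rightarrow> 'a::euclidean_space"
  assumes f: "L2_primitive T f u" and g: "L2_primitive T g u"
  shows "AE t in lebesgue_on {0..T}. f t = g t"
proof -
  have d: "L2_primitive T (\<lambda>t. f t - g t) (\<lambda>t. u t - u t)" by (rule L2_primitive_diff[OF f g])
  have "AE t in lebesgue_on {0..T}. f t - g t = 0"
    using L2_primitive_eq[OF d]
    by (intro AE_zero_if_integrals_zero L2_fun_integrable_on[OF L2_primitive_fun[OF d]]) auto
  then show ?thesis by simp
qed

lemma integral_cong_AE_lebesgue_on:
  fixes f g :: "real \<Rightarrow> 'a::euclidean_space"
  assumes "AE t in lebesgue_on {0..T}. f t = g t" and st: "0 \<le> s" "t \<le> T"
  shows "integral {s..t} f = integral {s..t} g"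
    and "f integrable_on {s..t} \<longleftrightarrow> g integrable_on {s..t}"
proof -
  have "AE t in lebesgue. t \<in> {0..T} \<longrightarrow> f t = g t"
    using assms by (simp add: AE_restrict_space_iff)
  then obtain N where N: "{t. \<not> (t \<in> {0..T} \<longrightarrow> f t = g t)} \<subseteq> N" "N \<in> null_sets lebesgue"
    by (auto simp: eventually_ae_filter)
  have ng: "negligible N" using N(2) negligible_iff_null_sets by blast
  have eq: "g x = f x" if "x \<in> {s..t} - N" for x
  proof -
    have "x \<in> {0..T}" "x \<notin> N" using that st by auto
    then show ?thesis using subsetD[OF N(1), of x] unfolding mem_Collect_eq by metis
  qed
  show "integral {s..t} f = integral {s..t} g" by (rule integral_spike[OF ng]) (use eq in auto)
  show "f integrable_on {s..t} \<longleftrightarrow> g integrable_on {s..t}"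
    using integrable_spike[of f "{s..t}" N g, OF _ ng eq] integrable_spike[of g "{s..t}" N f, OF _ ng eq[symmetric]]
    by blast
qed


section \<open>Compactness of bounded sets of primitives\<close>

lemma AE_summable_norm_if_summable_integral_norm:
  fixes f :: "nat \<Rightarrow> 'b \<Rightarrow> 'a::{banach, second_countable_topology}"
  assumes f: "\<And>i. integrable M (f i)" and s: "summable (\<lambda>i. \<integral>x. norm (f i x) \<partial>M)"
  shows "AE x in M. summable (\<lambda>i. norm (f i x))"
proof -
  have [measurable]: "f i \<in> borel_measurable M" for i using f by auto
  have "(\<integral>\<^sup>+x. (\<Sum>i. ennreal (norm (f i x))) \<partial>M) = (\<Sum>i. \<integral>\<^sup>+x. ennreal (norm (f i x)) \<partial>M)"
    by (rule nn_integral_suminf) auto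
  also have "\<dots> = (\<Sum>i. ennreal (\<integral>x. norm (f i x) \<partial>M))"
    by (subst nn_integral_eq_integral[OF integrable_norm[OF f]]) auto
  also have "\<dots> = ennreal (\<Sum>i. \<integral>x. norm (f i x) \<partial>M)"
    by (rule suminf_ennreal2[OF Bochner_Integration.integral_nonneg s]) (rule norm_ge_zero)
  also have "\<dots> \<noteq> \<infinity>" by simp
  finally have "(\<integral>\<^sup>+x. (\<Sum>i. ennreal (norm (f i x))) \<partial>M) \<noteq> \<infinity>" .
  then have "AE x in M. (\<Sum>i. ennreal (norm (f i x))) \<noteq> \<infinity>"
    by (intro nn_integral_PInf_AE) auto
  then show ?thesis by eventually_elim (auto intro: summable_suminf_not_top)
qed

text \<open>The core of the Riesz-Fischer theorem: the telescoping series of the increments converges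
  absolutely almost everywhere, and the sum of the norms of its terms is an integrable majorant.\<close>

lemma AE_limit_if_summable_increments:
  fixes v :: "nat \<Rightarrow> 'b \<Rightarrow> 'a::{banach, second_countable_topology}"
  assumes v: "\<And>n. integrable M (v n)" and s: "summable (\<lambda>n. \<integral>x. norm (v (Suc n) x - v n x) \<partial>M)"
  obtains h where "integrable M h" "AE x in M. convergent (\<lambda>n. v n x) \<and> (\<forall>n. norm (v n x) \<le> h x)"
proof
  define f where "f n x = v (Suc n) x - v n x" for n x
  have f: "integrable M (f n)" for n unfolding f_def by (intro Bochner_Integration.integrable_diff v)
  have ae: "AE x in M. summable (\<lambda>i. norm (f i x))"
    using f s unfolding f_def by (rule AE_summable_norm_if_summable_integral_norm)
  show "integrable M (\<lambda>x. norm (v 0 x) + (\<Sum>i. norm (f i x)))"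
    using v f ae s unfolding f_def
    by (intro Bochner_Integration.integrable_add integrable_norm integrable_suminf) auto
  show "AE x in M. convergent (\<lambda>n. v n x) \<and> (\<forall>n. norm (v n x) \<le> norm (v 0 x) + (\<Sum>i. norm (f i x)))"
    using ae
  proof eventually_elim
    case (elim x)
    have eq: "v n x = v 0 x + (\<Sum>i<n. f i x)" for n
      by (induction n) (auto simp: f_def)
    have "(\<lambda>n. v 0 x + (\<Sum>i<n. f i x)) \<longlonglongrightarrow> v 0 x + (\<Sum>i. f i x)"
      by (intro tendsto_intros summable_LIMSEQ summable_norm_cancel[OF elim])
    then have "convergent (\<lambda>n. v n x)"
      unfolding ext[of "\<lambda>n. v n x" "\<lambda>n. v 0 x + (\<Sum>i<n. f i x)", OF eq] by (rule convergentI)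
    moreover have "norm (v n x) \<le> norm (v 0 x) + (\<Sum>i. norm (f i x))" for n
    proof -
      have "norm (\<Sum>i<n. f i x) \<le> (\<Sum>i<n. norm (f i x))" by (rule norm_sum)
      also have "\<dots> \<le> (\<Sum>i. norm (f i x))" by (rule sum_le_suminf[OF elim]) auto
      finally show ?thesis unfolding eq[of n] by (intro order_trans[OF norm_triangle_ineq]) simp
    qed
    ultimately show ?case by blast
  qed
qed

lemma norm_sq_midpoint:
  fixes a b :: "'a::real_inner"
  shows "(norm (b - a))\<^sup>2 = 2 * (norm a)\<^sup>2 + 2 * (norm b)\<^sup>2 - 4 * (norm ((1/2) *\<^sub>R (a + b)))\<^sup>2"
  unfolding power2_norm_eq_inner
  by (simp add: inner_diff_left inner_diff_right inner_add_left inner_add_right inner_commute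
      field_simps)

text \<open>Weak lower semicontinuity without the weak topology.  Among all primitives within distance
  \<open>\<epsilon>\<close> of the limit \<open>u\<close>, pick one whose derivative has almost minimal norm.  These sets of
  primitives are convex and shrink with \<open>\<epsilon>\<close>, so by the parallelogram identity the chosen
  derivatives form a Cauchy sequence in mean square; its limit is the derivative of \<open>u\<close>.\<close>

lemma L2_primitive_uniform_limit:
  fixes U :: "nat \<Rightarrow> real \<Rightarrow> 'a::euclidean_space"
  assumes T: "0 < T" and U: "\<And>k. L2_primitive T (g k) (U k)"
    and M: "\<And>k. integral {0..T} (\<lambda>t. (norm (g k t))\<^sup>2) \<le> M"
    and lim: "uniform_limit {0..T} U u sequentially"
  obtains g' where "L2_primitive T g' u" "integral {0..T} (\<lambda>t. (norm (g' t))\<^sup>2) \<le> M"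
proof -
  define N where "N v = integral {0..T} (\<lambda>t. (norm (v t))\<^sup>2)" for v :: "real \<Rightarrow> 'a"
  define S where "S \<epsilon> = {v. \<exists>w. L2_primitive T v w \<and> (\<forall>t\<in>{0..T}. norm (w t - u t) \<le> \<epsilon>)}" for \<epsilon>
  \<comment> \<open>\<open>D \<epsilon>\<close> grows as \<open>\<epsilon>\<close> shrinks and is bounded by \<open>M\<close>; \<open>L\<close> below is its limit.\<close>
  define D where "D \<epsilon> = Inf (N ` S \<epsilon>)" for \<epsilon>
  have N0: "N v \<ge> 0" for v unfolding N_def
    by (cases "(\<lambda>t. (norm (v t))\<^sup>2) integrable_on {0..T}") (auto intro: integral_nonneg simp: not_integrable_integral)
  have Sg: "\<exists>k. g k \<in> S \<epsilon>" if e: "\<epsilon> > 0" for \<epsilon>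
  proof -
    obtain k where "\<forall>t\<in>{0..T}. dist (U k t) (u t) < \<epsilon>"
      using uniform_limitD[OF lim e] unfolding eventually_sequentially by blast
    then have "\<forall>t\<in>{0..T}. norm (U k t - u t) \<le> \<epsilon>" by (auto simp: dist_norm intro: less_imp_le)
    then show ?thesis unfolding S_def using U by blast
  qed
  have bddN: "bdd_below (N ` A)" for A using N0 by (intro bdd_belowI[of _ 0]) auto
  have DM: "D \<epsilon> \<le> M" if e: "\<epsilon> > 0" for \<epsilon>
  proof -
    obtain k where "g k \<in> S \<epsilon>" using Sg[OF e] by blast
    then have "D \<epsilon> \<le> N (g k)" unfolding D_def by (intro cInf_lower bddN) auto
    then show ?thesis using M[of k] by (simp add: N_def)
  qed
  have Smono: "S \<epsilon> \<subseteq> S \<delta>" if "\<epsilon> \<le> \<delta>" for \<epsilon> \<delta> unfolding S_def using that by force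
  have Dmono: "D \<delta> \<le> D \<epsilon>" if "0 < \<epsilon>" "\<epsilon> \<le> \<delta>" for \<epsilon> \<delta>
    unfolding D_def using Sg[OF that(1)] Smono[OF that(2)] by (intro cInf_superset_mono bddN image_mono) auto
  have bddD: "bdd_above (D ` {0<..})" using DM by (intro bdd_aboveI[of _ M]) auto
  define L where "L = Sup (D ` {0<..})"
  have DL: "D \<epsilon> \<le> L" if "\<epsilon> > 0" for \<epsilon> unfolding L_def using that by (intro cSup_upper bddD) auto
  have LM: "L \<le> M" unfolding L_def using DM by (intro cSup_least) auto
  \<comment> \<open>The tolerance for almost minimality.  Derivatives chosen with tolerance \<open>q n\<close> have consecutive
      distances of order \<open>sqrt (q n) = (1/2)^n\<close> in mean square, which is summable.\<close>
  define q where "q n = (1/4::real) ^ n" for n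
  have q0: "q n > 0" and q_dec: "q (Suc n) \<le> q n" for n by (simp_all add: q_def)
  have "\<exists>v w. L2_primitive T v w \<and> N v < L + q n \<and> (\<forall>t\<in>{0..T}. norm (w t - u t) \<le> (1/2)^n) \<and>
      (\<exists>\<epsilon>>0. L - q n < D \<epsilon> \<and> v \<in> S \<epsilon>)" for n
  proof -
    have "\<exists>y\<in>D ` {0<..}. L - q n < y"
      unfolding L_def using q0[of n] by (intro less_cSupD) auto
    then obtain e where e: "e > 0" "L - q n < D e" by auto
    define \<epsilon> where "\<epsilon> = min e ((1/2)^n)"
    have \<epsilon>: "\<epsilon> > 0" "\<epsilon> \<le> (1/2)^n" "L - q n < D \<epsilon>"
      using e Dmono[of \<epsilon> e] by (auto simp: \<epsilon>_def)
    have "\<exists>y\<in>N ` S \<epsilon>. y < L + q n"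
      using Sg[OF \<epsilon>(1)] DL[OF \<epsilon>(1)] q0[of n] unfolding D_def by (intro cInf_lessD) auto
    then obtain v where v: "v \<in> S \<epsilon>" "N v < L + q n" by auto
    then obtain w where "L2_primitive T v w" "\<forall>t\<in>{0..T}. norm (w t - u t) \<le> \<epsilon>" unfolding S_def by blast
    then show ?thesis using v \<epsilon> by (intro exI[of _ v] exI[of _ w]) (auto intro: order_trans)
  qed
  then obtain v w where vw: "\<And>n. L2_primitive T (v n) (w n)" "\<And>n. N (v n) < L + q n"
      "\<And>n t. t \<in> {0..T} \<Longrightarrow> norm (w n t - u t) \<le> (1/2)^n"
      "\<And>n. \<exists>\<epsilon>>0. L - q n < D \<epsilon> \<and> v n \<in> S \<epsilon>"
    by metis
  note vL = L2_primitive_fun[OF vw(1)]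
  have diffN: "N (\<lambda>t. v (Suc n) t - v n t) \<le> 8 * q n" for n
  proof -
    obtain \<epsilon>1 \<epsilon>2 where e: "\<epsilon>1 > 0" "L - q n < D \<epsilon>1" "v n \<in> S \<epsilon>1" "\<epsilon>2 > 0" "L - q (Suc n) < D \<epsilon>2" "v (Suc n) \<in> S \<epsilon>2"
      using vw(4)[of n] vw(4)[of "Suc n"] by blast
    define \<epsilon> where "\<epsilon> = max \<epsilon>1 \<epsilon>2"
    have \<epsilon>: "\<epsilon> > 0" "L - q n < D \<epsilon>"
      using e q_dec[of n] by (auto simp: \<epsilon>_def max_def)
    have vS: "v n \<in> S \<epsilon>" "v (Suc n) \<in> S \<epsilon>"
      using subsetD[OF Smono e(3)] subsetD[OF Smono e(6)] by (auto simp: \<epsilon>_def)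
    obtain w1 where w1: "L2_primitive T (v n) w1" "\<forall>t\<in>{0..T}. norm (w1 t - u t) \<le> \<epsilon>"
      using vS(1) unfolding S_def by blast
    obtain w2 where w2: "L2_primitive T (v (Suc n)) w2" "\<forall>t\<in>{0..T}. norm (w2 t - u t) \<le> \<epsilon>"
      using vS(2) unfolding S_def by blast
    let ?m = "\<lambda>t. (1/2) *\<^sub>R (v n t + v (Suc n) t)"
    have mp: "L2_primitive T ?m (\<lambda>t. (1/2) *\<^sub>R (w1 t + w2 t))"
      by (intro L2_primitive_scaleR L2_primitive_add w1(1) w2(1))
    have "norm ((1/2) *\<^sub>R (w1 t + w2 t) - u t) \<le> \<epsilon>" if "t \<in> {0..T}" for t
    proof -
      have "(1/2) *\<^sub>R (w1 t + w2 t) - u t = (1/2) *\<^sub>R ((w1 t - u t) + (w2 t - u t))"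
        by (simp add: algebra_simps flip: scaleR_add_left)
      also have "norm \<dots> \<le> 1/2 * (norm (w1 t - u t) + norm (w2 t - u t))"
        unfolding norm_scaleR using norm_triangle_ineq[of "w1 t - u t" "w2 t - u t"] by simp
      finally show ?thesis using bspec[OF w1(2) that] bspec[OF w2(2) that] by simp
    qed
    then have "?m \<in> S \<epsilon>" unfolding S_def using mp by blast
    then have "D \<epsilon> \<le> N ?m" unfolding D_def by (intro cInf_lower bddN) auto
    then have Nm: "L - q n < N ?m" using \<epsilon> by simp
    have "N (\<lambda>t. v (Suc n) t - v n t) = 2 * N (v n) + 2 * N (v (Suc n)) - 4 * N ?m"
      unfolding N_def norm_sq_midpoint
      by (intro integral_unique has_integral_diff has_integral_add has_integral_mult_right integrable_integral
          L2_fun_sq_integrable_on vL L2_primitive_fun[OF mp])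
    then show ?thesis using Nm q_dec[of n] vw(2)[of n] vw(2)[of "Suc n"] by simp
  qed
  let ?M = "lebesgue_on {0..T}"
  have vint: "integrable ?M (v n)" for n
    using L2_fun_absolutely_integrable[OF vL] by (intro absolutely_integrable_imp_integrable) auto
  have "summable (\<lambda>n. \<integral>x. norm (v (Suc n) x - v n x) \<partial>?M)"
  proof (rule summable_comparison_test')
    show "summable (\<lambda>n. sqrt (8 * T) * (1/2)^n)" by (intro summable_mult summable_geometric) auto
    fix n :: nat
    have d: "L2_fun T (\<lambda>t. v (Suc n) t - v n t)" by (intro L2_fun_diff vL)
    have di: "(\<integral>x. norm (v (Suc n) x - v n x) \<partial>?M) = integral {0..T} (\<lambda>t. norm (v (Suc n) t - v n t))"
      by (intro lebesgue_integral_eq_integral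
          integrable_norm[OF absolutely_integrable_imp_integrable[OF L2_fun_absolutely_integrable[OF d]]]) auto
    have "(integral {0..T} (\<lambda>t. norm (v (Suc n) t - v n t)))\<^sup>2 \<le> (T - 0) * N (\<lambda>t. v (Suc n) t - v n t)"
      unfolding N_def using T by (intro integral_norm_sq_le[OF d]) auto
    also have "\<dots> \<le> T * (8 * q n)" using diffN[of n] T by (simp add: mult_left_mono)
    also have "\<dots> = (sqrt (8 * T) * (1/2)^n)\<^sup>2"
    proof -
      have "q n = ((1/2)^n)\<^sup>2" by (simp add: q_def power2_eq_square flip: power_mult_distrib)
      then show ?thesis using T by (simp add: power_mult_distrib)
    qed
    finally have "integral {0..T} (\<lambda>t. norm (v (Suc n) t - v n t)) \<le> sqrt (8 * T) * (1/2)^n"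
      by (rule power2_le_imp_le) (use T in auto)
    then show "norm (\<integral>x. norm (v (Suc n) x - v n x) \<partial>?M) \<le> sqrt (8 * T) * (1/2)^n"
      unfolding di by (simp add: integral_nonneg L2_fun_norm_integrable_on[OF d])
  qed
  from AE_limit_if_summable_increments[OF vint this] obtain h where h: "integrable ?M h"
      "AE x in ?M. convergent (\<lambda>n. v n x) \<and> (\<forall>n. norm (v n x) \<le> h x)" by blast
  define v' where "v' x = lim (\<lambda>n. v n x)" for x
  have conv: "AE x in ?M. (\<lambda>n. v n x) \<longlonglongrightarrow> v' x"
    using h(2) unfolding v'_def by eventually_elim (auto simp: convergent_LIMSEQ_iff)
  have v'int: "integrable ?M v'" 
  proof (rule integrable_dominated_convergence[OF _ _ h(1)])
    have "(\<lambda>x. lim (\<lambda>n. v n x)) \<in> borel_measurable ?M"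
      using vint by (intro borel_measurable_lim_metric) auto
    then show "v' \<in> borel_measurable ?M" by (simp add: v'_def[abs_def])
    show "AE x in ?M. norm (v n x) \<le> h x" for n using h(2) by eventually_elim auto
  qed (use vint conv in auto)
  have N_LINT: "(\<integral>\<^sup>+x. ennreal ((norm (v n x))\<^sup>2) \<partial>?M) = ennreal (N (v n))" for n
    using vL[of n] unfolding N_def LINT_sq_eq_integral[OF vL, symmetric]
    by (intro nn_integral_eq_integral) (auto simp: L2_fun_def)
  have [measurable]: "v n \<in> borel_measurable ?M" "v' \<in> borel_measurable ?M" for n using vint v'int by auto
  have "(\<integral>\<^sup>+x. ennreal ((norm (v' x))\<^sup>2) \<partial>?M) = (\<integral>\<^sup>+x. liminf (\<lambda>n. ennreal ((norm (v n x))\<^sup>2)) \<partial>?M)"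
  proof (intro nn_integral_cong_AE)
    show "AE x in ?M. ennreal ((norm (v' x))\<^sup>2) = liminf (\<lambda>n. ennreal ((norm (v n x))\<^sup>2))"
      using conv
    proof eventually_elim
      case (elim x)
      have "(\<lambda>n. ennreal ((norm (v n x))\<^sup>2)) \<longlonglongrightarrow> ennreal ((norm (v' x))\<^sup>2)"
        by (intro tendsto_ennrealI tendsto_intros elim)
      then show ?case by (intro lim_imp_Liminf[symmetric]) auto
    qed
  qed
  also have "\<dots> \<le> liminf (\<lambda>n. \<integral>\<^sup>+x. ennreal ((norm (v n x))\<^sup>2) \<partial>?M)"
    by (rule nn_integral_liminf) auto
  also have "\<dots> \<le> liminf (\<lambda>n. ennreal (M + q n))"
    unfolding N_LINT using vw(2) LM by (intro Liminf_mono always_eventually allI ennreal_leI) (meson add_mono less_imp_le order_trans order_refl)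
  also have "\<dots> = ennreal M"
  proof (intro lim_imp_Liminf)
    have "q \<longlonglongrightarrow> 0" unfolding q_def[abs_def] by (intro LIMSEQ_power_zero) auto
    then have "(\<lambda>n. M + q n) \<longlonglongrightarrow> M + 0" by (intro tendsto_intros)
    then show "(\<lambda>n. ennreal (M + q n)) \<longlonglongrightarrow> ennreal M" by (intro tendsto_ennrealI) auto
  qed auto
  finally have nnM: "(\<integral>\<^sup>+x. ennreal ((norm (v' x))\<^sup>2) \<partial>?M) \<le> ennreal M" .
  have i2: "integrable ?M (\<lambda>x. (norm (v' x))\<^sup>2)"
    by (rule integrableI_bounded) (use nnM in \<open>auto intro: le_less_trans\<close>)
  then have v'L: "L2_fun T v'" unfolding L2_fun_def by simp
  have M0: "M \<ge> 0" using M[of 0] N0[of "g 0"] by (simp add: N_def)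
  have "ennreal (\<integral>x. (norm (v' x))\<^sup>2 \<partial>?M) \<le> ennreal M"
    using nnM nn_integral_eq_integral[OF i2] by simp
  then have "N v' \<le> M" using M0 LINT_sq_eq_integral[OF v'L] by (simp add: N_def ennreal_le_iff)
  moreover have "L2_primitive T v' u"
  proof (rule L2_primitiveI[OF v'L])
    fix t assume t: "t \<in> {0..T}"
    let ?Mt = "lebesgue_on {0..t}"
    have sub: "AE x in ?Mt. P x" if "AE x in ?M. P x" for P
      using that t by (auto simp: AE_restrict_space_iff)
    have intt: "integrable ?Mt f" if "integrable ?M f" for f :: "real \<Rightarrow> 'b::euclidean_space"
    proof -
      have "f absolutely_integrable_on {0..T}" using that by (simp add: integrable_restrict_space set_integrable_def)
      then have "f absolutely_integrable_on {0..t}" 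
        by (rule absolutely_integrable_on_subinterval) (use t in auto)
      then show ?thesis by (intro absolutely_integrable_imp_integrable) auto
    qed
    have "(\<lambda>n. integral\<^sup>L ?Mt (v n)) \<longlonglongrightarrow> integral\<^sup>L ?Mt v'"
    proof (rule integral_dominated_convergence)
      show "integrable ?Mt h" by (rule intt[OF h(1)])
      show "AE x in ?Mt. (\<lambda>n. v n x) \<longlonglongrightarrow> v' x" by (rule sub[OF conv])
      show "AE x in ?Mt. norm (v n x) \<le> h x" for n by (rule sub) (use h(2) in \<open>eventually_elim, auto\<close>)
    qed (use intt[OF vint] intt[OF v'int] in auto)
    then have c1: "(\<lambda>n. integral {0..t} (v n)) \<longlonglongrightarrow> integral {0..t} v'"
      using intt[OF vint] intt[OF v'int] by (simp add: lebesgue_integral_eq_integral)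
    have wu: "(\<lambda>n. w n s) \<longlonglongrightarrow> u s" if "s \<in> {0..T}" for s
    proof (rule LIM_zero_cancel, rule Lim_null_comparison)
      show "(\<lambda>n. (1/2::real)^n) \<longlonglongrightarrow> 0" by (intro LIMSEQ_power_zero) auto
    qed (use vw(3)[OF that] in auto)
    have "(\<lambda>n. w n t - w n 0) \<longlonglongrightarrow> u t - u 0"
      using t T by (intro tendsto_diff wu) auto
    moreover have "w n t - w n 0 = integral {0..t} (v n)" for n
      by (rule L2_primitive_increment[OF vw(1)]) (use t in auto)
    ultimately have "u t - u 0 = integral {0..t} v'" using c1 LIMSEQ_unique by simp
    then show "u t = u 0 + integral {0..t} v'" by (metis add.commute diff_add_cancel)
  qed
  ultimately show ?thesis using that by (simp add: N_def)
qed

text \<open>The functions have the common modulus of continuity \<open>sqrt (\<bar>t - s\<bar> * M)\<close>, so the theorem of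
  Arzela and Ascoli provides a uniform limit.\<close>

lemma L2_primitive_compactness:
  fixes U :: "nat \<Rightarrow> real \<Rightarrow> 'a::euclidean_space"
  assumes T: "0 < T" and U: "\<And>k. L2_primitive T (g k) (U k)"
    and M: "\<And>k. integral {0..T} (\<lambda>t. (norm (g k t))\<^sup>2) \<le> M" and R: "\<And>k. norm (U k 0) \<le> R"
  obtains u g' r where "strict_mono (r :: nat \<Rightarrow> nat)" "uniform_limit {0..T} (\<lambda>k. U (r k)) u sequentially"
    "L2_primitive T g' u" "integral {0..T} (\<lambda>t. (norm (g' t))\<^sup>2) \<le> M"
proof -
  have M0: "M \<ge> 0"
    using order_trans[OF integral_nonneg M[of 0]] L2_fun_sq_integrable_on[OF L2_primitive_fun[OF U]] by simp
  have inc: "norm (U k t - U k s) \<le> sqrt (\<bar>t - s\<bar> * M)" if st: "s \<in> {0..T}" "t \<in> {0..T}" for k s t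
  proof -
    have *: "norm (U k b - U k a) \<le> sqrt (\<bar>b - a\<bar> * M)" if "0 \<le> a" "a \<le> b" "b \<le> T" for a b
    proof (rule real_le_rsqrt)
      have "(norm (U k b - U k a))\<^sup>2 \<le> (b - a) * integral {0..T} (\<lambda>t. (norm (g k t))\<^sup>2)"
        by (rule L2_primitive_increment_sq_le[OF U that])
      also have "\<dots> \<le> (b - a) * M" using M that by (intro mult_left_mono) auto
      finally show "(norm (U k b - U k a))\<^sup>2 \<le> \<bar>b - a\<bar> * M" using that by simp
    qed
    show ?thesis using *[of s t] *[of t s] st by (cases "s \<le> t") (auto simp: norm_minus_commute abs_minus_commute)
  qed
  have bound: "norm (U k t) \<le> R + sqrt (T * M)" if t: "t \<in> {0..T}" for k t
  proof -
    have "norm (U k t) \<le> norm (U k 0) + norm (U k t - U k 0)" by (metis add.commute norm_triangle_sub)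
    also have "norm (U k t - U k 0) \<le> sqrt (\<bar>t - 0\<bar> * M)" using t T by (intro inc) auto
    also have "\<dots> \<le> sqrt (T * M)" using t M0 by (auto intro: mult_right_mono)
    finally show ?thesis using R[of k] by simp
  qed
  have equi: "\<exists>d. 0 < d \<and> (\<forall>n y. y \<in> {0..T} \<and> norm (x - y) < d \<longrightarrow> norm (U n x - U n y) < e)"
    if x: "x \<in> {0..T}" and e: "0 < e" for x e
  proof (intro exI conjI allI impI)
    show "0 < e\<^sup>2 / (M + 1)" using e M0 by simp
    fix n y assume y: "y \<in> {0..T} \<and> norm (x - y) < e\<^sup>2 / (M + 1)"
    have "\<bar>x - y\<bar> * M \<le> \<bar>x - y\<bar> * (M + 1)" by (intro mult_left_mono) auto
    also have "\<dots> < e\<^sup>2" using y M0 by (simp add: field_simps)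
    finally have "sqrt (\<bar>x - y\<bar> * M) < sqrt (e\<^sup>2)" by (rule real_sqrt_less_mono)
    then show "norm (U n x - U n y) < e" using inc[of y x n] x y e by simp
  qed
  obtain u r where ur: "continuous_on {0..T} u" "strict_mono (r :: nat \<Rightarrow> nat)"
      "\<And>e. 0 < e \<Longrightarrow> \<exists>N. \<forall>n x. n \<ge> N \<and> x \<in> {0..T} \<longrightarrow> norm (U (r n) x - u x) < e"
    by (rule Arzela_Ascoli[OF compact_Icc bound equi]) (assumption | rule that)+
  have lim: "uniform_limit {0..T} (\<lambda>k. U (r k)) u sequentially"
    unfolding uniform_limit_sequentially_iff dist_norm using ur(3) by meson
  obtain g' where "L2_primitive T g' u" "integral {0..T} (\<lambda>t. (norm (g' t))\<^sup>2) \<le> M"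
    by (rule L2_primitive_uniform_limit[OF T U M lim])
  then show ?thesis using that ur(2) lim by blast
qed

section \<open>Ordinary differential equations with a bounded continuous nonlinearity\<close>

text \<open>Explicit Euler steps.  The polygon \<open>x n\<close> solves the equation with \<open>G\<close> evaluated at a step
  function that is uniformly close to \<open>x n\<close>, and the polygons are compact in the uniform norm.\<close>

lemma Peano_bounded:
  fixes G :: "'a::euclidean_space \<Rightarrow> 'a"
  assumes T: "0 < T" and G: "continuous_on UNIV G" and B: "\<And>x. norm (G x) \<le> B" and g: "L2_fun T g"
  obtains y where "y 0 = x0" "L2_primitive T (\<lambda>t. g t - G (y t)) y"
proof -
  define Q where "Q t = integral {0..t} g" for t
  define \<tau> where "\<tau> n = T / real (Suc n)" for n :: nat
  have \<tau>: "\<tau> n > 0" for n using T by (simp add: \<tau>_def)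
  \<comment> \<open>The values of the polygon at the nodes \<open>j * \<tau> n\<close>.  The inhomogeneity \<open>g\<close> is integrated exactly; only \<open>G\<close>
      is frozen at the left end of each step.\<close>
  define z where "z n = rec_nat x0 (\<lambda>j zj. zj + (Q (real (Suc j) * \<tau> n) - Q (real j * \<tau> n)) - \<tau> n *\<^sub>R G zj)" for n
  have z0: "z n 0 = x0" and zS: "z n (Suc j) = z n j + (Q (real (Suc j) * \<tau> n) - Q (real j * \<tau> n)) - \<tau> n *\<^sub>R G (z n j)"
    for n j by (simp_all add: z_def)
  define s where "s n r = z n (nat \<lfloor>r / \<tau> n\<rfloor>)" for n r
  have s_eq: "s n r = z n j" if "real j * \<tau> n \<le> r" "r < real (Suc j) * \<tau> n" for n j r
  proof -
    have "\<lfloor>r / \<tau> n\<rfloor> = int j" using that \<tau>[of n] by (intro floor_unique) (auto simp: field_simps)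
    then show ?thesis by (simp add: s_def)
  qed
  have Gs: "L2_fun T (\<lambda>r. G (s n r))" for n
  proof (rule L2_fun_dominated)
    have "(\<lambda>r. (G \<circ> z n \<circ> nat) \<lfloor>r / \<tau> n\<rfloor>) \<in> borel_measurable borel"
      by (rule measurable_compose[of "\<lambda>r. \<lfloor>r / \<tau> n\<rfloor>" borel "count_space UNIV" "G \<circ> z n \<circ> nat" borel]) simp_all
    then have "(\<lambda>r. G (s n r)) \<in> borel_measurable borel" by (simp add: s_def[abs_def] o_def)
    then show "(\<lambda>r. G (s n r)) \<in> borel_measurable (lebesgue_on {0..T})"
      by (intro measurable_restrict_space1 borel_measurable_if_I measurable_completion) auto
    show "(\<lambda>r. B\<^sup>2) integrable_on {0..T}" by auto
    show "(norm (G (s n r)))\<^sup>2 \<le> B\<^sup>2" for r by (intro power_mono B) auto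
  qed
  define x where "x n t = x0 + integral {0..t} (\<lambda>r. g r - G (s n r))" for n t
  have xp: "L2_primitive T (\<lambda>r. g r - G (s n r)) (x n)" for n
    unfolding x_def[abs_def] by (intro L2_primitive_integral L2_fun_diff g Gs)
  define K where "K = 2 * integral {0..T} (\<lambda>r. (norm (g r))\<^sup>2) + 2 * B\<^sup>2 * T"
  have K: "integral {0..T} (\<lambda>r. (norm (g r - G (s n r)))\<^sup>2) \<le> K" for n
  proof -
    have "integral {0..T} (\<lambda>r. (norm (g r - G (s n r)))\<^sup>2) \<le> integral {0..T} (\<lambda>r. 2 * (norm (g r))\<^sup>2 + 2 * B\<^sup>2)"
    proof (rule integral_le)
      show "(norm (g r - G (s n r)))\<^sup>2 \<le> 2 * (norm (g r))\<^sup>2 + 2 * B\<^sup>2" for r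
      proof -
        have "(norm (g r + - G (s n r)))\<^sup>2 \<le> 2 * (norm (g r))\<^sup>2 + 2 * (norm (- G (s n r)))\<^sup>2"
          by (rule norm_add_sq_le)
        also have "(norm (- G (s n r)))\<^sup>2 \<le> B\<^sup>2" unfolding norm_minus_cancel by (intro power_mono B) auto
        finally show ?thesis by simp
      qed
    qed (intro L2_fun_sq_integrable_on L2_fun_diff g Gs integrable_add integrable_on_mult_right integrable_const_ivl)+
    also have "\<dots> = K"
      unfolding K_def using has_integral_const_real[of "2 * B\<^sup>2" 0 T] T
      by (intro integral_unique has_integral_add has_integral_mult_right integrable_integral L2_fun_sq_integrable_on g)
         (simp add: mult.commute)
    finally show ?thesis .
  qed
  have node: "x n (real j * \<tau> n) = z n j" if "j \<le> Suc n" for n j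
    using that
  proof (induction j)
    case 0 then show ?case by (simp add: x_def z0)
  next
    case (Suc j)
    let ?a = "real j * \<tau> n" and ?b = "real (Suc j) * \<tau> n"
    have ab: "0 \<le> ?a" "?a \<le> ?b" "?b - ?a = \<tau> n" using \<tau>[of n] by (auto simp: algebra_simps)
    have "real (Suc j) * \<tau> n \<le> real (Suc n) * \<tau> n" using Suc.prems \<tau>[of n] by (intro mult_right_mono) auto
    then have bT: "?b \<le> T" by (simp add: \<tau>_def)
    have sub: "f integrable_on {?a..?b}" if "L2_fun T f" for f :: "real \<Rightarrow> 'a"
      by (rule integrable_on_subsegment[OF L2_fun_integrable_on[OF that]]) (use ab bT in auto)
    have "((\<lambda>r. G (s n r)) has_integral (\<tau> n *\<^sub>R G (z n j))) {?a..?b}"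
    proof (rule has_integral_spike_finite[of "{?b}"])
      show "((\<lambda>r. G (z n j)) has_integral \<tau> n *\<^sub>R G (z n j)) {?a..?b}"
        using has_integral_const_real[of "G (z n j)" ?a ?b] ab by simp
      show "G (s n r) = G (z n j)" if "r \<in> {?a..?b} - {?b}" for r
        using s_eq[of j n r] that by auto
    qed auto
    then have iG: "integral {?a..?b} (\<lambda>r. G (s n r)) = \<tau> n *\<^sub>R G (z n j)" by (rule integral_unique)
    have "integral {0..?a} g + integral {?a..?b} g = integral {0..?b} g"
      using ab bT by (intro Henstock_Kurzweil_Integration.integral_combine
          integrable_on_subsegment[OF L2_fun_integrable_on[OF g]]) auto
    then have iQ: "integral {?a..?b} g = Q ?b - Q ?a" unfolding Q_def by (simp add: algebra_simps)
    have "x n ?b - x n ?a = integral {?a..?b} (\<lambda>r. g r - G (s n r))"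
      by (rule L2_primitive_increment[OF xp]) (use ab bT in auto)
    also have "\<dots> = Q ?b - Q ?a - \<tau> n *\<^sub>R G (z n j)"
      using iG iQ sub[OF g] sub[OF Gs] by (simp add: integral_diff)
    finally have "x n ?b = x n ?a + (Q ?b - Q ?a) - \<tau> n *\<^sub>R G (z n j)" by (simp add: algebra_simps)
    then show ?case using Suc by (simp add: zS)
  qed
  have close: "norm (x n t - s n t) \<le> sqrt (\<tau> n * K)" if t: "t \<in> {0..T}" for n t
  proof -
    define j where "j = nat \<lfloor>t / \<tau> n\<rfloor>"
    have fl: "real j = of_int \<lfloor>t / \<tau> n\<rfloor>" using t \<tau>[of n] by (simp add: j_def)
    have j1: "real j * \<tau> n \<le> t" "t - real j * \<tau> n \<le> \<tau> n"
      using fl floor_divide_lower[OF \<tau>[of n], of t] floor_divide_upper[OF \<tau>[of n], of t]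
      by (auto simp: algebra_simps)
    have "real j * \<tau> n \<le> real (Suc n) * \<tau> n" using j1(1) t by (simp add: \<tau>_def)
    then have jn: "j \<le> Suc n" using \<tau>[of n] by (simp del: of_nat_Suc)
    have st: "s n t = x n (real j * \<tau> n)" using node[OF jn] by (simp add: s_def j_def)
    have "(norm (x n t - x n (real j * \<tau> n)))\<^sup>2
        \<le> (t - real j * \<tau> n) * integral {0..T} (\<lambda>r. (norm (g r - G (s n r)))\<^sup>2)"
      using t j1 \<tau>[of n] by (intro L2_primitive_increment_sq_le xp) auto
    also have "\<dots> \<le> \<tau> n * K"
      using j1 K[of n] \<tau>[of n] L2_fun_sq_integrable_on[OF L2_primitive_fun[OF xp[of n]]]
      by (intro mult_mono integral_nonneg) auto
    finally show ?thesis unfolding st by (rule real_le_rsqrt)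
  qed
  have x_init: "x n 0 = x0" for n by (simp add: x_def)
  obtain y g' r where y: "strict_mono (r :: nat \<Rightarrow> nat)" "uniform_limit {0..T} (\<lambda>k. x (r k)) y sequentially"
     "L2_primitive T g' y"
    by (rule L2_primitive_compactness[OF T xp K, where R = "norm x0"]) (simp add: x_init, rule that)
  have \<tau>lim: "(\<lambda>k. \<tau> (r k)) \<longlonglongrightarrow> 0"
  proof -
    have "(\<lambda>n. T * inverse (real (Suc n))) \<longlonglongrightarrow> T * 0" by (intro tendsto_intros LIMSEQ_inverse_real_of_nat)
    then have "\<tau> \<longlonglongrightarrow> 0" by (simp add: \<tau>_def[abs_def] divide_inverse)
    from LIMSEQ_subseq_LIMSEQ[OF this y(1)] show ?thesis by (simp add: o_def)
  qed
  have xlim: "(\<lambda>k. x (r k) t) \<longlonglongrightarrow> y t" if "t \<in> {0..T}" for t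
    using tendsto_uniform_limitI[OF y(2) that] .
  have slim: "(\<lambda>k. s (r k) t) \<longlonglongrightarrow> y t" if t: "t \<in> {0..T}" for t
  proof -
    have "(\<lambda>k. x (r k) t - s (r k) t) \<longlonglongrightarrow> 0"
    proof (rule Lim_null_comparison)
      have "(\<lambda>k. sqrt (\<tau> (r k) * K)) \<longlonglongrightarrow> sqrt (0 * K)" by (intro tendsto_intros \<tau>lim)
      then show "(\<lambda>k. sqrt (\<tau> (r k) * K)) \<longlonglongrightarrow> 0" by simp
    qed (use close[OF t] in auto)
    from tendsto_diff[OF xlim[OF t] this] show ?thesis by simp
  qed
  have y0: "y 0 = x0" using xlim[of 0] T x_init by (simp add: LIMSEQ_const_iff)
  have Gy: "L2_fun T (\<lambda>t. G (y t))"
    using L2_primitive_continuous[OF y(3)] G by (intro L2_fun_continuous continuous_on_compose2[OF G]) auto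
  have "L2_primitive T (\<lambda>t. g t - G (y t)) y"
  proof (rule L2_primitiveI[OF L2_fun_diff[OF g Gy]])
    fix t assume t: "t \<in> {0..T}"
    have sub: "f integrable_on {0..t}" if "L2_fun T f" for f :: "real \<Rightarrow> 'a"
      by (rule integrable_on_subsegment[OF L2_fun_integrable_on[OF that]]) (use t in auto)
    have "(\<lambda>k. integral {0..t} (\<lambda>q. G (s (r k) q))) \<longlonglongrightarrow> integral {0..t} (\<lambda>q. G (y q))"
    proof (rule dominated_convergence)
      show "(\<lambda>k. G (s (r k) q)) \<longlonglongrightarrow> G (y q)" if "q \<in> {0..t}" for q
        using G slim[of q] that t by (intro continuous_on_tendsto_compose[OF G]) auto
      show "(\<lambda>q. B) integrable_on {0..t}" by auto
    qed (use B sub[OF Gs] in auto)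
    then have "(\<lambda>k. x0 + (integral {0..t} g - integral {0..t} (\<lambda>q. G (s (r k) q)))) \<longlonglongrightarrow>
        x0 + (integral {0..t} g - integral {0..t} (\<lambda>q. G (y q)))" by (intro tendsto_intros)
    then have "(\<lambda>k. x (r k) t) \<longlonglongrightarrow> x0 + integral {0..t} (\<lambda>q. g q - G (y q))"
      unfolding x_def using sub[OF g] sub[OF Gs] sub[OF Gy] by (simp add: integral_diff)
    then show "y t = y 0 + integral {0..t} (\<lambda>q. g q - G (y q))"
      using xlim[OF t] LIMSEQ_unique unfolding y0 by blast
  qed
  then show ?thesis using that y0 by blast
qed


section \<open>Differentiable convex functions\<close>

lemma gradient_eqI:
  assumes "GDERIV \<phi> x :> D" shows "gradient \<phi> x = D"
  unfolding gradient_def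
proof (rule the_equality)
  fix D' assume "GDERIV \<phi> x :> D'"
  then have "(\<lambda>h. h \<bullet> D') = (\<lambda>h. h \<bullet> D)"
    using assms unfolding gderiv_def by (rule has_derivative_unique)
  then show "D' = D" using vector_eq_ldot[of D' D] by (simp add: fun_eq_iff)
qed (rule assms)

lemma differentiable_imp_GDERIV_gradient:
  fixes \<phi> :: "'a::euclidean_space \<Rightarrow> real"
  assumes "\<phi> differentiable (at x)" shows "GDERIV \<phi> x :> gradient \<phi> x"
proof -
  obtain L where L: "(\<phi> has_derivative L) (at x)" using assms by (auto simp: differentiable_def)
  have lin: "linear L" using has_derivative_bounded_linear[OF L] bounded_linear.linear by blast
  have "L = (\<lambda>h. h \<bullet> adjoint L 1)"
    using adjoint_works[OF lin, of _ 1] by (auto simp: fun_eq_iff)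
  then have "GDERIV \<phi> x :> adjoint L 1" unfolding gderiv_def using L by simp
  then show ?thesis using gradient_eqI by metis
qed

lemma convex_gradient_inequality:
  fixes \<phi> :: "'a::euclidean_space \<Rightarrow> real"
  assumes c: "convex_on UNIV \<phi>" and d: "\<phi> differentiable (at x)"
  shows "gradient \<phi> x \<bullet> (z - x) \<le> \<phi> z - \<phi> x"
proof -
  define \<gamma> where "\<gamma> s = x + s *\<^sub>R (z - x)" for s :: real
  have aff: "\<gamma> (u * s + v * t) = u *\<^sub>R \<gamma> s + v *\<^sub>R \<gamma> t" if "u + v = 1" for u v s t
  proof -
    have "u *\<^sub>R x + v *\<^sub>R x = x" using that by (metis scaleR_add_left scaleR_one)
    moreover have "u *\<^sub>R \<gamma> s + v *\<^sub>R \<gamma> t = (u *\<^sub>R x + v *\<^sub>R x) + (u * s + v * t) *\<^sub>R (z - x)"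
      by (simp add: \<gamma>_def scaleR_add_right scaleR_add_left)
    ultimately show ?thesis by (simp add: \<gamma>_def)
  qed
  have conv: "convex_on UNIV (\<lambda>s. \<phi> (\<gamma> s))"
  proof (rule convex_onI)
    fix t s r :: real assume t: "0 < t" "t < 1"
    have "\<gamma> ((1 - t) *\<^sub>R s + t *\<^sub>R r) = (1 - t) *\<^sub>R \<gamma> s + t *\<^sub>R \<gamma> r"
      using aff[of "1 - t" t s r] by simp
    then show "\<phi> (\<gamma> ((1 - t) *\<^sub>R s + t *\<^sub>R r)) \<le> (1 - t) * \<phi> (\<gamma> s) + t * \<phi> (\<gamma> r)"
      using convex_onD[OF c, of t "\<gamma> s" "\<gamma> r"] t by simp
  qed auto
  have "((\<lambda>s. \<phi> (\<gamma> s)) has_derivative (\<lambda>h. (h *\<^sub>R (z - x)) \<bullet> gradient \<phi> x)) (at 0)"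
  proof (rule has_derivative_compose[of \<gamma> "\<lambda>h. h *\<^sub>R (z - x)" 0 UNIV \<phi>])
    show "(\<gamma> has_derivative (\<lambda>h. h *\<^sub>R (z - x))) (at 0)"
      unfolding \<gamma>_def by (auto intro!: derivative_eq_intros)
    show "(\<phi> has_derivative (\<lambda>h. h \<bullet> gradient \<phi> x)) (at (\<gamma> 0))"
      using differentiable_imp_GDERIV_gradient[OF d] by (simp add: gderiv_def \<gamma>_def)
  qed
  then have "((\<lambda>s. \<phi> (\<gamma> s)) has_real_derivative ((z - x) \<bullet> gradient \<phi> x)) (at 0)"
    by (simp add: has_field_derivative_def mult.commute[of _ "(z - x) \<bullet> gradient \<phi> x"])
  then have "\<phi> (\<gamma> 1) - \<phi> (\<gamma> 0) \<ge> ((z - x) \<bullet> gradient \<phi> x) * (1 - 0)"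
    by (intro convex_on_imp_above_tangent[OF conv]) auto
  then show ?thesis by (simp add: \<gamma>_def inner_commute)
qed

text \<open>By convexity \<open>gradient \<phi> y \<bullet> (r v) \<le> \<phi> (y + r v) - \<phi> y\<close>; for \<open>y\<close> close to \<open>x\<close> the right
  hand side is close to \<open>\<phi> (x + r v) - \<phi> x\<close>, hence to \<open>gradient \<phi> x \<bullet> (r v)\<close> if \<open>r\<close> is small.
  The claim follows with \<open>v\<close> pointing along the difference of the gradients.\<close>

lemma convex_gradient_continuous:
  fixes \<phi> :: "'a::euclidean_space \<Rightarrow> real"
  assumes c: "convex_on UNIV \<phi>" and d: "\<And>x. \<phi> differentiable (at x)"
  shows "continuous_on UNIV (gradient \<phi>)"
  unfolding continuous_on_iff
proof (intro ballI allI impI)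
  fix x :: 'a and e :: real assume e: "0 < e"
  have "(\<phi> has_derivative (\<lambda>h. h \<bullet> gradient \<phi> x)) (at x)"
    using differentiable_imp_GDERIV_gradient[OF d] by (simp add: gderiv_def)
  then obtain s where s: "s > 0" "\<And>y. norm (y - x) < s \<Longrightarrow>
      norm (\<phi> y - \<phi> x - (y - x) \<bullet> gradient \<phi> x) \<le> e / 4 * norm (y - x)"
    using e unfolding has_derivative_at_alt by (meson divide_pos_pos zero_less_numeral)
  define r where "r = min s 1 / 2"
  have r: "0 < r" "r < s" "r \<le> 1" using s(1) by (auto simp: r_def)
  have cont: "continuous_on (cball x 2) \<phi>"
    using d by (intro continuous_at_imp_continuous_on ballI differentiable_imp_continuous_within)
  obtain \<delta> where \<delta>: "\<delta> > 0" "\<And>a b. a \<in> cball x 2 \<Longrightarrow> b \<in> cball x 2 \<Longrightarrow> dist b a < \<delta> \<Longrightarrow>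
      dist (\<phi> b) (\<phi> a) < e * r / 8"
    using compact_uniformly_continuous[OF cont compact_cball] e r(1)
    unfolding uniformly_continuous_on_def by (metis divide_pos_pos mult_pos_pos zero_less_numeral)
  show "\<exists>\<delta>>0. \<forall>y\<in>UNIV. dist y x < \<delta> \<longrightarrow> dist (gradient \<phi> y) (gradient \<phi> x) < e"
  proof (intro exI[of _ "min \<delta> 1"] conjI ballI impI)
    fix y assume y: "dist y x < min \<delta> 1"
    define g where "g = gradient \<phi> y - gradient \<phi> x"
    show "dist (gradient \<phi> y) (gradient \<phi> x) < e"
    proof (cases "g = 0")
      case False
      define v where "v = r *\<^sub>R (g /\<^sub>R norm g)"
      have nv: "norm v = r" using False r by (simp add: v_def)
      have gv: "g \<bullet> v = r * norm g"
        using False by (simp add: v_def dot_square_norm power2_eq_square)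
      have "gradient \<phi> y \<bullet> v \<le> \<phi> (y + v) - \<phi> y"
        using convex_gradient_inequality[OF c d, of y "y + v"] by simp
      moreover have "\<bar>\<phi> (x + v) - \<phi> x - v \<bullet> gradient \<phi> x\<bar> \<le> e / 4 * r"
        using s(2)[of "x + v"] nv r by simp
      moreover have "\<bar>\<phi> (y + v) - \<phi> (x + v)\<bar> < e * r / 8"
      proof -
        have "norm (y - x + v) \<le> norm (y - x) + norm v" by (rule norm_triangle_ineq)
        then have "dist x (y + v) \<le> 2" using y nv r by (simp add: dist_norm norm_minus_commute algebra_simps)
        then show ?thesis using \<delta>(2)[of "x + v" "y + v"] y nv r by (simp add: dist_norm)
      qed
      moreover have "\<bar>\<phi> y - \<phi> x\<bar> < e * r / 8"
        using \<delta>(2)[of x y] y by (simp add: dist_norm norm_minus_commute)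
      ultimately have "g \<bullet> v \<le> e / 4 * r + e * r / 8 + e * r / 8"
        unfolding g_def inner_diff_left using inner_commute[of v "gradient \<phi> x"] by linarith
      then have "r * norm g \<le> r * (e / 2)" unfolding gv by (simp add: algebra_simps)
      then have "norm g \<le> e / 2" using r by simp
      then show ?thesis using e by (simp add: g_def dist_norm)
    qed (use e in \<open>simp add: g_def\<close>)
  qed (use \<delta> in auto)
qed


section \<open>The hypergraph energies\<close>

text \<open>Convexity up to the end point zero, where it reduces to \<open>c powr q \<le> c\<close> for \<open>0 \<le> c \<le> 1\<close>.\<close>

lemma convex_powr_nonneg:
  fixes a b u v q :: real
  assumes "0 \<le> a" "0 \<le> b" "0 \<le> u" "0 \<le> v" "u + v = 1" "1 \<le> q"
  shows "(u * a + v * b) powr q \<le> u * a powr q + v * b powr q"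
proof -
  have sc: "(c * t) powr q \<le> c * t powr q" if "0 \<le> c" "c \<le> 1" "0 \<le> t" for c t :: real
  proof (cases "c = 0")
    case False
    then have "c powr q \<le> c powr 1" using that assms(6) by (intro powr_mono') auto
    then show ?thesis using that False by (auto simp: powr_mult intro!: mult_right_mono)
  qed (use assms in simp)
  consider "a = 0" | "b = 0" | "a > 0" "b > 0" using assms by linarith
  then show ?thesis
  proof cases
    case 1 then show ?thesis using sc[of v b] assms by simp
  next
    case 2 then show ?thesis using sc[of u a] assms by simp
  next
    case 3
    then show ?thesis using powr_convex[OF assms(6)] assms unfolding convex_on_def
      by (metis greaterThan_iff real_scaleR_def)
  qed
qed

lemma convex_abs_powr:
  fixes s t u v q :: real
  assumes "0 \<le> u" "0 \<le> v" "u + v = 1" "1 \<le> q"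
  shows "\<bar>u * s + v * t\<bar> powr q \<le> u * \<bar>s\<bar> powr q + v * \<bar>t\<bar> powr q"
proof -
  have "\<bar>u * s + v * t\<bar> \<le> u * \<bar>s\<bar> + v * \<bar>t\<bar>"
    using assms abs_triangle_ineq[of "u * s" "v * t"] by (simp add: abs_mult)
  then have "\<bar>u * s + v * t\<bar> powr q \<le> (u * \<bar>s\<bar> + v * \<bar>t\<bar>) powr q"
    using assms by (intro powr_mono2) auto
  also have "\<dots> \<le> u * \<bar>s\<bar> powr q + v * \<bar>t\<bar> powr q"
    by (rule convex_powr_nonneg) (use assms in auto)
  finally show ?thesis .
qed

lemma abs_powr_differentiable:
  fixes t q :: real
  assumes "1 < q" shows "(\<lambda>t. \<bar>t\<bar> powr q) differentiable (at t)"
proof (cases "t = 0")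
  case False
  then have pos: "0 < sgn t * t" by (simp add: sgn_if)
  have "((\<lambda>s. (sgn t * s) powr q) has_real_derivative (q * (sgn t * t) powr (q - 1)) * (sgn t * 1)) (at t)"
    by (rule DERIV_chain2[of "\<lambda>z. z powr q" _ "\<lambda>s. sgn t * s", OF has_real_derivative_powr[OF pos]
          DERIV_cmult[OF DERIV_ident]])
  then have "((\<lambda>s. \<bar>s\<bar> powr q) has_real_derivative (q * (sgn t * t) powr (q - 1)) * (sgn t * 1)) (at t)"
  proof (rule has_field_derivative_transform_within_open)
    show "open (if t > 0 then {0<..} else {..<0::real})" by simp
    show "t \<in> (if t > 0 then {0<..} else {..<0})" using False by auto
    show "(sgn t * s) powr q = \<bar>s\<bar> powr q" if "s \<in> (if t > 0 then {0<..} else {..<0})" for s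
      using that False by (auto simp: sgn_if split: if_splits)
  qed
  then show ?thesis using real_differentiable_def by blast
next
  case True
  have "((\<lambda>y. \<bar>y\<bar> powr q) has_real_derivative 0) (at 0)"
    unfolding DERIV_def
  proof (rule Lim_null_comparison)
    show "\<forall>\<^sub>F h in at 0. norm ((\<bar>0 + h\<bar> powr q - \<bar>0\<bar> powr q) / h) \<le> \<bar>h\<bar> powr (q - 1)"
    proof (rule always_eventually, rule allI)
      fix h :: real
      have "\<bar>h\<bar> powr q / \<bar>h\<bar> = \<bar>h\<bar> powr (q - 1)" if "h \<noteq> 0"
        using that by (simp add: powr_diff)
      then show "norm ((\<bar>0 + h\<bar> powr q - \<bar>0\<bar> powr q) / h) \<le> \<bar>h\<bar> powr (q - 1)"
        using assms by (cases "h = 0") auto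
    qed
    have "((\<lambda>h. \<bar>h\<bar> powr (q - 1)) \<longlongrightarrow> \<bar>0::real\<bar> powr (q - 1)) (at 0)"
      using assms by (intro tendsto_powr' tendsto_intros) auto
    then show "((\<lambda>h::real. \<bar>h\<bar> powr (q - 1)) \<longlongrightarrow> 0) (at 0)" by simp
  qed
  then show ?thesis using True real_differentiable_def by blast
qed

lemma f_edge_set:
  fixes x :: "real ^ 'v::finite"
  shows "finite {\<bar>x $ i - x $ j\<bar> | i j. i \<in> e \<and> j \<in> e}"
    and "e \<noteq> {} \<Longrightarrow> {\<bar>x $ i - x $ j\<bar> | i j. i \<in> e \<and> j \<in> e} \<noteq> {}"
proof -
  have "{\<bar>x $ i - x $ j\<bar> | i j. i \<in> e \<and> j \<in> e} = (\<lambda>(i, j). \<bar>x $ i - x $ j\<bar>) ` (e \<times> e)" by auto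
  then show "finite {\<bar>x $ i - x $ j\<bar> | i j. i \<in> e \<and> j \<in> e}" by simp
qed auto

lemma f_edge_ge: "i \<in> e \<Longrightarrow> j \<in> e \<Longrightarrow> \<bar>x $ i - x $ j\<bar> \<le> f_edge e x"
  unfolding f_edge_def by (rule Max_ge[OF f_edge_set(1)]) blast

lemma f_edge_attained:
  assumes "e \<noteq> {}" obtains i j where "i \<in> e" "j \<in> e" "f_edge e x = \<bar>x $ i - x $ j\<bar>"
  using Max_in[OF f_edge_set(1) f_edge_set(2)[OF assms]] unfolding f_edge_def by blast

lemma f_edge_nonneg: "e \<noteq> {} \<Longrightarrow> 0 \<le> f_edge e x"
  by (metis abs_ge_zero f_edge_attained)

lemma f_edge_Lipschitz:
  fixes x y :: "real ^ 'v::finite"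
  assumes "e \<noteq> {}" shows "f_edge e x \<le> f_edge e y + 2 * norm (x - y)"
proof -
  obtain i j where ij: "i \<in> e" "j \<in> e" "f_edge e x = \<bar>x $ i - x $ j\<bar>" by (rule f_edge_attained[OF assms])
  have "\<bar>(x - y) $ i\<bar> \<le> norm (x - y)" "\<bar>(x - y) $ j\<bar> \<le> norm (x - y)" by (rule component_le_norm_cart)+
  then show ?thesis using f_edge_ge[OF ij(1,2), of y] ij(3) by auto
qed

lemma continuous_on_f_edge:
  fixes e :: "'v::finite set"
  assumes "e \<noteq> {}" shows "continuous_on UNIV (f_edge e)"
proof (rule continuous_onI)
  fix x :: "real ^ 'v" and \<epsilon> :: real assume "\<epsilon> > 0"
  show "\<exists>d>0. \<forall>x'\<in>UNIV. dist x' x < d \<longrightarrow> dist (f_edge e x') (f_edge e x) \<le> \<epsilon>"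
  proof (intro exI[of _ "\<epsilon> / 2"] conjI ballI impI)
    fix y assume "dist y x < \<epsilon> / 2"
    then show "dist (f_edge e y) (f_edge e x) \<le> \<epsilon>"
      using f_edge_Lipschitz[OF assms, of y x] f_edge_Lipschitz[OF assms, of x y]
      by (auto simp: dist_norm norm_minus_commute)
  qed (use \<open>\<epsilon> > 0\<close> in auto)
qed

definition edge_sum :: "'v::finite set \<Rightarrow> real \<Rightarrow> real ^ 'v \<Rightarrow> real" where
  "edge_sum e q x = 1 / 2 * (\<Sum>i\<in>e. \<Sum>j\<in>e. \<bar>x $ i - x $ j\<bar> powr q)"

lemma f_edge_q_eq: "f_edge_q e q x = edge_sum e q x powr (1 / q)"
  by (simp add: f_edge_q_def edge_sum_def)

lemma edge_sum_nonneg: "0 \<le> edge_sum e q x"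
  unfolding edge_sum_def by (intro mult_nonneg_nonneg sum_nonneg) auto

lemma f_edge_q_nonneg: "0 \<le> f_edge_q e q x" by (simp add: f_edge_q_eq)

lemma f_edge_q_powr: "0 < q \<Longrightarrow> f_edge_q e q x powr q = edge_sum e q x"
  unfolding f_edge_q_eq using edge_sum_nonneg[of e q x] by (simp add: powr_powr)

lemma edge_sum_convex:
  assumes "0 \<le> u" "0 \<le> v" "u + v = 1" "1 \<le> q"
  shows "edge_sum e q (u *\<^sub>R x + v *\<^sub>R y) \<le> u * edge_sum e q x + v * edge_sum e q y"
proof -
  have "\<bar>(u *\<^sub>R x + v *\<^sub>R y) $ i - (u *\<^sub>R x + v *\<^sub>R y) $ j\<bar> powr q
      \<le> u * \<bar>x $ i - x $ j\<bar> powr q + v * \<bar>y $ i - y $ j\<bar> powr q" for i j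
    using convex_abs_powr[OF assms, of "x $ i - x $ j" "y $ i - y $ j"] by (simp add: algebra_simps)
  then have "(\<Sum>i\<in>e. \<Sum>j\<in>e. \<bar>(u *\<^sub>R x + v *\<^sub>R y) $ i - (u *\<^sub>R x + v *\<^sub>R y) $ j\<bar> powr q)
    \<le> (\<Sum>i\<in>e. \<Sum>j\<in>e. u * \<bar>x $ i - x $ j\<bar> powr q + v * \<bar>y $ i - y $ j\<bar> powr q)"
    by (intro sum_mono)
  then show ?thesis
    by (simp add: edge_sum_def sum.distrib sum_distrib_left[symmetric])
qed

lemma edge_sum_scaleR: "edge_sum e q (c *\<^sub>R x) = \<bar>c\<bar> powr q * edge_sum e q x"
proof -
  have "\<bar>(c *\<^sub>R x) $ i - (c *\<^sub>R x) $ j\<bar> powr q = \<bar>c\<bar> powr q * \<bar>x $ i - x $ j\<bar> powr q" for i j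
  proof -
    have "\<bar>(c *\<^sub>R x) $ i - (c *\<^sub>R x) $ j\<bar> = \<bar>c\<bar> * \<bar>x $ i - x $ j\<bar>"
      by (simp add: abs_mult[symmetric] right_diff_distrib)
    then show ?thesis by (simp add: powr_mult)
  qed
  then show ?thesis unfolding edge_sum_def by (simp add: sum_distrib_left[symmetric])
qed

lemma f_edge_q_scaleR:
  assumes "0 < q" shows "f_edge_q e q (c *\<^sub>R x) = \<bar>c\<bar> * f_edge_q e q x"
  unfolding f_edge_q_eq edge_sum_scaleR using assms edge_sum_nonneg[of e q x]
  by (simp add: powr_mult powr_powr)

lemma f_edge_q_le_1_iff:
  assumes "0 < q" shows "f_edge_q e q x \<le> 1 \<longleftrightarrow> edge_sum e q x \<le> 1"
proof
  assume "f_edge_q e q x \<le> 1"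
  then have "f_edge_q e q x powr q \<le> 1 powr q"
    using assms by (intro powr_mono2) (auto simp: f_edge_q_nonneg)
  then show "edge_sum e q x \<le> 1" using f_edge_q_powr[OF assms, of e x] by simp
next
  assume "edge_sum e q x \<le> 1"
  then have "edge_sum e q x powr (1/q) \<le> 1 powr (1/q)"
    using assms by (intro powr_mono2) (auto simp: edge_sum_nonneg)
  then show "f_edge_q e q x \<le> 1" by (simp add: f_edge_q_eq)
qed

text \<open>Minkowski's inequality: \<open>f_edge_q\<close> is the gauge of the convex set \<open>{x. edge_sum e q x \<le> 1}\<close>.\<close>

lemma f_edge_q_triangle:
  assumes q: "1 \<le> q" shows "f_edge_q e q (x + y) \<le> f_edge_q e q x + f_edge_q e q y"
proof (rule field_le_epsilon)
  fix \<delta> :: real assume \<delta>: "\<delta> > 0"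
  define \<alpha> \<beta> where "\<alpha> = f_edge_q e q x + \<delta> / 2" and "\<beta> = f_edge_q e q y + \<delta> / 2"
  have pos: "\<alpha> > 0" "\<beta> > 0"
    using \<delta> f_edge_q_nonneg[of e q x] f_edge_q_nonneg[of e q y] by (auto simp: \<alpha>_def \<beta>_def)
  have le: "f_edge_q e q x \<le> \<alpha>" "f_edge_q e q y \<le> \<beta>" using \<delta> by (auto simp: \<alpha>_def \<beta>_def)
  have unit: "edge_sum e q (z /\<^sub>R \<gamma>) \<le> 1" if "f_edge_q e q z \<le> \<gamma>" "\<gamma> > 0" for z \<gamma>
  proof -
    have "f_edge_q e q (z /\<^sub>R \<gamma>) = f_edge_q e q z / \<gamma>"
      using that q by (simp add: f_edge_q_scaleR divide_inverse mult.commute)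
    also have "\<dots> \<le> 1" using that by simp
    finally show ?thesis using q f_edge_q_le_1_iff[of q e "z /\<^sub>R \<gamma>"] by simp
  qed
  have sum1: "\<alpha> / (\<alpha> + \<beta>) + \<beta> / (\<alpha> + \<beta>) = 1" using pos by (simp flip: add_divide_distrib)
  then have "edge_sum e q ((\<alpha> / (\<alpha> + \<beta>)) *\<^sub>R (x /\<^sub>R \<alpha>) + (\<beta> / (\<alpha> + \<beta>)) *\<^sub>R (y /\<^sub>R \<beta>))
      \<le> \<alpha> / (\<alpha> + \<beta>) * edge_sum e q (x /\<^sub>R \<alpha>) + \<beta> / (\<alpha> + \<beta>) * edge_sum e q (y /\<^sub>R \<beta>)"
    using pos q by (intro edge_sum_convex) auto
  also have "\<dots> \<le> \<alpha> / (\<alpha> + \<beta>) * 1 + \<beta> / (\<alpha> + \<beta>) * 1"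
    using pos unit[OF le(1) pos(1)] unit[OF le(2) pos(2)] by (intro add_mono mult_left_mono) auto
  also have "\<dots> = 1" using sum1 by simp
  also have "(\<alpha> / (\<alpha> + \<beta>)) *\<^sub>R (x /\<^sub>R \<alpha>) + (\<beta> / (\<alpha> + \<beta>)) *\<^sub>R (y /\<^sub>R \<beta>) = (x + y) /\<^sub>R (\<alpha> + \<beta>)"
  proof -
    have "\<gamma> / (\<alpha> + \<beta>) * inverse \<gamma> = inverse (\<alpha> + \<beta>)" if "\<gamma> > 0" for \<gamma>
      using that pos by (simp add: divide_simps)
    from this[OF pos(1)] this[OF pos(2)] show ?thesis
      by (simp add: scaleR_add_right del: divide_const_simps times_divide_eq_left)
  qed
  finally have "f_edge_q e q ((x + y) /\<^sub>R (\<alpha> + \<beta>)) \<le> 1"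
    using q by (subst f_edge_q_le_1_iff) auto
  then have "f_edge_q e q (x + y) \<le> \<alpha> + \<beta>"
    using q pos by (subst (asm) f_edge_q_scaleR) (auto simp: field_simps)
  then show "f_edge_q e q (x + y) \<le> f_edge_q e q x + f_edge_q e q y + \<delta>" by (simp add: \<alpha>_def \<beta>_def)
qed

lemma f_edge_le_f_edge_q:
  assumes e: "e \<noteq> {}" and q: "0 < q" shows "f_edge e x \<le> f_edge_q e q x"
proof -
  obtain i j where ij: "i \<in> e" "j \<in> e" "f_edge e x = \<bar>x $ i - x $ j\<bar>" by (rule f_edge_attained[OF e])
  show ?thesis
  proof (cases "i = j")
    case True then show ?thesis using ij f_edge_q_nonneg[of e q x] by simp
  next
    case False
    have "(\<Sum>(k, l)\<in>{(i, j), (j, i)}. \<bar>x $ k - x $ l\<bar> powr q) \<le> (\<Sum>(k, l)\<in>e \<times> e. \<bar>x $ k - x $ l\<bar> powr q)"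
      using ij by (intro sum_mono2) auto
    then have "\<bar>x $ i - x $ j\<bar> powr q \<le> edge_sum e q x"
      using False by (simp add: edge_sum_def sum.cartesian_product abs_minus_commute)
    then have "(\<bar>x $ i - x $ j\<bar> powr q) powr (1 / q) \<le> edge_sum e q x powr (1 / q)"
      using q by (intro powr_mono2) auto
    then show ?thesis using ij(3) q by (simp add: powr_powr f_edge_q_eq)
  qed
qed

text \<open>An edge has at most \<open>N\<^sup>2\<close> ordered pairs of vertices.  The resulting factor tends to one as \<open>q\<close>
  tends to infinity, which is why the smooth energies approximate the original one.\<close>

lemma f_edge_q_le_f_edge:
  fixes e :: "'v::finite set"
  assumes e: "e \<noteq> {}" and q: "0 < q"
  shows "f_edge_q e q x \<le> ((real CARD('v))\<^sup>2) powr (1 / q) * f_edge e x"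
proof -
  let ?f = "f_edge e x"
  have f0: "?f \<ge> 0" by (rule f_edge_nonneg[OF e])
  have "(\<Sum>i\<in>e. \<Sum>j\<in>e. \<bar>x $ i - x $ j\<bar> powr q) \<le> (\<Sum>i\<in>e. \<Sum>j\<in>e. ?f powr q)"
    using q f_edge_ge by (intro sum_mono powr_mono2) auto
  also have "\<dots> = (real (card e))\<^sup>2 * ?f powr q" by (simp add: power2_eq_square)
  also have "\<dots> \<le> (real CARD('v))\<^sup>2 * ?f powr q"
    by (intro mult_right_mono power_mono) (auto simp: card_mono)
  finally have "edge_sum e q x \<le> (real CARD('v))\<^sup>2 * ?f powr q"
    using edge_sum_nonneg[of e q x] unfolding edge_sum_def by linarith
  then have "edge_sum e q x powr (1/q) \<le> ((real CARD('v))\<^sup>2 * ?f powr q) powr (1/q)"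
    using q by (intro powr_mono2) (auto simp: edge_sum_nonneg)
  also have "\<dots> = ((real CARD('v))\<^sup>2) powr (1/q) * ?f"
    using q f0 by (simp add: powr_mult powr_powr)
  finally show ?thesis by (simp add: f_edge_q_eq)
qed

text \<open>Where \<open>edge_sum\<close> is positive, the chain rule applies.  Where it vanishes, \<open>f_edge_q\<close> vanishes too and
  grows at most linearly around that point, so that its power with exponent \<open>p > 1\<close> has derivative zero.\<close>

lemma f_edge_q_powr_differentiable:
  fixes e :: "'v::finite set" and x :: "real ^ 'v"
  assumes e: "e \<noteq> {}" and p: "1 < p" and q: "1 < q"
  shows "(\<lambda>x. f_edge_q e q x powr p) differentiable (at x)"
proof (cases "edge_sum e q x = 0")
  case False
  have S: "edge_sum e q differentiable (at x)"
    unfolding edge_sum_def[abs_def]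
  proof (intro differentiable_mult differentiable_const differentiable_sum finite ballI)
    fix i j
    have "(\<lambda>x::real ^ 'v. x $ i - x $ j) differentiable (at x)"
      by (intro differentiable_diff linear_imp_differentiable bounded_linear.linear bounded_linear_vec_nth)
    from differentiable_compose[OF abs_powr_differentiable[OF q] this]
    show "(\<lambda>x::real ^ 'v. \<bar>x $ i - x $ j\<bar> powr q) differentiable (at x)" .
  qed
  have pos: "edge_sum e q x > 0" using False edge_sum_nonneg[of e q x] by simp
  have "(\<lambda>s. s powr (p / q)) differentiable (at (edge_sum e q x))"
    using has_real_derivative_powr[OF pos] real_differentiable_def by blast
  from differentiable_compose[OF this S]
  show ?thesis by (simp add: f_edge_q_eq powr_powr)
next
  case True
  let ?C = "((real CARD('v))\<^sup>2) powr (1 / q) * 2"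
  have fx: "f_edge_q e q x = 0" using True by (simp add: f_edge_q_eq)
  have le: "f_edge_q e q y \<le> ?C * norm (y - x)" for y
  proof -
    have "f_edge_q e q y \<le> f_edge_q e q x + f_edge_q e q (y - x)"
      using f_edge_q_triangle[of q e x "y - x"] q by simp
    also have "\<dots> \<le> ((real CARD('v))\<^sup>2) powr (1 / q) * f_edge e (y - x)"
      using fx f_edge_q_le_f_edge[OF e, of q "y - x"] q by simp
    also have "f_edge e (y - x) \<le> f_edge e 0 + 2 * norm (y - x)"
      using f_edge_Lipschitz[OF e, of "y - x" 0] by simp
    also have "f_edge e (0::real ^ 'v) = 0"
      by (rule f_edge_attained[OF e, of 0]) simp
    finally show ?thesis by (simp add: mult_left_mono)
  qed
  have "((\<lambda>x. f_edge_q e q x powr p) has_derivative (\<lambda>h. 0)) (at x)"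
    unfolding has_derivative_at
  proof (intro conjI bounded_linear_zero, rule Lim_null_comparison)
    show "\<forall>\<^sub>F h in at 0. norm (norm (f_edge_q e q (x + h) powr p - f_edge_q e q x powr p - 0) / norm h)
        \<le> ?C powr p * norm h powr (p - 1)"
    proof (rule always_eventually, rule allI)
      fix h :: "real ^ 'v"
      have "f_edge_q e q (x + h) powr p \<le> (?C * norm h) powr p"
        using le[of "x + h"] p by (intro powr_mono2) (auto simp: f_edge_q_nonneg)
      also have "\<dots> = ?C powr p * norm h powr p" by (simp add: powr_mult)
      finally have "f_edge_q e q (x + h) powr p / norm h \<le> ?C powr p * norm h powr p / norm h"
        by (rule divide_right_mono) simp
      also have "?C powr p * norm h powr p / norm h = ?C powr p * norm h powr (p - 1)"
      proof (cases "h = 0")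
        case False
        then have "norm h powr p / norm h = norm h powr (p - 1)" by (simp add: powr_diff)
        then show ?thesis by (metis times_divide_eq_right)
      qed simp
      finally show "norm (norm (f_edge_q e q (x + h) powr p - f_edge_q e q x powr p - 0) / norm h)
        \<le> ?C powr p * norm h powr (p - 1)" using fx by simp
    qed
    have "((\<lambda>h::real ^ 'v. ?C powr p * norm h powr (p - 1)) \<longlongrightarrow> ?C powr p * norm (0::real ^ 'v) powr (p - 1)) (at 0)"
      using p by (intro tendsto_powr' tendsto_intros) auto
    then show "((\<lambda>h::real ^ 'v. ?C powr p * norm h powr (p - 1)) \<longlongrightarrow> 0) (at 0)" by simp
  qed
  then show ?thesis by (auto simp: differentiable_def)
qed

lemma f_edge_q_powr_convex:
  assumes "0 \<le> u" "0 \<le> v" "u + v = 1" "1 < p" "1 < q"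
  shows "f_edge_q e q (u *\<^sub>R x + v *\<^sub>R y) powr p \<le> u * f_edge_q e q x powr p + v * f_edge_q e q y powr p"
proof -
  have "f_edge_q e q (u *\<^sub>R x + v *\<^sub>R y) \<le> f_edge_q e q (u *\<^sub>R x) + f_edge_q e q (v *\<^sub>R y)"
    using assms by (intro f_edge_q_triangle) auto
  also have "\<dots> = u * f_edge_q e q x + v * f_edge_q e q y" using assms by (simp add: f_edge_q_scaleR)
  finally have "f_edge_q e q (u *\<^sub>R x + v *\<^sub>R y) powr p \<le> (u * f_edge_q e q x + v * f_edge_q e q y) powr p"
    using assms by (intro powr_mono2) (auto simp: f_edge_q_nonneg)
  also have "\<dots> \<le> u * f_edge_q e q x powr p + v * f_edge_q e q y powr p"
    using assms by (intro convex_powr_nonneg) (auto simp: f_edge_q_nonneg)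
  finally show ?thesis .
qed

lemma hyperedge_nonempty: "weighted_hypergraph E w \<Longrightarrow> e \<in> E \<Longrightarrow> e \<noteq> {}"
  unfolding weighted_hypergraph_def by force

lemma hyperedge_weight_pos: "weighted_hypergraph E w \<Longrightarrow> e \<in> E \<Longrightarrow> 0 < w e"
  unfolding weighted_hypergraph_def by blast

locale hypergraph_energy =
  fixes E :: "'v::finite set set" and w :: "'v set \<Rightarrow> real" and p :: real
  assumes hg: "weighted_hypergraph E w" and p: "1 < p"
begin

abbreviation \<phi> :: "real ^ 'v \<Rightarrow> real" where "\<phi> \<equiv> energy E w p"

abbreviation \<phi>q :: "real \<Rightarrow> real ^ 'v \<Rightarrow> real" where "\<phi>q \<equiv> energy_q E w p"

abbreviation D\<phi>q :: "real \<Rightarrow> real ^ 'v \<Rightarrow> real ^ 'v" where "D\<phi>q q \<equiv> gradient (energy_q E w p q)"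

lemma energy_q_differentiable: "1 < q \<Longrightarrow> \<phi>q q differentiable (at x)"
  unfolding energy_q_def[abs_def]
  by (intro differentiable_mult differentiable_const differentiable_sum finite ballI
      f_edge_q_powr_differentiable hyperedge_nonempty[OF hg] p)

lemma energy_q_convex:
  assumes q: "1 < q" shows "convex_on UNIV (\<phi>q q)"
  unfolding convex_on_def
proof (intro conjI ballI allI impI convex_UNIV)
  fix x y :: "real ^ 'v" and u v :: real assume uv: "0 \<le> u" "0 \<le> v" "u + v = 1"
  have "(\<Sum>e\<in>E. w e * f_edge_q e q (u *\<^sub>R x + v *\<^sub>R y) powr p)
     \<le> (\<Sum>e\<in>E. w e * (u * f_edge_q e q x powr p + v * f_edge_q e q y powr p))"
    using hyperedge_weight_pos[OF hg] by (intro sum_mono mult_left_mono f_edge_q_powr_convex uv p q) (auto intro: less_imp_le)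
  also have "\<dots> = u * (\<Sum>e\<in>E. w e * f_edge_q e q x powr p) + v * (\<Sum>e\<in>E. w e * f_edge_q e q y powr p)"
    by (simp add: sum_distrib_left sum.distrib algebra_simps)
  finally have "1 / p * (\<Sum>e\<in>E. w e * f_edge_q e q (u *\<^sub>R x + v *\<^sub>R y) powr p)
      \<le> 1 / p * (u * (\<Sum>e\<in>E. w e * f_edge_q e q x powr p) + v * (\<Sum>e\<in>E. w e * f_edge_q e q y powr p))"
    using p by (intro mult_left_mono) auto
  then show "\<phi>q q (u *\<^sub>R x + v *\<^sub>R y) \<le> u * \<phi>q q x + v * \<phi>q q y"
    unfolding energy_q_def by (simp add: algebra_simps)
qed

lemma energy_q_gradient_inequality:
  "1 < q \<Longrightarrow> D\<phi>q q x \<bullet> (z - x) \<le> \<phi>q q z - \<phi>q q x"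
  by (rule convex_gradient_inequality[OF energy_q_convex energy_q_differentiable])

lemma energy_q_gradient_continuous: "1 < q \<Longrightarrow> continuous_on UNIV (D\<phi>q q)"
  by (rule convex_gradient_continuous[OF energy_q_convex energy_q_differentiable])

lemma energy_q_zero: "\<phi>q q 0 = 0"
  using p by (simp add: energy_q_def f_edge_q_def)

lemma energy_nonneg: "0 \<le> \<phi> x"
  unfolding energy_def using p hyperedge_weight_pos[OF hg]
  by (intro mult_nonneg_nonneg sum_nonneg) (auto intro: less_imp_le)

lemma energy_continuous: "continuous_on A (\<phi>)"
proof -
  have "continuous_on UNIV (\<lambda>x. f_edge e x powr p)" if "e \<in> E" for e
    using p hyperedge_nonempty[OF hg that] f_edge_nonneg
    by (intro continuous_on_powr' continuous_on_f_edge continuous_intros) auto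
  then have "continuous_on UNIV (\<phi>)"
    unfolding energy_def[abs_def] by (intro continuous_on_mult continuous_on_const continuous_on_sum)
  then show ?thesis using continuous_on_subset by blast
qed

lemma energy_le_energy_q: "0 < q \<Longrightarrow> \<phi> x \<le> \<phi>q q x"
  unfolding energy_def energy_q_def using p hyperedge_weight_pos[OF hg] hyperedge_nonempty[OF hg]
  by (intro mult_left_mono sum_mono powr_mono2 f_edge_le_f_edge_q f_edge_nonneg) (auto intro: less_imp_le)

lemma energy_q_le_energy:
  assumes q: "0 < q"
  shows "\<phi>q q x \<le> ((real CARD('v))\<^sup>2) powr (p / q) * \<phi> x"
proof -
  have "f_edge_q e q x powr p \<le> ((real CARD('v))\<^sup>2) powr (p / q) * f_edge e x powr p" if e: "e \<in> E" for e
  proof -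
    have "f_edge_q e q x powr p \<le> (((real CARD('v))\<^sup>2) powr (1 / q) * f_edge e x) powr p"
      using p by (intro powr_mono2 f_edge_q_le_f_edge hyperedge_nonempty[OF hg e] q f_edge_q_nonneg) auto
    also have "\<dots> = ((real CARD('v))\<^sup>2) powr (p / q) * f_edge e x powr p"
      using f_edge_nonneg[OF hyperedge_nonempty[OF hg e], of x] by (simp add: powr_mult powr_powr)
    finally show ?thesis .
  qed
  then have "(\<Sum>e\<in>E. w e * f_edge_q e q x powr p)
      \<le> (\<Sum>e\<in>E. w e * (((real CARD('v))\<^sup>2) powr (p / q) * f_edge e x powr p))"
    using hyperedge_weight_pos[OF hg] by (intro sum_mono mult_left_mono) (auto intro: less_imp_le)
  also have "\<dots> = ((real CARD('v))\<^sup>2) powr (p / q) * (\<Sum>e\<in>E. w e * f_edge e x powr p)"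
    by (simp only: sum_distrib_left mult.left_commute)
  finally have "1 / p * (\<Sum>e\<in>E. w e * f_edge_q e q x powr p)
      \<le> 1 / p * (((real CARD('v))\<^sup>2) powr (p / q) * (\<Sum>e\<in>E. w e * f_edge e x powr p))"
    using p by (intro mult_left_mono) auto
  then show ?thesis unfolding energy_def energy_q_def by (simp add: algebra_simps)
qed

end


section \<open>A priori estimates and solvability of the penalised equation\<close>

lemma L2_primitive_AE_cong:
  assumes u: "L2_primitive T f u" and g: "L2_fun T g" and eq: "AE t in lebesgue_on {0..T}. f t = g t"
  shows "L2_primitive T g u"
proof (rule L2_primitiveI[OF g])
  fix t assume t: "t \<in> {0..T}"
  have "integral {0..t} f = integral {0..t} g"
    by (rule integral_cong_AE_lebesgue_on(1)[OF eq]) (use t in auto)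
  then show "u t = u 0 + integral {0..t} g" using L2_primitive_eq[OF u t] by simp
qed

text \<open>At a point where \<open>norm u\<close> attains its maximum \<open>Y\<close>, the energy identity gives
  \<open>Y\<^sup>2 \<le> A + 2 * (Y * K)\<close>, where \<open>K\<close> is the integral of \<open>k\<close> and \<open>A\<close> is the number under the square root.
  Solve for \<open>Y\<close>.\<close>

lemma L2_primitive_energy_bound:
  fixes u :: "real \<Rightarrow> 'a::euclidean_space"
  assumes u: "L2_primitive T f u" and k: "k integrable_on {0..T}" and c0: "0 \<le> c"
    and k0: "\<And>r. r \<in> {0..T} \<Longrightarrow> 0 \<le> k r"
    and diss: "\<And>r. r \<in> {0..T} \<Longrightarrow> f r \<bullet> u r \<le> k r * norm (u r) + c"
    and t: "t \<in> {0..T}"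
  shows "norm (u t) \<le> 2 * integral {0..T} k + sqrt ((norm (u 0))\<^sup>2 + 2 * (c * T))"
proof -
  have "\<exists>s\<in>{0..T}. \<forall>r\<in>{0..T}. norm (u r) \<le> norm (u s)"
    using t by (intro continuous_attains_sup continuous_on_norm L2_primitive_continuous[OF u]) auto
  then obtain s where s: "s \<in> {0..T}" "\<And>r. r \<in> {0..T} \<Longrightarrow> norm (u r) \<le> norm (u s)" by blast
  define Y K A where "Y = norm (u s)" and "K = integral {0..T} k" and "A = (norm (u 0))\<^sup>2 + 2 * (c * T)"
  have K0: "K \<ge> 0" unfolding K_def by (rule integral_nonneg[OF k k0])
  have A0: "A \<ge> 0" using c0 t by (auto simp: A_def intro!: add_nonneg_nonneg mult_nonneg_nonneg)
  have ks: "k integrable_on {0..s}" by (rule integrable_on_subsegment[OF k]) (use s in auto)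
  have fu: "(\<lambda>r. f r \<bullet> u r) integrable_on {0..s}"
    by (rule integrable_on_subsegment)
       (use L2_fun_inner_integrable[OF L2_primitive_fun[OF u] L2_fun_continuous[OF L2_primitive_continuous[OF u]]] s in
         \<open>auto simp: absolutely_integrable_on_def\<close>)
  have bd: "((\<lambda>r. Y * k r + c) has_integral (Y * integral {0..s} k + c * s)) {0..s}"
    using has_integral_const_real[of c 0 s] s
    by (intro has_integral_add has_integral_mult_right integrable_integral ks) (simp add: mult.commute)
  have "integral {0..s} (\<lambda>r. f r \<bullet> u r) \<le> integral {0..s} (\<lambda>r. Y * k r + c)"
  proof (rule integral_le[OF fu has_integral_integrable[OF bd]])
    fix r assume r: "r \<in> {0..s}"
    then have rT: "r \<in> {0..T}" using s by auto
    have "k r * norm (u r) \<le> k r * Y" unfolding Y_def by (intro mult_left_mono s(2) k0 rT)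
    then show "f r \<bullet> u r \<le> Y * k r + c" using diss[OF rT] by (simp add: mult.commute)
  qed
  also have "\<dots> = Y * integral {0..s} k + c * s" by (rule integral_unique[OF bd])
  also have "\<dots> \<le> Y * K + c * T"
    using s k0 c0 unfolding K_def Y_def
    by (intro add_mono mult_left_mono integral_subset_le ks k) auto
  finally have "Y\<^sup>2 \<le> A + 2 * (Y * K)"
    using L2_primitive_norm_sq[OF u, of s] s by (simp add: A_def Y_def)
  then have "(Y - K)\<^sup>2 \<le> A + K\<^sup>2" by (simp add: power2_eq_square algebra_simps)
  also have "\<dots> \<le> (sqrt A + K)\<^sup>2" using A0 K0 by (simp add: power2_sum)
  finally have "Y - K \<le> sqrt A + K" by (rule power2_le_imp_le) (use A0 K0 in auto)
  then show ?thesis using s(2)[OF t] by (simp add: Y_def K_def A_def)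
qed

lemma bounded_linear_H_proj: "bounded_linear (H_proj C)"
  unfolding linear_conv_bounded_linear[symmetric]
  by (rule linearI) (auto simp: H_proj_def vec_eq_iff)

lemma H_proj_nth: "H_proj C z $ i = (if i \<in> C then z $ i else 0)" by (simp add: H_proj_def)

lemma H_proj_idem: "H_proj C (H_proj C z) = H_proj C z" by (simp add: vec_eq_iff H_proj_nth)

lemma inner_H_proj: "H_proj C y \<bullet> z = H_proj C y \<bullet> H_proj C z"
  unfolding inner_vec_def by (intro sum.cong) (auto simp: H_proj_nth)

lemma H_proj_inner_self: "H_proj C z \<bullet> z = (norm (H_proj C z))\<^sup>2"
  by (simp add: inner_H_proj[of C z z] power2_norm_eq_inner)

lemma norm_H_proj_le: "norm (H_proj C z) \<le> norm z"
  by (rule norm_le_componentwise_cart) (simp add: H_proj_nth)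

lemma H_proj_add: "H_proj C (y + z) = H_proj C y + H_proj C z"
  and H_proj_diff: "H_proj C (y - z) = H_proj C y - H_proj C z"
  and H_proj_scaleR: "H_proj C (c *\<^sub>R z) = c *\<^sub>R H_proj C z"
  by (simp_all add: vec_eq_iff H_proj_nth)

lemma H_proj_control: "a \<in> controls T C \<Longrightarrow> t \<in> {0..T} \<Longrightarrow> H_proj C (a t) = a t"
  by (auto simp: controls_def vec_eq_iff H_proj_nth)

lemma adm_control_controls: "a \<in> adm_controls T C M \<Longrightarrow> a \<in> controls T C"
  by (simp add: adm_controls_def)

lemma control_continuous: "a \<in> controls T C \<Longrightarrow> continuous_on {0..T} a"
  by (simp add: controls_def W12_def)

lemma adm_control_primitive:
  assumes "0 < T" "a \<in> adm_controls T C M"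
  shows "L2_primitive T (wderiv T a) a" "integral {0..T} (\<lambda>t. (norm (wderiv T a t))\<^sup>2) \<le> M"
proof -
  show p: "L2_primitive T (wderiv T a) a"
    using assms by (intro W12_imp_L2_primitive) (auto simp: adm_controls_def controls_def)
  show "integral {0..T} (\<lambda>t. (norm (wderiv T a t))\<^sup>2) \<le> M"
    using assms(2) LINT_sq_eq_integral[OF L2_primitive_fun[OF p]] by (simp add: adm_controls_def)
qed

text \<open>The radial retraction onto the ball of radius \<open>R\<close>.\<close>

definition radial :: "real \<Rightarrow> 'a::real_normed_vector \<Rightarrow> 'a" where
  "radial R x = (R / max R (norm x)) *\<^sub>R x"

lemma radial_continuous: "0 < R \<Longrightarrow> continuous_on UNIV (radial R)"
  unfolding radial_def[abs_def] by (intro continuous_intros) auto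

lemma norm_radial_le: "0 < R \<Longrightarrow> norm (radial R x) \<le> R"
  by (auto simp: radial_def max_def field_simps)

lemma radial_id: "0 < R \<Longrightarrow> norm x \<le> R \<Longrightarrow> radial R x = x"
  by (simp add: radial_def max_def)

text \<open>Truncating \<open>G\<close> radially preserves its sign condition, hence the a priori bound, which does not
  involve the truncation radius.\<close>

lemma dissipative_ODE_solvable:
  fixes G :: "'a::euclidean_space \<Rightarrow> 'a"
  assumes T: "0 < T" and G: "continuous_on UNIV G" and pos: "\<And>x. 0 \<le> G x \<bullet> x" and g: "L2_fun T g"
  obtains y where "y 0 = x0" "L2_primitive T (\<lambda>t. g t - G (y t)) y"
proof -
  define K where "K = integral {0..T} (\<lambda>t. norm (g t))"
  have ig: "(\<lambda>t. norm (g t)) integrable_on {0..T}" by (rule L2_fun_norm_integrable_on[OF g])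
  have K0: "0 \<le> K" unfolding K_def by (rule integral_nonneg[OF ig]) auto
  define R where "R = 2 * K + norm x0 + 1"
  have R: "R > 0" unfolding R_def using K0 norm_ge_zero[of x0] by linarith
  have cont: "continuous_on UNIV (\<lambda>x. G (radial R x))"
    by (rule continuous_on_compose2[OF G radial_continuous[OF R]]) auto
  have "compact (G ` cball 0 R)"
    using G by (intro compact_continuous_image) (auto intro: continuous_on_subset)
  then obtain B where B: "\<And>z. z \<in> G ` cball 0 R \<Longrightarrow> norm z \<le> B"
    using compact_imp_bounded bounded_iff by metis
  have Gb: "norm (G (radial R x)) \<le> B" for x by (rule B) (simp add: norm_radial_le[OF R])
  obtain y where y: "y 0 = x0" "L2_primitive T (\<lambda>t. g t - G (radial R (y t))) y"
    by (rule Peano_bounded[OF T cont Gb g])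
  have "norm (y t) \<le> R" if t: "t \<in> {0..T}" for t
  proof -
    have diss: "(g r - G (radial R (y r))) \<bullet> y r \<le> norm (g r) * norm (y r) + 0" for r
    proof -
      define c where "c = max R (norm (y r)) / R"
      have c: "c \<ge> 0" using R by (simp add: c_def)
      have "y r = c *\<^sub>R radial R (y r)" using R by (simp add: c_def radial_def max_def)
      then have "G (radial R (y r)) \<bullet> y r = c * (G (radial R (y r)) \<bullet> radial R (y r))"
        by (metis inner_scaleR_right)
      then have "0 \<le> G (radial R (y r)) \<bullet> y r" using c pos by simp
      moreover have "g r \<bullet> y r \<le> norm (g r) * norm (y r)" by (rule norm_cauchy_schwarz)
      ultimately show ?thesis by (simp add: inner_diff_left)
    qed
    have "norm (y t) \<le> 2 * integral {0..T} (\<lambda>t. norm (g t)) + sqrt ((norm (y 0))\<^sup>2 + 2 * (0 * T))"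
      by (rule L2_primitive_energy_bound[OF y(2) ig _ _ diss t]) auto
    then show ?thesis by (simp add: R_def K_def y(1))
  qed
  then have eq: "radial R (y t) = y t" if "t \<in> {0..T}" for t using that R by (simp add: radial_id)
  have "L2_primitive T (\<lambda>t. g t - G (y t)) y"
  proof (rule L2_primitive_AE_cong[OF y(2)])
    show "L2_fun T (\<lambda>t. g t - G (y t))"
      by (intro L2_fun_diff g L2_fun_continuous continuous_on_compose2[OF G L2_primitive_continuous[OF y(2)]]) auto
    show "AE t in lebesgue_on {0..T}. g t - G (radial R (y t)) = g t - G (y t)"
      by (rule AE_I2) (simp add: eq)
  qed
  then show ?thesis using that y(1) by blast
qed

locale hypergraph_flow = hypergraph_energy E w p
  for E :: "'v::finite set set" and w :: "'v set \<Rightarrow> real" and p :: real +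
  fixes C :: "'v set" and T :: real and h :: "real \<Rightarrow> real ^ 'v" and \<xi> :: "'v \<Rightarrow> real"
  assumes T: "0 < T" and h: "L2_fun T h"
begin

definition penalised_rate :: "real \<Rightarrow> real \<Rightarrow> (real \<Rightarrow> real ^ 'v) \<Rightarrow> (real \<Rightarrow> real ^ 'v) \<Rightarrow> real \<Rightarrow> real ^ 'v" where
  "penalised_rate q lam a x t = h t - D\<phi>q q (x t) - (1 / lam) *\<^sub>R (H_proj C (x t) - a t)"

lemma gradient_continuous_along:
  assumes "1 < q" "continuous_on {0..T} x"
  shows "continuous_on {0..T} (\<lambda>t. D\<phi>q q (x t))"
  by (rule continuous_on_compose2[OF energy_q_gradient_continuous[OF assms(1)] assms(2)]) auto

lemma H_proj_continuous_along:
  "continuous_on {0..T} x \<Longrightarrow> continuous_on {0..T} (\<lambda>t. H_proj C (x t))"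
  by (rule bounded_linear.continuous_on[OF bounded_linear_H_proj])

lemma penalised_rate_L2:
  assumes "1 < q" "continuous_on {0..T} x" "continuous_on {0..T} a"
  shows "L2_fun T (penalised_rate q lam a x)"
  unfolding penalised_rate_def[abs_def]
  by (intro L2_fun_diff h L2_fun_continuous continuous_intros gradient_continuous_along
      H_proj_continuous_along assms)

lemma is_state_q_iff:
  assumes q: "1 < q" and a: "continuous_on {0..T} a"
  shows "is_state_q T C E w p h \<xi> q lam a x \<longleftrightarrow>
    L2_primitive T (penalised_rate q lam a x) x \<and> x 0 = init_state C \<xi> a"
proof -
  have alg: "(d + g + l = k) = (d = k - g - l)" for d g l k :: "real ^ 'v" by (auto simp: algebra_simps)
  have eq: "(wderiv T x t + D\<phi>q q (x t) + (1 / lam) *\<^sub>R (H_proj C (x t) - a t) = h t)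
      = (wderiv T x t = penalised_rate q lam a x t)" for t
    unfolding penalised_rate_def by (rule alg)
  show ?thesis
    unfolding is_state_q_def eq
  proof (intro iffI conjI; (elim conjE)?)
    assume W: "W12 T x" and ae: "AE t in lebesgue_on {0..T}. wderiv T x t = penalised_rate q lam a x t"
    have px: "L2_primitive T (wderiv T x) x" by (rule W12_imp_L2_primitive[OF T W])
    show "L2_primitive T (penalised_rate q lam a x) x"
      by (rule L2_primitive_AE_cong[OF px penalised_rate_L2[OF q L2_primitive_continuous[OF px] a] ae])
  next
    assume px: "L2_primitive T (penalised_rate q lam a x) x"
    show W: "W12 T x" by (rule L2_primitive_imp_W12[OF T px])
    show "AE t in lebesgue_on {0..T}. wderiv T x t = penalised_rate q lam a x t"
      by (rule L2_primitive_unique_AE[OF W12_imp_L2_primitive[OF T W] px])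
  qed auto
qed

lemma gradient_dissipative:
  assumes q: "1 < q" shows "0 \<le> D\<phi>q q x \<bullet> x"
proof -
  have "D\<phi>q q x \<bullet> (0 - x) \<le> \<phi>q q 0 - \<phi>q q x"
    by (rule energy_q_gradient_inequality[OF q])
  moreover have "0 \<le> \<phi>q q x"
    using energy_nonneg[of x] energy_le_energy_q[of q x] q by simp
  ultimately show ?thesis by (simp add: energy_q_zero)
qed

lemma state_q_exists:
  assumes q: "1 < q" and lam: "0 < lam" and a: "continuous_on {0..T} a"
  shows "\<exists>x. is_state_q T C E w p h \<xi> q lam a x"
proof -
  define G where "G x = D\<phi>q q x + (1 / lam) *\<^sub>R H_proj C x" for x
  have "continuous_on UNIV G"
    unfolding G_def[abs_def]
    by (intro continuous_intros energy_q_gradient_continuous[OF q]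
        bounded_linear.continuous_on[OF bounded_linear_H_proj])
  moreover have "0 \<le> G x \<bullet> x" for x
    unfolding G_def inner_add_left inner_scaleR_left H_proj_inner_self
    using gradient_dissipative[OF q, of x] lam by (intro add_nonneg_nonneg mult_nonneg_nonneg) auto
  moreover have "L2_fun T (\<lambda>t. h t + (1 / lam) *\<^sub>R a t)"
    by (intro L2_fun_add h L2_fun_scaleR L2_fun_continuous a)
  ultimately obtain y where y: "y 0 = init_state C \<xi> a"
      "L2_primitive T (\<lambda>t. h t + (1 / lam) *\<^sub>R a t - G (y t)) y"
    by (rule dissipative_ODE_solvable[OF T])
  have "(\<lambda>t. h t + (1 / lam) *\<^sub>R a t - G (y t)) = penalised_rate q lam a y"
    by (auto simp: fun_eq_iff G_def penalised_rate_def algebra_simps)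
  then show ?thesis using y is_state_q_iff[OF q a] by auto
qed

text \<open>The bound is uniform in \<open>q > 1\<close> since the factor between the energies is largest at \<open>q = 1\<close>.\<close>

lemma energy_bounded_on_balls:
  obtains \<Phi> where "0 \<le> \<Phi>" "\<And>q z. 1 < q \<Longrightarrow> norm z \<le> r \<Longrightarrow> \<phi>q q z \<le> \<Phi>"
    "\<And>z. norm z \<le> r \<Longrightarrow> \<phi> z \<le> \<Phi>"
proof -
  have "bounded (\<phi> ` cball 0 r)"
    by (intro compact_imp_bounded compact_continuous_image energy_continuous compact_cball)
  then obtain B where B: "\<And>z. norm z \<le> r \<Longrightarrow> \<phi> z \<le> B"
    unfolding bounded_iff by (metis abs_le_D1 imageI mem_cball_0 real_norm_def)
  define N where "N = (real CARD('v))\<^sup>2"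
  have N1: "N \<ge> 1" unfolding N_def by (simp add: one_le_power)
  define \<Phi> where "\<Phi> = N powr p * \<bar>B\<bar>"
  have Np: "N powr p \<ge> 1" using N1 p by (simp add: ge_one_powr_ge_zero)
  show ?thesis
  proof
    show "0 \<le> \<Phi>" by (simp add: \<Phi>_def)
    fix z :: "real ^ 'v" assume z: "norm z \<le> r"
    have "\<phi> z \<le> 1 * \<bar>B\<bar>" using B[OF z] by simp
    also have "\<dots> \<le> \<Phi>" unfolding \<Phi>_def using Np by (intro mult_right_mono) auto
    finally show "\<phi> z \<le> \<Phi>" .
    fix q :: real assume q: "1 < q"
    have "\<phi>q q z \<le> N powr (p / q) * \<phi> z"
      unfolding N_def using q by (intro energy_q_le_energy) auto
    also have "\<dots> \<le> N powr p * \<bar>B\<bar>"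
      using B[OF z] N1 p q energy_nonneg[of z]
      by (intro mult_mono powr_mono) (auto simp: field_simps)
    finally show "\<phi>q q z \<le> \<Phi>" by (simp add: \<Phi>_def)
  qed
qed

text \<open>Use the subgradient inequality for a unit step in the direction of the gradient.\<close>

lemma norm_gradient_le:
  assumes q: "1 < q" and \<Phi>: "\<And>z. norm z \<le> norm x + 1 \<Longrightarrow> \<phi>q q z \<le> \<Phi>" "0 \<le> \<Phi>"
  shows "norm (D\<phi>q q x) \<le> \<Phi>"
proof (cases "D\<phi>q q x = 0")
  case False
  define v where "v = D\<phi>q q x /\<^sub>R norm (D\<phi>q q x)"
  have nv: "norm v = 1" using False by (simp add: v_def)
  have "norm (D\<phi>q q x) = D\<phi>q q x \<bullet> v"
    using False by (simp add: v_def dot_square_norm power2_eq_square)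
  also have "\<dots> \<le> \<phi>q q (x + v) - \<phi>q q x"
    using energy_q_gradient_inequality[OF q, of x "x + v"] by simp
  also have "\<dots> \<le> \<phi>q q (x + v)"
    using energy_nonneg[of x] energy_le_energy_q[of q x] q by simp
  also have "\<dots> \<le> \<Phi>" using norm_triangle_ineq[of x v] nv by (intro \<Phi>) simp
  finally show ?thesis .
qed (use \<Phi> in simp)

text \<open>The function \<open>z\<close> is the violation \<open>H x - a\<close> of the constraint, which relaxes at the rate \<open>1 / lam\<close>.
  Test its equation \<open>z' + z / lam = r\<close> with \<open>z'\<close>: the penalty term is then the derivative of
  \<open>(norm z)\<^sup>2 / (2 * lam)\<close>, and \<open>z\<close> starts at zero.\<close>

lemma penalty_estimate:
  fixes z :: "real \<Rightarrow> 'a::euclidean_space"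
  assumes lam: "0 < lam" and z: "L2_primitive T (\<lambda>t. r t - (1 / lam) *\<^sub>R z t) z" and r: "L2_fun T r"
    and z0: "z 0 = 0" and B: "integral {0..T} (\<lambda>t. (norm (r t))\<^sup>2) \<le> B"
  shows "\<And>t. t \<in> {0..T} \<Longrightarrow> (norm (z t))\<^sup>2 \<le> lam * B"
    and "integral {0..T} (\<lambda>t. (norm ((1 / lam) *\<^sub>R z t))\<^sup>2) \<le> 4 * B"
proof -
  define z' where "z' = (\<lambda>t. r t - (1 / lam) *\<^sub>R z t)"
  have z': "L2_primitive T z' z" using z by (simp add: z'_def)
  note L = L2_primitive_fun[OF z'] and Lz = L2_fun_continuous[OF L2_primitive_continuous[OF z]]
  have Li: "(\<lambda>s. z' s \<bullet> z s) integrable_on {0..t}" "(\<lambda>s. (norm (z' s))\<^sup>2) integrable_on {0..t}"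
      "(\<lambda>s. (norm (r s))\<^sup>2) integrable_on {0..t}" if "t \<in> {0..T}" for t
  proof -
    have "(\<lambda>s. z' s \<bullet> z s) integrable_on {0..T}"
      using L2_fun_inner_integrable[OF L Lz] by (simp add: absolutely_integrable_on_def)
    then show "(\<lambda>s. z' s \<bullet> z s) integrable_on {0..t}" by (rule integrable_on_subsegment) (use that in auto)
    show "(\<lambda>s. (norm (z' s))\<^sup>2) integrable_on {0..t}"
      by (rule integrable_on_subsegment[OF L2_fun_sq_integrable_on[OF L]]) (use that in auto)
    show "(\<lambda>s. (norm (r s))\<^sup>2) integrable_on {0..t}"
      by (rule integrable_on_subsegment[OF L2_fun_sq_integrable_on[OF r]]) (use that in auto)
  qed
  have test: "integral {0..t} (\<lambda>s. (norm (z' s))\<^sup>2) + (1 / lam) * (norm (z t))\<^sup>2 \<le> B" if t: "t \<in> {0..T}" for t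
  proof -
    have "integral {0..t} (\<lambda>s. (norm (z' s))\<^sup>2 + (2 / lam) * (z' s \<bullet> z s)) \<le> integral {0..t} (\<lambda>s. (norm (r s))\<^sup>2)"
    proof (rule integral_le)
      fix s
      have "(norm (r s))\<^sup>2 = (norm (z' s + (1 / lam) *\<^sub>R z s))\<^sup>2" by (simp add: z'_def)
      also have "\<dots> = (norm (z' s))\<^sup>2 + (2 / lam) * (z' s \<bullet> z s) + (norm ((1 / lam) *\<^sub>R z s))\<^sup>2"
        unfolding power2_norm_eq_inner by (simp add: inner_add_left inner_add_right inner_commute)
      finally show "(norm (z' s))\<^sup>2 + (2 / lam) * (z' s \<bullet> z s) \<le> (norm (r s))\<^sup>2" by simp
    qed (intro integrable_add integrable_on_mult_right Li t)+
    also have "\<dots> \<le> integral {0..T} (\<lambda>s. (norm (r s))\<^sup>2)"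
      using t by (intro integral_subset_le Li L2_fun_sq_integrable_on r) auto
    also have "\<dots> \<le> B" by (rule B)
    finally have "integral {0..t} (\<lambda>s. (norm (z' s))\<^sup>2) + (2 / lam) * integral {0..t} (\<lambda>s. z' s \<bullet> z s) \<le> B"
      by (subst (asm) integral_unique[OF has_integral_add[OF integrable_integral[OF Li(2)[OF t]]
            has_integral_mult_right[OF integrable_integral[OF Li(1)[OF t]]]]])
    moreover have "(norm (z t))\<^sup>2 = 2 * integral {0..t} (\<lambda>s. z' s \<bullet> z s)"
      using L2_primitive_norm_sq[OF z', of t] t z0 by simp
    ultimately show ?thesis by simp
  qed
  show "(norm (z t))\<^sup>2 \<le> lam * B" if t: "t \<in> {0..T}" for t
  proof -
    have "0 \<le> integral {0..t} (\<lambda>s. (norm (z' s))\<^sup>2)" by (rule integral_nonneg[OF Li(2)[OF t]]) auto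
    then have "(1 / lam) * (norm (z t))\<^sup>2 \<le> B" using test[OF t] by linarith
    then show ?thesis using lam by (simp add: field_simps)
  qed
  have TT: "T \<in> {0..T}" using T by simp
  have z'B: "integral {0..T} (\<lambda>s. (norm (z' s))\<^sup>2) \<le> B"
    using test[OF TT] lam by (smt (verit) divide_nonneg_pos mult_nonneg_nonneg zero_le_power2)
  have "integral {0..T} (\<lambda>t. (norm ((1 / lam) *\<^sub>R z t))\<^sup>2)
      \<le> integral {0..T} (\<lambda>t. 2 * (norm (r t))\<^sup>2 + 2 * (norm (z' t))\<^sup>2)"
  proof (rule integral_le)
    show "(\<lambda>t. (norm ((1 / lam) *\<^sub>R z t))\<^sup>2) integrable_on {0..T}"
      by (intro L2_fun_sq_integrable_on L2_fun_scaleR Lz)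
    show "(norm ((1 / lam) *\<^sub>R z t))\<^sup>2 \<le> 2 * (norm (r t))\<^sup>2 + 2 * (norm (z' t))\<^sup>2" for t
      using norm_add_sq_le[of "r t" "- z' t"] unfolding norm_minus_cancel by (simp add: z'_def)
  qed (intro integrable_add integrable_on_mult_right Li TT)
  also have "\<dots> = 2 * integral {0..T} (\<lambda>t. (norm (r t))\<^sup>2) + 2 * integral {0..T} (\<lambda>t. (norm (z' t))\<^sup>2)"
    using Li[OF TT] by (simp add: integral_add integrable_on_mult_right)
  finally show "integral {0..T} (\<lambda>t. (norm ((1 / lam) *\<^sub>R z t))\<^sup>2) \<le> 4 * B" using B z'B by linarith
qed

lemma integral_norm_le_sqrt:
  fixes f :: "real \<Rightarrow> 'a::euclidean_space"
  assumes f: "L2_fun T f" and B: "integral {0..T} (\<lambda>t. (norm (f t))\<^sup>2) \<le> B"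
  shows "integral {0..T} (\<lambda>t. norm (f t)) \<le> sqrt (T * B)"
proof (rule real_le_rsqrt)
  have "(integral {0..T} (\<lambda>t. norm (f t)))\<^sup>2 \<le> (T - 0) * integral {0..T} (\<lambda>t. (norm (f t))\<^sup>2)"
    by (rule integral_norm_sq_le[OF f]) (use T in auto)
  also have "\<dots> \<le> T * B" using B T by simp
  finally show "(integral {0..T} (\<lambda>t. norm (f t)))\<^sup>2 \<le> T * B" .
qed

text \<open>The bounds that hold uniformly in \<open>q\<close> and \<open>lam\<close>.  At a single time the penalty force is only known
  to be of order \<open>1 / sqrt lam\<close>; it is its mean square that stays bounded.\<close>

definition uniform_bounds ::
    "real \<Rightarrow> real \<Rightarrow> real \<Rightarrow> real \<Rightarrow> (real \<Rightarrow> real ^ 'v) \<Rightarrow> (real \<Rightarrow> real ^ 'v) \<Rightarrow> bool" where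
  "uniform_bounds R B q lam a x \<longleftrightarrow>
      (\<forall>t\<in>{0..T}. norm (x t) \<le> R \<and> norm (D\<phi>q q (x t)) \<le> B \<and>
         (norm (H_proj C (x t) - a t))\<^sup>2 \<le> lam * B) \<and>
      integral {0..T} (\<lambda>t. (norm ((1 / lam) *\<^sub>R (H_proj C (x t) - a t)))\<^sup>2) \<le> B \<and>
      integral {0..T} (\<lambda>t. (norm (penalised_rate q lam a x t))\<^sup>2) \<le> B"

text \<open>The difference \<open>x - a\<close> is a good test function because the penalty term then has a sign, and
  because by convexity the gradient term is bounded below by \<open>- energy_q\<close> at the control.  This bounds \<open>x\<close>;
  the gradients are bounded along \<open>x\<close>, and everything but the penalty force becomes a given right hand
  side \<open>r\<close> in \<open>penalty_estimate\<close>.\<close>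

lemma state_q_estimates:
  obtains R B where "0 \<le> R" "0 \<le> B"
    "\<And>q lam a x. \<lbrakk>1 < q; 0 < lam; a \<in> adm_controls T C M; \<And>t. t \<in> {0..T} \<Longrightarrow> norm (a t) \<le> A;
        is_state_q T C E w p h \<xi> q lam a x\<rbrakk> \<Longrightarrow> uniform_bounds R B q lam a x"
proof -
  define \<xi>0 :: "real ^ 'v" where "\<xi>0 = (\<chi> i. if i \<in> C then 0 else \<xi> i)"
  define hn where "hn = integral {0..T} (\<lambda>t. norm (h t))"
  define h2 where "h2 = integral {0..T} (\<lambda>t. (norm (h t))\<^sup>2)"
  have hn0: "hn \<ge> 0" unfolding hn_def by (rule integral_nonneg[OF L2_fun_norm_integrable_on[OF h]]) auto
  have h20: "h2 \<ge> 0" unfolding h2_def by (rule integral_nonneg[OF L2_fun_sq_integrable_on[OF h]]) auto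
  obtain \<Phi>1 where \<Phi>1: "0 \<le> \<Phi>1" "\<And>q z. 1 < q \<Longrightarrow> norm z \<le> A \<Longrightarrow> \<phi>q q z \<le> \<Phi>1"
    by (rule energy_bounded_on_balls[of A]) blast
  define R where "R = \<bar>A\<bar> + (2 * (hn + sqrt (T * \<bar>M\<bar>)) + sqrt ((norm \<xi>0)\<^sup>2 + 2 * (\<Phi>1 * T)))"
  have R0: "0 \<le> R" unfolding R_def using hn0 T \<Phi>1 by (intro add_nonneg_nonneg mult_nonneg_nonneg) auto
  obtain \<Phi>2 where \<Phi>2: "0 \<le> \<Phi>2" "\<And>q z. 1 < q \<Longrightarrow> norm z \<le> R + 1 \<Longrightarrow> \<phi>q q z \<le> \<Phi>2"
    by (rule energy_bounded_on_balls[of "R + 1"]) blast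
  define Br where "Br = 2 * (2 * h2 + 2 * \<bar>M\<bar>) + 2 * (\<Phi>2\<^sup>2 * T)"
  have Br0: "0 \<le> Br" unfolding Br_def using h20 T by (intro add_nonneg_nonneg mult_nonneg_nonneg) auto
  define B where "B = \<Phi>2 + 2 * (2 * h2 + 2 * (\<Phi>2\<^sup>2 * T)) + 8 * Br"
  have B0: "0 \<le> B" "\<Phi>2 \<le> B" "Br \<le> B" "4 * Br \<le> B" "2 * (2 * h2 + 2 * (\<Phi>2\<^sup>2 * T)) + 8 * Br \<le> B"
    using \<Phi>2(1) h20 T Br0 by (auto simp: B_def)
  show ?thesis
  proof (rule that[OF R0 B0(1)])
    fix q lam a x
    assume q: "1 < q" and lam: "0 < lam" and adm: "a \<in> adm_controls T C M"
      and aA: "\<And>t. t \<in> {0..T} \<Longrightarrow> norm (a t) \<le> A" and st: "is_state_q T C E w p h \<xi> q lam a x"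
    define a' where "a' = wderiv T a"
    have pa: "L2_primitive T a' a" and a'M: "integral {0..T} (\<lambda>t. (norm (a' t))\<^sup>2) \<le> M"
      unfolding a'_def using adm_control_primitive[OF T adm] .
    note a'L = L2_primitive_fun[OF pa] and ca = L2_primitive_continuous[OF pa]
    have Ha: "H_proj C (a t) = a t" if "t \<in> {0..T}" for t
      by (rule H_proj_control[OF adm_control_controls[OF adm] that])
    have px: "L2_primitive T (penalised_rate q lam a x) x" and x0: "x 0 = init_state C \<xi> a"
      using st is_state_q_iff[OF q ca] by auto
    note cx = L2_primitive_continuous[OF px]
    define F where "F t = D\<phi>q q (x t)" for t
    have FL: "L2_fun T F" unfolding F_def[abs_def] by (intro L2_fun_continuous gradient_continuous_along q cx)
    have Hya: "H_proj C (x t - a t) = H_proj C (x t) - a t" if "t \<in> {0..T}" for t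
      using Ha[OF that] by (simp add: H_proj_diff)
    have T0: "0 \<in> {0..T}" using T by simp
    have y0: "x 0 - a 0 = \<xi>0"
      using adm_control_controls[OF adm] T0 unfolding x0 \<xi>0_def init_state_def controls_def
      by (auto simp: vec_eq_iff)
    have py: "L2_primitive T (\<lambda>t. penalised_rate q lam a x t - a' t) (\<lambda>t. x t - a t)"
      by (rule L2_primitive_diff[OF px pa])
    have xR: "norm (x t) \<le> R" if t: "t \<in> {0..T}" for t
    proof -
      have ik: "(\<lambda>t. norm (h t) + norm (a' t)) integrable_on {0..T}"
        by (intro integrable_add L2_fun_norm_integrable_on h a'L)
      have diss: "(penalised_rate q lam a x r - a' r) \<bullet> (x r - a r) \<le> (norm (h r) + norm (a' r)) * norm (x r - a r) + \<Phi>1"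
        if r: "r \<in> {0..T}" for r
      proof -
        have "D\<phi>q q (x r) \<bullet> (a r - x r) \<le> \<phi>q q (a r) - \<phi>q q (x r)"
          by (rule energy_q_gradient_inequality[OF q])
        also have "\<dots> \<le> \<Phi>1"
          using \<Phi>1(2)[OF q aA[OF r]] energy_nonneg[of "x r"] energy_le_energy_q[of q "x r"] q by simp
        finally have F1: "- (F r \<bullet> (x r - a r)) \<le> \<Phi>1" by (simp add: F_def inner_diff_right)
        have "0 \<le> (1 / lam) * (H_proj C (x r - a r) \<bullet> (x r - a r))"
          using lam by (simp add: H_proj_inner_self)
        then have F2: "0 \<le> ((1 / lam) *\<^sub>R (H_proj C (x r) - a r)) \<bullet> (x r - a r)"
          by (simp add: Hya[OF r])
        have "(h r - a' r) \<bullet> (x r - a r) \<le> norm (h r - a' r) * norm (x r - a r)" by (rule norm_cauchy_schwarz)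
        also have "\<dots> \<le> (norm (h r) + norm (a' r)) * norm (x r - a r)"
          by (intro mult_right_mono norm_triangle_ineq4) auto
        finally have F3: "(h r - a' r) \<bullet> (x r - a r) \<le> (norm (h r) + norm (a' r)) * norm (x r - a r)" .
        have "(penalised_rate q lam a x r - a' r) \<bullet> (x r - a r) = (h r - a' r) \<bullet> (x r - a r) - F r \<bullet> (x r - a r)
            - ((1 / lam) *\<^sub>R (H_proj C (x r) - a r)) \<bullet> (x r - a r)"
          unfolding penalised_rate_def F_def inner_diff_left by simp
        then show ?thesis using F1 F2 F3 by linarith
      qed
      have "norm (x t - a t) \<le> 2 * integral {0..T} (\<lambda>t. norm (h t) + norm (a' t))
          + sqrt ((norm (x 0 - a 0))\<^sup>2 + 2 * (\<Phi>1 * T))"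
        by (rule L2_primitive_energy_bound[OF py ik \<Phi>1(1) _ diss t]) auto
      moreover have "integral {0..T} (\<lambda>t. norm (h t) + norm (a' t)) = hn + integral {0..T} (\<lambda>t. norm (a' t))"
        unfolding hn_def by (intro integral_add L2_fun_norm_integrable_on h a'L)
      moreover have "integral {0..T} (\<lambda>t. norm (a' t)) \<le> sqrt (T * \<bar>M\<bar>)"
        by (rule integral_norm_le_sqrt[OF a'L]) (use a'M in linarith)
      moreover have "norm (x t) \<le> norm (x t - a t) + norm (a t)" by (metis norm_triangle_sub add.commute)
      ultimately show ?thesis using aA[OF t] abs_ge_self[of A] unfolding R_def y0 by argo
    qed
    have FB: "norm (F t) \<le> \<Phi>2" if t: "t \<in> {0..T}" for t
      unfolding F_def using xR[OF t] by (intro norm_gradient_le[OF q _ \<Phi>2(1)] \<Phi>2(2)[OF q]) simp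
    define z where "z t = H_proj C (x t - a t)" for t
    define r where "r t = H_proj C (h t - a' t - F t)" for t
    have rL: "L2_fun T r" unfolding r_def[abs_def]
      by (intro L2_fun_linear[OF _ bounded_linear_H_proj] L2_fun_diff h a'L FL)
    have pz: "L2_primitive T (\<lambda>t. r t - (1 / lam) *\<^sub>R z t) z"
    proof (rule L2_primitive_AE_cong)
      show "L2_primitive T (\<lambda>t. H_proj C (penalised_rate q lam a x t - a' t)) z"
        unfolding z_def[abs_def] by (rule L2_primitive_linear[OF py bounded_linear_H_proj])
      show "L2_fun T (\<lambda>t. r t - (1 / lam) *\<^sub>R z t)"
        unfolding z_def[abs_def]
        by (intro L2_fun_diff rL L2_fun_scaleR L2_fun_continuous H_proj_continuous_along L2_primitive_continuous[OF py])
      show "AE t in lebesgue_on {0..T}. H_proj C (penalised_rate q lam a x t - a' t) = r t - (1 / lam) *\<^sub>R z t"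
        unfolding r_def z_def penalised_rate_def F_def H_proj_diff H_proj_scaleR H_proj_idem
        by (rule AE_I2) (simp add: Ha)
    qed
    have F2: "integral {0..T} (\<lambda>t. (norm (F t))\<^sup>2) \<le> \<Phi>2\<^sup>2 * T"
    proof -
      have "integral {0..T} (\<lambda>t. (norm (F t))\<^sup>2) \<le> integral {0..T} (\<lambda>t. \<Phi>2\<^sup>2)"
        using FB by (intro integral_le L2_fun_sq_integrable_on FL power_mono) auto
      then show ?thesis using T by (simp add: mult.commute)
    qed
    have sq3: "(norm (b - c - d))\<^sup>2 \<le> 2 * (2 * (norm b)\<^sup>2 + 2 * (norm c)\<^sup>2) + 2 * (norm d)\<^sup>2" for b c d :: "real ^ 'v"
      using norm_add_sq_le[of "b - c" "- d"] norm_add_sq_le[of b "- c"] by simp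
    have int3: "integral {0..T} (\<lambda>t. (norm (f t))\<^sup>2) \<le> 2 * (2 * integral {0..T} (\<lambda>t. (norm (b t))\<^sup>2)
        + 2 * integral {0..T} (\<lambda>t. (norm (c t))\<^sup>2)) + 2 * integral {0..T} (\<lambda>t. (norm (d t))\<^sup>2)"
      if L: "L2_fun T f" "L2_fun T b" "L2_fun T c" "L2_fun T d"
        and le: "\<And>t. t \<in> {0..T} \<Longrightarrow> norm (f t) \<le> norm (b t - c t - d t)" for f b c d :: "real \<Rightarrow> real ^ 'v"
    proof -
      have "integral {0..T} (\<lambda>t. (norm (f t))\<^sup>2)
        \<le> integral {0..T} (\<lambda>t. 2 * (2 * (norm (b t))\<^sup>2 + 2 * (norm (c t))\<^sup>2) + 2 * (norm (d t))\<^sup>2)"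
      proof (rule integral_le)
        show "(norm (f t))\<^sup>2 \<le> 2 * (2 * (norm (b t))\<^sup>2 + 2 * (norm (c t))\<^sup>2) + 2 * (norm (d t))\<^sup>2" if "t \<in> {0..T}" for t
          by (rule order_trans[OF power_mono[OF le[OF that]] sq3]) simp
      qed (intro integrable_add integrable_on_mult_right L2_fun_sq_integrable_on L)+
      also have "\<dots> = 2 * (2 * integral {0..T} (\<lambda>t. (norm (b t))\<^sup>2)
        + 2 * integral {0..T} (\<lambda>t. (norm (c t))\<^sup>2)) + 2 * integral {0..T} (\<lambda>t. (norm (d t))\<^sup>2)"
        by (intro integral_unique has_integral_add has_integral_mult_right integrable_integral
            L2_fun_sq_integrable_on L)
      finally show ?thesis .
    qed
    have rB: "integral {0..T} (\<lambda>t. (norm (r t))\<^sup>2) \<le> Br"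
      using int3[OF rL h a'L FL] a'M F2 norm_H_proj_le unfolding r_def Br_def h2_def by force
    have z0: "z 0 = 0" unfolding z_def y0 by (simp add: \<xi>0_def vec_eq_iff H_proj_nth)
    note pen = penalty_estimate[OF lam pz rL z0 rB]
    have zeq: "z t = H_proj C (x t) - a t" if "t \<in> {0..T}" for t using Hya[OF that] by (simp add: z_def)
    have zi: "integral {0..T} (\<lambda>t. (norm ((1 / lam) *\<^sub>R (H_proj C (x t) - a t)))\<^sup>2)
        = integral {0..T} (\<lambda>t. (norm ((1 / lam) *\<^sub>R z t))\<^sup>2)"
      by (rule integral_cong) (simp add: zeq)
    have zL: "L2_fun T (\<lambda>t. (1 / lam) *\<^sub>R z t)"
      by (intro L2_fun_scaleR L2_fun_continuous L2_primitive_continuous[OF pz])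
    have rateB: "integral {0..T} (\<lambda>t. (norm (penalised_rate q lam a x t))\<^sup>2) \<le> B"
    proof -
      have "integral {0..T} (\<lambda>t. (norm (penalised_rate q lam a x t))\<^sup>2)
        \<le> 2 * (2 * h2 + 2 * integral {0..T} (\<lambda>t. (norm (F t))\<^sup>2))
          + 2 * integral {0..T} (\<lambda>t. (norm ((1 / lam) *\<^sub>R z t))\<^sup>2)"
        unfolding h2_def
        by (rule int3[OF L2_primitive_fun[OF px] h FL zL]) (simp add: penalised_rate_def F_def zeq)
      then show ?thesis using F2 pen(2) B0(5) by argo
    qed
    show "uniform_bounds R B q lam a x"
      unfolding uniform_bounds_def
    proof (intro conjI ballI)
      fix t assume t: "t \<in> {0..T}"
      show "norm (x t) \<le> R" by (rule xR[OF t])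
      show "norm (D\<phi>q q (x t)) \<le> B" using FB[OF t] B0(2) by (simp add: F_def)
      have "lam * Br \<le> lam * B" using lam B0(3) by simp
      then show "(norm (H_proj C (x t) - a t))\<^sup>2 \<le> lam * B" using pen(1)[OF t] zeq[OF t] by simp
    qed (use zi pen(2) B0(4) rateB in argo)+
  qed
qed

end


section \<open>The constrained flow as a limit of penalised flows\<close>

lemma L2_primitive_Pair:
  fixes u :: "real \<Rightarrow> 'a::euclidean_space" and v :: "real \<Rightarrow> 'b::euclidean_space"
  assumes "L2_primitive T f u" "L2_primitive T g v"
  shows "L2_primitive T (\<lambda>t. (f t, g t)) (\<lambda>t. (u t, v t))"
proof -
  have "L2_primitive T (\<lambda>t. (f t, 0::'b) + (0::'a, g t)) (\<lambda>t. (u t, 0::'b) + (0::'a, v t))"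
    by (intro L2_primitive_add L2_primitive_linear[OF assms(1)] L2_primitive_linear[OF assms(2)]
        bounded_linear_Pair bounded_linear_ident bounded_linear_zero)
  then show ?thesis by simp
qed

lemma edge_constant_tendsto:
  assumes "filterlim qs at_top sequentially" and N: "0 < (N::real)"
  shows "(\<lambda>k. N powr (p / qs k)) \<longlonglongrightarrow> 1"
proof -
  have "(\<lambda>k. p / qs k) \<longlonglongrightarrow> 0"
    by (rule real_tendsto_divide_at_top[OF tendsto_const assms(1)])
  then have "(\<lambda>k. N powr (p / qs k)) \<longlonglongrightarrow> N powr 0"
    using N by (intro tendsto_powr tendsto_const) auto
  then show ?thesis using N by simp
qed

context hypergraph_flow
begin

text \<open>The energies are squeezed between each other up to a factor that tends to one.\<close>

lemma energy_q_tendsto: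
  assumes qs: "filterlim qs at_top sequentially" "\<And>k. 1 < qs k" and y: "y \<longlonglongrightarrow> y0"
  shows "(\<lambda>k. \<phi>q (qs k) (y k)) \<longlonglongrightarrow> \<phi> y0"
proof (rule real_tendsto_sandwich)
  have q0: "0 < qs k" for k using qs(2)[of k] by simp
  have ylim: "(\<lambda>k. \<phi> (y k)) \<longlonglongrightarrow> \<phi> y0"
    by (rule continuous_on_tendsto_compose[OF energy_continuous[of UNIV] y]) auto
  show "(\<lambda>k. \<phi> (y k)) \<longlonglongrightarrow> \<phi> y0" by (rule ylim)
  have "(\<lambda>k. ((real CARD('v))\<^sup>2) powr (p / qs k) * \<phi> (y k)) \<longlonglongrightarrow> 1 * \<phi> y0"
    by (intro tendsto_mult ylim edge_constant_tendsto qs(1)) auto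
  then show "(\<lambda>k. ((real CARD('v))\<^sup>2) powr (p / qs k) * \<phi> (y k)) \<longlonglongrightarrow> \<phi> y0"
    by simp
  show "\<forall>\<^sub>F k in sequentially. \<phi> (y k) \<le> \<phi>q (qs k) (y k)"
    by (intro always_eventually allI energy_le_energy_q q0)
  show "\<forall>\<^sub>F k in sequentially. \<phi>q (qs k) (y k) \<le> ((real CARD('v))\<^sup>2) powr (p / qs k) * \<phi> (y k)"
    by (intro always_eventually allI energy_q_le_energy q0)
qed

lemma subdiff_energy_iff:
  "\<eta> \<in> subdiff (\<lambda>z. ereal (\<phi> z)) x \<longleftrightarrow> (\<forall>v. \<eta> \<bullet> v \<le> \<phi> (x + v) - \<phi> x)"
proof
  assume "\<eta> \<in> subdiff (\<lambda>z. ereal (\<phi> z)) x"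
  then have "\<And>z. \<eta> \<bullet> (z - x) \<le> \<phi> z - \<phi> x" by (simp add: subdiff_def)
  from this[of "x + _"] show "\<forall>v. \<eta> \<bullet> v \<le> \<phi> (x + v) - \<phi> x" by simp
next
  assume R: "\<forall>v. \<eta> \<bullet> v \<le> \<phi> (x + v) - \<phi> x"
  have "\<eta> \<bullet> (z - x) \<le> \<phi> z - \<phi> x" for z using R[rule_format, of "z - x"] by simp
  then show "\<eta> \<in> subdiff (\<lambda>z. ereal (\<phi> z)) x" by (simp add: subdiff_def)
qed

text \<open>The normal cone of an affine space is the orthogonal complement of its directions, which for
  \<open>K_set C a t\<close> is the range of \<open>H_proj C\<close>.\<close>

lemma subdiff_ind_fun_K_set_iff:
  assumes x: "x \<in> K_set C a t"
  shows "\<zeta> \<in> subdiff (ind_fun (K_set C a t)) x \<longleftrightarrow> H_proj C \<zeta> = \<zeta>"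
proof
  assume Z: "\<zeta> \<in> subdiff (ind_fun (K_set C a t)) x"
  define d where "d = \<zeta> - H_proj C \<zeta>"
  have "x + d \<in> K_set C a t" using x by (auto simp: K_set_def d_def H_proj_nth)
  then have "\<zeta> \<bullet> d \<le> 0" using Z x unfolding subdiff_def
    by (auto simp: ind_fun_def zero_ereal_def dest!: spec[of _ "x + d"])
  moreover have "\<zeta> \<bullet> d = d \<bullet> d"
    unfolding d_def inner_diff_left inner_diff_right
    using inner_H_proj[of C \<zeta> \<zeta>] by (simp add: inner_commute)
  ultimately have "d \<bullet> d \<le> 0" by simp
  then have "d = 0" using inner_ge_zero[of d] inner_eq_zero_iff[of d] by linarith
  then show "H_proj C \<zeta> = \<zeta>" by (simp add: d_def)
next
  assume Z: "H_proj C \<zeta> = \<zeta>"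
  have "\<zeta> \<bullet> (z - x) = 0" if "z \<in> K_set C a t" for z
  proof -
    have "H_proj C (z - x) = 0" using that x by (auto simp: K_set_def vec_eq_iff H_proj_nth)
    then show ?thesis using inner_H_proj[of C \<zeta> "z - x"] Z by simp
  qed
  then show "\<zeta> \<in> subdiff (ind_fun (K_set C a t)) x"
    using x by (auto simp: subdiff_def ind_fun_def zero_ereal_def)
qed

lemma K_set_iff_H_proj:
  assumes "H_proj C (a t) = a t" shows "x \<in> K_set C a t \<longleftrightarrow> H_proj C x = a t"
proof -
  have "H_proj C x = a t \<longleftrightarrow> H_proj C x = H_proj C (a t)" using assms by simp
  also have "\<dots> \<longleftrightarrow> x \<in> K_set C a t" by (auto simp: K_set_def vec_eq_iff H_proj_nth split: if_splits)
  finally show ?thesis by simp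
qed

text \<open>A limit of gradients in the sense of integrals over intervals is a subgradient: the subgradient
  inequality with a fixed increment \<open>d\<close>, integrated over an interval, passes to the limit on both
  sides.  It then holds almost everywhere, simultaneously for a countable dense set of \<open>d\<close>.\<close>

lemma subgradient_limit:
  assumes qs: "filterlim qs at_top sequentially" "\<And>k. 1 < qs k"
    and cy: "\<And>k. continuous_on {0..T} (y k)" and R: "\<And>k t. t \<in> {0..T} \<Longrightarrow> norm (y k t) \<le> R"
    and P: "\<And>k. L2_primitive T (\<lambda>t. D\<phi>q (qs k) (y k t)) (P k)"
    and cX: "continuous_on {0..T} X" and ylim: "\<And>t. t \<in> {0..T} \<Longrightarrow> (\<lambda>k. y k t) \<longlonglongrightarrow> X t"
    and pQ: "L2_primitive T \<eta> Q" and Plim: "\<And>t. t \<in> {0..T} \<Longrightarrow> (\<lambda>k. P k t) \<longlonglongrightarrow> Q t"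
  shows "AE t in lebesgue_on {0..T}. \<eta> t \<in> subdiff (\<lambda>z. ereal (\<phi> z)) (X t)"
proof -
  define F where "F k t = D\<phi>q (qs k) (y k t)" for k t
  have pP: "L2_primitive T (F k) (P k)" for k using P[of k] by (simp add: F_def[abs_def])
  have dir: "AE t in lebesgue_on {0..T}. 0 \<le> \<phi> (X t + d) - \<phi> (X t) - \<eta> t \<bullet> d" for d
  proof -
    have cE: "continuous_on {0..T} (\<lambda>t. \<phi> (X t + d) - \<phi> (X t))"
      by (intro continuous_on_diff continuous_on_compose2[OF energy_continuous[of UNIV]]
          continuous_on_add continuous_on_const cX) auto
    have i\<eta>: "(\<lambda>t. \<eta> t \<bullet> d) integrable_on {0..T}"
      using L2_fun_inner_integrable[OF L2_primitive_fun[OF pQ] L2_fun_continuous[OF continuous_on_const]]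
      by (simp add: absolutely_integrable_on_def)
    show ?thesis
    proof (rule AE_nonneg_if_integrals_nonneg)
      show "(\<lambda>t. \<phi> (X t + d) - \<phi> (X t) - \<eta> t \<bullet> d) integrable_on {0..T}"
        by (intro integrable_diff[OF integrable_continuous_real[OF cE] i\<eta>])
      fix s t assume st: "0 \<le> s" "s \<le> t" "t \<le> T"
      have sT: "{s..t} \<subseteq> {0..T}" "s \<in> {0..T}" "t \<in> {0..T}" using st by auto
      obtain \<Phi> where \<Phi>: "0 \<le> \<Phi>" "\<And>q z. 1 < q \<Longrightarrow> norm z \<le> R + norm d \<Longrightarrow> \<phi>q q z \<le> \<Phi>"
        by (rule energy_bounded_on_balls[of "R + norm d"]) blast
      define e where "e k t = \<phi>q (qs k) (y k t + d) - \<phi>q (qs k) (y k t)" for k t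
      have cq: "continuous_on UNIV (\<phi>q q)" if "1 < q" for q
        by (intro continuous_at_imp_continuous_on ballI differentiable_imp_continuous_within
            energy_q_differentiable[OF that])
      have ie: "e k integrable_on {s..t}" for k
        unfolding e_def[abs_def]
        by (intro integrable_continuous_real continuous_on_diff continuous_on_compose2[OF cq[OF qs(2)]]
            continuous_on_add continuous_on_const continuous_on_subset[OF cy sT(1)]) auto
      have elim: "(\<lambda>k. integral {s..t} (e k)) \<longlonglongrightarrow> integral {s..t} (\<lambda>t. \<phi> (X t + d) - \<phi> (X t))"
      proof (rule dominated_convergence[OF ie])
        show "(\<lambda>q. 2 * \<Phi>) integrable_on {s..t}" by auto
        fix q assume q: "q \<in> {s..t}"
        then have qT: "q \<in> {0..T}" using sT(1) by blast
        show "(\<lambda>k. e k q) \<longlonglongrightarrow> \<phi> (X q + d) - \<phi> (X q)"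
          unfolding e_def by (intro tendsto_diff energy_q_tendsto qs tendsto_add tendsto_const ylim[OF qT])
        fix k
        have xR: "norm (y k q) \<le> R" by (rule R[OF qT])
        have nn: "0 \<le> \<phi>q (qs k) z" for z
          using energy_nonneg[of z] energy_le_energy_q[of "qs k" z] qs(2)[of k] by linarith
        have "\<phi>q (qs k) (y k q + d) \<le> \<Phi>"
          using norm_triangle_ineq[of "y k q" d] xR by (intro \<Phi>(2)[OF qs(2)]) linarith
        moreover have "\<phi>q (qs k) (y k q) \<le> \<Phi>"
          using xR norm_ge_zero[of d] by (intro \<Phi>(2)[OF qs(2)]) linarith
        ultimately show "norm (e k q) \<le> 2 * \<Phi>"
          unfolding e_def real_norm_def using nn[of "y k q + d"] nn[of "y k q"] \<Phi>(1) by linarith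
      qed
      have le: "(P k t - P k s) \<bullet> d \<le> integral {s..t} (e k)" for k
      proof -
        have iF: "F k integrable_on {s..t}"
          by (rule integrable_on_subsegment[OF L2_fun_integrable_on[OF L2_primitive_fun[OF pP]] st(1,3)])
        have "(P k t - P k s) \<bullet> d = integral {s..t} (\<lambda>q. F k q \<bullet> d)"
          unfolding L2_primitive_increment[OF pP st]
          using integral_linear[OF iF bounded_linear_inner_left, of d] by (simp add: o_def)
        also have "\<dots> \<le> integral {s..t} (e k)"
        proof (rule integral_le[OF _ ie])
          show "(\<lambda>q. F k q \<bullet> d) integrable_on {s..t}"
            using integrable_linear[OF iF bounded_linear_inner_left, of d] by (simp add: o_def)
          show "F k q \<bullet> d \<le> e k q" for q
            using energy_q_gradient_inequality[OF qs(2), of k "y k q" "y k q + d"]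
            by (simp add: F_def e_def)
        qed
        finally show ?thesis .
      qed
      have "(\<lambda>k. (P k t - P k s) \<bullet> d) \<longlonglongrightarrow> (Q t - Q s) \<bullet> d"
        by (intro tendsto_inner tendsto_diff tendsto_const Plim sT)
      from LIMSEQ_le[OF this elim] le
      have "(Q t - Q s) \<bullet> d \<le> integral {s..t} (\<lambda>t. \<phi> (X t + d) - \<phi> (X t))" by blast
      moreover have "(Q t - Q s) \<bullet> d = integral {s..t} (\<lambda>q. \<eta> q \<bullet> d)"
        unfolding L2_primitive_increment[OF pQ st]
        using integral_linear[OF integrable_on_subsegment[OF L2_fun_integrable_on[OF L2_primitive_fun[OF pQ]] st(1,3)]
            bounded_linear_inner_left, of d] by (simp add: o_def)
      moreover have "integral {s..t} (\<lambda>t. \<phi> (X t + d) - \<phi> (X t) - \<eta> t \<bullet> d)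
          = integral {s..t} (\<lambda>t. \<phi> (X t + d) - \<phi> (X t)) - integral {s..t} (\<lambda>t. \<eta> t \<bullet> d)"
        by (rule integral_diff[OF integrable_on_subsegment[OF integrable_continuous_real[OF cE] st(1,3)]
              integrable_on_subsegment[OF i\<eta> st(1,3)]])
      ultimately show "0 \<le> integral {s..t} (\<lambda>t. \<phi> (X t + d) - \<phi> (X t) - \<eta> t \<bullet> d)"
        by simp
    qed
  qed
  obtain D :: "(real ^ 'v) set" where D: "countable D" "\<And>S. open S \<Longrightarrow> S \<noteq> {} \<Longrightarrow> \<exists>d\<in>D. d \<in> S"
    by (rule countable_dense_setE) blast
  have "AE t in lebesgue_on {0..T}. \<forall>d\<in>D. 0 \<le> \<phi> (X t + d) - \<phi> (X t) - \<eta> t \<bullet> d"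
    using dir by (subst AE_ball_countable[OF D(1)]) blast
  then show "AE t in lebesgue_on {0..T}. \<eta> t \<in> subdiff (\<lambda>z. ereal (\<phi> z)) (X t)"
  proof eventually_elim
    case (elim t)
    define S where "S = {d. \<phi> (X t + d) - \<phi> (X t) - \<eta> t \<bullet> d < 0}"
    have "open S" unfolding S_def
      by (intro open_Collect_less continuous_on_diff continuous_on_compose2[OF energy_continuous[of UNIV]]
          continuous_intros) auto
    moreover have "\<not> (\<exists>d\<in>D. d \<in> S)" using elim unfolding S_def by (auto simp: not_less)
    ultimately have "S = {}" using D(2) by blast
    then have "\<not> (\<phi> (X t + d) - \<phi> (X t) - \<eta> t \<bullet> d < 0)" for d unfolding S_def by blast
    then show ?case unfolding subdiff_energy_iff by (simp add: not_less)
  qed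
qed

text \<open>For a fixed control, the penalised flows and the integrals \<open>P k\<close> of their gradients lie in a
  compact set.  The limit of the gradients is a subgradient.  The penalty only acts on the components
  in \<open>C\<close>, so the remaining ones satisfy the limit equation, and whatever is missing in the components
  in \<open>C\<close> is a normal vector of the constraint.\<close>

lemma state_exists:
  assumes adm: "a \<in> adm_controls T C M"
  shows "\<exists>x. is_state T C E w p h \<xi> a x"
proof -
  have ca: "continuous_on {0..T} a" by (rule control_continuous[OF adm_control_controls[OF adm]])
  have Ha: "H_proj C (a t) = a t" if "t \<in> {0..T}" for t
    by (rule H_proj_control[OF adm_control_controls[OF adm] that])
  have "bounded (a ` {0..T})" by (intro compact_imp_bounded compact_continuous_image ca compact_Icc)
  then obtain A where A: "\<And>t. t \<in> {0..T} \<Longrightarrow> norm (a t) \<le> A" unfolding bounded_iff by blast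
  \<comment> \<open>Any sequences with \<open>qs\<close> tending to infinity and \<open>ls\<close> to zero would do.\<close>
  define qs ls where "qs k = real k + 2" and "ls k = inverse (real (Suc k))" for k :: nat
  have qs1: "1 < qs k" and ls0: "0 < ls k" for k by (simp_all add: qs_def ls_def)
  have qsinf: "filterlim qs at_top sequentially"
    unfolding qs_def[abs_def]
    by (rule filterlim_at_top_mono[OF filterlim_real_sequentially]) auto
  have ls_lim: "ls \<longlonglongrightarrow> 0" unfolding ls_def[abs_def] by (rule LIMSEQ_inverse_real_of_nat)
  have "\<forall>k. \<exists>x. is_state_q T C E w p h \<xi> (qs k) (ls k) a x"
    using state_q_exists[OF qs1 ls0 ca] by blast
  then obtain x where x: "\<And>k. is_state_q T C E w p h \<xi> (qs k) (ls k) a (x k)" by metis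
  obtain R B where R0: "0 \<le> R" "0 \<le> B" and est0: "\<And>q lam a x. \<lbrakk>1 < q; 0 < lam; a \<in> adm_controls T C M;
        \<And>t. t \<in> {0..T} \<Longrightarrow> norm (a t) \<le> A; is_state_q T C E w p h \<xi> q lam a x\<rbrakk> \<Longrightarrow> uniform_bounds R B q lam a x"
    by (rule state_q_estimates[of M A]) blast
  note est = est0[OF qs1 ls0 adm A x, unfolded uniform_bounds_def]
  have px: "L2_primitive T (penalised_rate (qs k) (ls k) a (x k)) (x k)" and x0: "x k 0 = init_state C \<xi> a" for k
    using x[of k] is_state_q_iff[OF qs1 ca] by auto
  note cx = L2_primitive_continuous[OF px]
  define F where "F k t = D\<phi>q (qs k) (x k t)" for k t
  have FL: "L2_fun T (F k)" for k
    unfolding F_def[abs_def] by (intro L2_fun_continuous gradient_continuous_along qs1 cx)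
  define P where "P k t = 0 + integral {0..t} (F k)" for k t
  have pP: "L2_primitive T (F k) (P k)" for k unfolding P_def[abs_def] by (rule L2_primitive_integral[OF FL])
  define M' where "M' = B + B\<^sup>2 * T"
  have UM: "integral {0..T} (\<lambda>t. (norm (penalised_rate (qs k) (ls k) a (x k) t, F k t))\<^sup>2) \<le> M'" for k
  proof -
    have "integral {0..T} (\<lambda>t. (norm (F k t))\<^sup>2) \<le> integral {0..T} (\<lambda>t. B\<^sup>2)"
      using est by (intro integral_le L2_fun_sq_integrable_on FL power_mono) (auto simp: F_def)
    moreover have "integral {0..T} (\<lambda>t. (norm (penalised_rate (qs k) (ls k) a (x k) t, F k t))\<^sup>2)
       = integral {0..T} (\<lambda>t. (norm (penalised_rate (qs k) (ls k) a (x k) t))\<^sup>2) + integral {0..T} (\<lambda>t. (norm (F k t))\<^sup>2)"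
      by (simp add: norm_Pair integral_add L2_fun_sq_integrable_on L2_primitive_fun[OF px] FL)
    moreover have "integral {0..T} (\<lambda>t. (norm (penalised_rate (qs k) (ls k) a (x k) t))\<^sup>2) \<le> B" using est by blast
    moreover have "integral {0..T} (\<lambda>t. B\<^sup>2) = B\<^sup>2 * T" using T by (simp add: mult.commute)
    ultimately show ?thesis unfolding M'_def by argo
  qed
  have U0: "norm (x k 0, P k 0) \<le> norm (init_state C \<xi> a)" for k by (simp add: x0 P_def norm_Pair)
  obtain r u g' where sub: "strict_mono (r :: nat \<Rightarrow> nat)"
      and ulim: "uniform_limit {0..T} (\<lambda>k t. (x (r k) t, P (r k) t)) u sequentially"
      and pu: "L2_primitive T g' u"
    by (rule L2_primitive_compactness[where U = "\<lambda>k t. (x k t, P k t)", OF T L2_primitive_Pair[OF px pP] UM U0]) (rule that)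
  define X Q v \<eta> where "X t = fst (u t)" and "Q t = snd (u t)" and "v t = fst (g' t)" and "\<eta> t = snd (g' t)" for t
  have pX: "L2_primitive T v X" unfolding X_def[abs_def] v_def[abs_def]
    by (rule L2_primitive_linear[OF pu bounded_linear_fst])
  have pQ: "L2_primitive T \<eta> Q" unfolding Q_def[abs_def] \<eta>_def[abs_def]
    by (rule L2_primitive_linear[OF pu bounded_linear_snd])
  note cX = L2_primitive_continuous[OF pX]
  have Xlim: "(\<lambda>k. x (r k) t) \<longlonglongrightarrow> X t" and Qlim: "(\<lambda>k. P (r k) t) \<longlonglongrightarrow> Q t" if t: "t \<in> {0..T}" for t
    using tendsto_fst[OF tendsto_uniform_limitI[OF ulim t]] tendsto_snd[OF tendsto_uniform_limitI[OF ulim t]]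
    by (simp_all add: X_def Q_def)
  have T0: "0 \<in> {0..T}" using T by simp
  have X0: "X 0 = init_state C \<xi> a" using Xlim[OF T0] by (simp add: x0 LIMSEQ_const_iff)
  have lsr: "(\<lambda>k. ls (r k)) \<longlonglongrightarrow> 0" using LIMSEQ_subseq_LIMSEQ[OF ls_lim sub] by (simp add: o_def)
  have qsr: "filterlim (\<lambda>k. qs (r k)) at_top sequentially"
    using filterlim_compose[OF qsinf filterlim_subseq[OF sub]] .
  have HX: "H_proj C (X t) = a t" if t: "t \<in> {0..T}" for t
  proof -
    have "(\<lambda>k. H_proj C (x (r k) t) - a t) \<longlonglongrightarrow> 0"
    proof (rule Lim_null_comparison)
      have "norm (H_proj C (x (r k) t) - a t) \<le> sqrt (ls (r k) * B)" for k
        using est t by (intro real_le_rsqrt) blast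
      then show "\<forall>\<^sub>F k in sequentially. norm (H_proj C (x (r k) t) - a t) \<le> sqrt (ls (r k) * B)"
        by (rule always_eventually[OF allI])
      have "(\<lambda>k. sqrt (ls (r k) * B)) \<longlonglongrightarrow> sqrt (0 * B)" by (intro tendsto_intros lsr)
      then show "(\<lambda>k. sqrt (ls (r k) * B)) \<longlonglongrightarrow> 0" by simp
    qed
    moreover have "(\<lambda>k. H_proj C (x (r k) t) - a t) \<longlonglongrightarrow> H_proj C (X t) - a t"
      by (intro tendsto_diff tendsto_const bounded_linear.tendsto[OF bounded_linear_H_proj Xlim[OF t]])
    ultimately have "H_proj C (X t) - a t = 0" using LIMSEQ_unique by blast
    then show ?thesis by simp
  qed
  have XK: "X t \<in> K_set C a t" if "t \<in> {0..T}" for t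
    using K_set_iff_H_proj[where a = a, OF Ha[OF that]] HX[OF that] by blast
  \<comment> \<open>The projection onto the uncontrolled vertices removes the penalty term from the equation.\<close>
  define Ac where "Ac z = z - H_proj C z" for z :: "real ^ 'v"
  have blAc: "bounded_linear Ac" unfolding Ac_def[abs_def]
    by (intro bounded_linear_sub bounded_linear_ident bounded_linear_H_proj)
  have AhL: "L2_fun T (\<lambda>t. Ac (h t))" by (rule L2_fun_linear[OF h blAc])
  have pAk: "L2_primitive T (\<lambda>t. Ac (h t)) (\<lambda>t. Ac (x k t + P k t))" for k
  proof (rule L2_primitive_AE_cong[OF L2_primitive_linear[OF L2_primitive_add[OF px pP] blAc] AhL])
    show "AE t in lebesgue_on {0..T}. Ac (penalised_rate (qs k) (ls k) a (x k) t + F k t) = Ac (h t)"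
    proof (rule AE_I2)
      fix t assume "t \<in> space (lebesgue_on {0..T})"
      then have t: "t \<in> {0..T}" by simp
      have "penalised_rate (qs k) (ls k) a (x k) t + F k t = h t - (1 / ls k) *\<^sub>R H_proj C (x k t - a t)"
        by (simp add: penalised_rate_def F_def H_proj_diff Ha[OF t])
      then show "Ac (penalised_rate (qs k) (ls k) a (x k) t + F k t) = Ac (h t)"
        by (simp add: Ac_def H_proj_diff H_proj_scaleR H_proj_idem)
    qed
  qed
  have pA: "L2_primitive T (\<lambda>t. Ac (h t)) (\<lambda>t. Ac (X t + Q t))"
  proof (rule L2_primitiveI[OF AhL])
    fix t assume t: "t \<in> {0..T}"
    have lim: "(\<lambda>k. Ac (x (r k) s + P (r k) s)) \<longlonglongrightarrow> Ac (X s + Q s)" if "s \<in> {0..T}" for s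
      by (intro bounded_linear.tendsto[OF blAc] tendsto_add Xlim Qlim that)
    have "(\<lambda>k. Ac (x (r k) 0 + P (r k) 0) + integral {0..t} (\<lambda>t. Ac (h t)))
        \<longlonglongrightarrow> Ac (X 0 + Q 0) + integral {0..t} (\<lambda>t. Ac (h t))"
      by (intro tendsto_add tendsto_const lim[OF T0])
    then have "(\<lambda>k. Ac (x (r k) t + P (r k) t)) \<longlonglongrightarrow> Ac (X 0 + Q 0) + integral {0..t} (\<lambda>t. Ac (h t))"
      unfolding L2_primitive_eq[OF pAk t, symmetric] .
    then show "Ac (X t + Q t) = Ac (X 0 + Q 0) + integral {0..t} (\<lambda>t. Ac (h t))"
      using LIMSEQ_unique[OF lim[OF t]] by blast
  qed
  have ae1: "AE t in lebesgue_on {0..T}. Ac (v t + \<eta> t) = Ac (h t)"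
    by (rule L2_primitive_unique_AE[OF L2_primitive_linear[OF L2_primitive_add[OF pX pQ] blAc] pA])
  have ae2: "AE t in lebesgue_on {0..T}. \<eta> t \<in> subdiff (\<lambda>z. ereal (\<phi> z)) (X t)"
  proof (rule subgradient_limit[OF qsr qs1 cx _ _ cX Xlim pQ Qlim])
    show "norm (x (r k) t) \<le> R" if "t \<in> {0..T}" for k t using est that by blast
    show "L2_primitive T (\<lambda>t. D\<phi>q (qs (r k)) (x (r k) t)) (P (r k))" for k
      using pP[of "r k"] by (simp add: F_def[abs_def])
  qed
  have WX: "W12 T X" by (rule L2_primitive_imp_W12[OF T pX])
  have ae3: "AE t in lebesgue_on {0..T}. wderiv T X t = v t"
    by (rule L2_primitive_unique_AE[OF W12_imp_L2_primitive[OF T WX] pX])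
  have ae4: "AE t in lebesgue_on {0..T}. t \<in> {0..T}" by (rule AE_I2) simp
  have "AE t in lebesgue_on {0..T}.
        \<exists>\<eta>\<in>subdiff (\<lambda>z. ereal (\<phi> z)) (X t). \<exists>\<zeta>\<in>subdiff (ind_fun (K_set C a t)) (X t).
          wderiv T X t + \<eta> + \<zeta> = h t"
    using ae1 ae2 ae3 ae4
  proof eventually_elim
    case (elim t)
    have "H_proj C (h t - v t - \<eta> t) = h t - v t - \<eta> t"
      using elim(1) by (simp add: Ac_def H_proj_diff H_proj_add algebra_simps)
    then have "h t - v t - \<eta> t \<in> subdiff (ind_fun (K_set C a t)) (X t)"
      using subdiff_ind_fun_K_set_iff[OF XK[OF elim(4)]] by blast
    then show ?case using elim(2,3) by (intro bexI[of _ "\<eta> t"] bexI[of _ "h t - v t - \<eta> t"]) auto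
  qed
  then have "is_state T C E w p h \<xi> a X"
    unfolding is_state_def using WX X0 XK by blast
  then show ?thesis by blast
qed

end


section \<open>Continuous dependence and optimal controls\<close>

lemma integral_le_AE:
  fixes f g :: "real \<Rightarrow> real"
  assumes ae: "AE r in lebesgue_on {0..T}. f r \<le> g r" and t: "0 \<le> t" "t \<le> T"
    and f: "f integrable_on {0..t}" and g: "g integrable_on {0..t}"
  shows "integral {0..t} f \<le> integral {0..t} g"
proof -
  define m where "m r = min (f r) (g r)" for r
  have eq: "AE r in lebesgue_on {0..T}. f r = m r" using ae by eventually_elim (simp add: m_def)
  note sp = integral_cong_AE_lebesgue_on[OF eq order_refl t(2)]
  have "integral {0..t} f = integral {0..t} m" by (rule sp(1))
  also have "\<dots> \<le> integral {0..t} g"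
    using sp(2) f by (intro integral_le g) (auto simp: m_def[abs_def])
  finally show ?thesis .
qed

lemma uniform_limit_imp_vanishing_bound:
  fixes f :: "nat \<Rightarrow> real \<Rightarrow> 'a::euclidean_space"
  assumes ab: "a \<le> b" and f: "\<And>k. continuous_on {a..b} (f k)" and l: "continuous_on {a..b} l"
    and lim: "uniform_limit {a..b} f l sequentially"
  obtains \<delta> where "\<delta> \<longlonglongrightarrow> 0" "\<And>k t. t \<in> {a..b} \<Longrightarrow> norm (f k t - l t) \<le> \<delta> k"
proof
  define \<delta> where "\<delta> k = (SUP t\<in>{a..b}. norm (f k t - l t))" for k
  have bdd: "bdd_above ((\<lambda>t. norm (f k t - l t)) ` {a..b})" for k
    by (intro bounded_imp_bdd_above compact_imp_bounded compact_continuous_image continuous_on_norm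
        continuous_on_diff f l compact_Icc)
  show le: "norm (f k t - l t) \<le> \<delta> k" if "t \<in> {a..b}" for k t
    unfolding \<delta>_def by (rule cSUP_upper[OF that bdd])
  have \<delta>0: "0 \<le> \<delta> k" for k using order_trans[OF norm_ge_zero le[of a k]] ab by simp
  show "\<delta> \<longlonglongrightarrow> 0"
  proof (rule LIMSEQ_I)
    fix e :: real assume e: "0 < e"
    then have "\<forall>\<^sub>F k in sequentially. \<forall>t\<in>{a..b}. dist (f k t) (l t) < e / 2"
      by (intro uniform_limitD[OF lim]) simp
    then obtain N where N: "\<And>k. k \<ge> N \<Longrightarrow> \<forall>t\<in>{a..b}. dist (f k t) (l t) < e / 2"
      unfolding eventually_sequentially by blast
    have "\<delta> k \<le> e / 2" if "k \<ge> N" for k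
      unfolding \<delta>_def using ab N[OF that] by (intro cSUP_least) (auto simp: dist_norm intro: less_imp_le)
    then show "\<exists>N. \<forall>k\<ge>N. norm (\<delta> k - 0) < e"
      using \<delta>0 e by (intro exI[of _ N] allI impI) (simp, smt (verit) field_sum_of_halves)
  qed
qed

context hypergraph_flow
begin

text \<open>Compare the penalised flows with the constrained flow \<open>x\<close> directly.  The subgradient
  inequalities for the two energies leave their difference at \<open>x\<close>; the penalty pairs with the
  difference of the controls, and the normal vector with the constraint violation.\<close>

lemma state_q_converges:
  assumes adm: "\<And>k. a k \<in> adm_controls T C M" "b \<in> adm_controls T C M"
    and A: "\<And>k t. t \<in> {0..T} \<Longrightarrow> norm (a k t) \<le> A"
    and lim: "uniform_limit {0..T} a b sequentially"
    and qs: "filterlim qs at_top sequentially" "\<And>k. 1 < qs k" and ls: "ls \<longlonglongrightarrow> 0" "\<And>k. 0 < ls k"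
    and y: "\<And>k. is_state_q T C E w p h \<xi> (qs k) (ls k) (a k) (y k)"
    and x: "is_state T C E w p h \<xi> b x" and t: "t \<in> {0..T}"
  shows "(\<lambda>k. y k t) \<longlonglongrightarrow> x t"
proof -
  have ca: "continuous_on {0..T} (a k)" and cb: "continuous_on {0..T} b" for k
    using control_continuous[OF adm_control_controls] adm by blast+
  have Ha: "H_proj C (a k s) = a k s" and Hb: "H_proj C (b s) = b s" if "s \<in> {0..T}" for k s
    using H_proj_control[OF adm_control_controls that] adm by blast+
  obtain \<delta> where \<delta>: "\<delta> \<longlonglongrightarrow> 0" "\<And>k t. t \<in> {0..T} \<Longrightarrow> norm (a k t - b t) \<le> \<delta> k"
    by (rule uniform_limit_imp_vanishing_bound[OF _ ca cb lim]) (use T in auto)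
  have T0: "0 \<in> {0..T}" using T by simp
  have \<delta>0: "0 \<le> \<delta> k" for k using order_trans[OF norm_ge_zero \<delta>(2)[OF T0]] .
  obtain R B where R0: "0 \<le> R" "0 \<le> B" and est0: "\<And>q lam a x. \<lbrakk>1 < q; 0 < lam; a \<in> adm_controls T C M;
        \<And>t. t \<in> {0..T} \<Longrightarrow> norm (a t) \<le> A; is_state_q T C E w p h \<xi> q lam a x\<rbrakk> \<Longrightarrow> uniform_bounds R B q lam a x"
    by (rule state_q_estimates[of M A]) blast
  note est = est0[OF qs(2) ls(2) adm(1) A y, unfolded uniform_bounds_def]
  have py: "L2_primitive T (penalised_rate (qs k) (ls k) (a k) (y k)) (y k)"
    and y0: "y k 0 = init_state C \<xi> (a k)" for k
    using y[of k] is_state_q_iff[OF qs(2) ca] by auto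
  have Wx: "W12 T x" and xK: "\<And>s. s \<in> {0..T} \<Longrightarrow> x s \<in> K_set C b s" and x0: "x 0 = init_state C \<xi> b"
    and inc: "AE s in lebesgue_on {0..T}.
        \<exists>\<eta>\<in>subdiff (\<lambda>z. ereal (\<phi> z)) (x s). \<exists>\<zeta>\<in>subdiff (ind_fun (K_set C b s)) (x s).
          wderiv T x s + \<eta> + \<zeta> = h s"
    using x unfolding is_state_def by blast+
  define x' where "x' = wderiv T x"
  have px: "L2_primitive T x' x" unfolding x'_def by (rule W12_imp_L2_primitive[OF T Wx])
  note x'L = L2_primitive_fun[OF px] and cx = L2_primitive_continuous[OF px]
  have "bounded (x ` {0..T})" by (intro compact_imp_bounded compact_continuous_image cx compact_Icc)
  then obtain Rx where Rx: "\<And>s. s \<in> {0..T} \<Longrightarrow> norm (x s) \<le> Rx" unfolding bounded_iff by blast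
  obtain \<Phi> where \<Phi>: "0 \<le> \<Phi>" "\<And>z. norm z \<le> Rx + 1 \<Longrightarrow> \<phi> z \<le> \<Phi>"
    by (rule energy_bounded_on_balls[of "Rx + 1"]) blast
  define c where "c k = ((real CARD('v))\<^sup>2) powr (p / qs k)" for k
  have clim: "c \<longlonglongrightarrow> 1" unfolding c_def[abs_def] by (intro edge_constant_tendsto qs(1)) auto
  have c1: "1 \<le> c k" for k
    unfolding c_def using p qs(2)[of k] by (intro ge_one_powr_ge_zero) (auto simp: one_le_power)
  define m where "m s = norm (h s) + norm (x' s) + \<Phi>" for s
  define Y where "Y k s = (1 / ls k) *\<^sub>R (H_proj C (y k s) - a k s)" for k s
  define \<rho> where "\<rho> k = sqrt (ls k * B) + \<delta> k" for k
  have \<rho>0: "0 \<le> \<rho> k" for k unfolding \<rho>_def using \<delta>0[of k] ls(2)[of k] R0 by simp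
  have mi: "m integrable_on {0..T}" unfolding m_def[abs_def]
    by (intro integrable_add L2_fun_norm_integrable_on h x'L) auto
  have m0: "0 \<le> m s" for s unfolding m_def using \<Phi>(1) by simp
  have cy: "continuous_on {0..T} (y k)" for k by (rule L2_primitive_continuous[OF py])
  have YL: "L2_fun T (Y k)" for k unfolding Y_def[abs_def]
    by (intro L2_fun_scaleR L2_fun_continuous continuous_on_diff H_proj_continuous_along cy ca)
  have pz: "L2_primitive T (\<lambda>s. penalised_rate (qs k) (ls k) (a k) (y k) s - x' s) (\<lambda>s. y k s - x s)" for k
    by (rule L2_primitive_diff[OF py px])
  have ae4: "AE t in lebesgue_on {0..T}. t \<in> {0..T}" by (rule AE_I2) simp
  have diss: "AE s in lebesgue_on {0..T}. (penalised_rate (qs k) (ls k) (a k) (y k) s - x' s) \<bullet> (y k s - x s)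
      \<le> (c k - 1) * \<Phi> + norm (Y k s) * \<delta> k + m s * \<rho> k" for k
    using inc ae4
  proof eventually_elim
    case (elim s)
    note s = elim(2)
    obtain \<eta> \<zeta> where \<eta>: "\<eta> \<in> subdiff (\<lambda>z. ereal (\<phi> z)) (x s)"
      and \<zeta>: "\<zeta> \<in> subdiff (ind_fun (K_set C b s)) (x s)" and sum: "x' s + \<eta> + \<zeta> = h s"
      using elim(1) unfolding x'_def by blast
    have \<eta>i: "\<eta> \<bullet> v \<le> \<phi> (x s + v) - \<phi> (x s)" for v
      using \<eta> unfolding subdiff_energy_iff by blast
    have H\<zeta>: "H_proj C \<zeta> = \<zeta>" using \<zeta> subdiff_ind_fun_K_set_iff[OF xK[OF s]] by blast
    have Hx: "H_proj C (x s) = b s" using xK[OF s] K_set_iff_H_proj[where a = b, OF Hb[OF s]] by blast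
    have n\<eta>: "norm \<eta> \<le> \<Phi>"
    proof (cases "\<eta> = 0")
      case False
      have "norm \<eta> = \<eta> \<bullet> (\<eta> /\<^sub>R norm \<eta>)" using False by (simp add: dot_square_norm power2_eq_square)
      also have "\<dots> \<le> \<phi> (x s + \<eta> /\<^sub>R norm \<eta>) - \<phi> (x s)" by (rule \<eta>i)
      also have "\<dots> \<le> \<phi> (x s + \<eta> /\<^sub>R norm \<eta>)" using energy_nonneg[of "x s"] by simp
      also have "\<dots> \<le> \<Phi>"
        using norm_triangle_ineq[of "x s" "\<eta> /\<^sub>R norm \<eta>"] Rx[OF s] False by (intro \<Phi>(2)) simp
      finally show ?thesis .
    qed (use \<Phi>(1) in simp)
    have "\<zeta> = h s - x' s - \<eta>" using sum by (simp add: algebra_simps)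
    then have n\<zeta>: "norm \<zeta> \<le> m s"
      using norm_triangle_ineq4[of "h s - x' s" \<eta>] norm_triangle_ineq4[of "h s" "x' s"] n\<eta> unfolding m_def by simp
    define z where "z = y k s - x s"
    define F where "F = D\<phi>q (qs k) (y k s)"
    have q0: "0 < qs k" using qs(2)[of k] by simp
    have "F \<bullet> (x s - y k s) \<le> \<phi>q (qs k) (x s) - \<phi>q (qs k) (y k s)"
      unfolding F_def by (rule energy_q_gradient_inequality[OF qs(2)])
    moreover have "\<phi> (y k s) \<le> \<phi>q (qs k) (y k s)" by (rule energy_le_energy_q[OF q0])
    moreover have "\<phi>q (qs k) (x s) \<le> c k * \<phi> (x s)"
      unfolding c_def by (rule energy_q_le_energy[OF q0])
    moreover have "(c k - 1) * \<phi> (x s) \<le> (c k - 1) * \<Phi>"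
      using Rx[OF s] c1[of k] by (intro mult_left_mono \<Phi>(2)) auto
    moreover have "\<eta> \<bullet> z \<le> \<phi> (y k s) - \<phi> (x s)" using \<eta>i[of z] by (simp add: z_def)
    ultimately have 1: "- (F \<bullet> z) + \<eta> \<bullet> z \<le> (c k - 1) * \<Phi>"
      unfolding z_def by (simp add: inner_diff_right left_diff_distrib)
    have HY: "H_proj C (Y k s) = Y k s"
      by (simp add: Y_def H_proj_scaleR H_proj_diff H_proj_idem Ha[OF s])
    define d where "d = H_proj C (y k s) - a k s"
    define d' where "d' = a k s - b s"
    have Hz: "H_proj C z = d + d'" by (simp add: z_def d_def d'_def H_proj_diff Hx)
    have nd: "norm d \<le> sqrt (ls k * B)" unfolding d_def using est s by (intro real_le_rsqrt) blast
    have nd': "norm d' \<le> \<delta> k" unfolding d'_def by (rule \<delta>(2)[OF s])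
    have Yz: "Y k s \<bullet> z = Y k s \<bullet> d + Y k s \<bullet> d'"
      using inner_H_proj[of C "Y k s" z] by (simp add: HY Hz inner_add_right)
    have "0 \<le> Y k s \<bullet> d" unfolding Y_def d_def using ls(2)[of k] by simp
    moreover have "- (Y k s \<bullet> d') \<le> norm (Y k s) * \<delta> k"
    proof -
      have "- (Y k s \<bullet> d') \<le> norm (Y k s) * norm d'" using Cauchy_Schwarz_ineq2[of "Y k s" d'] by simp
      also have "\<dots> \<le> norm (Y k s) * \<delta> k" by (intro mult_left_mono nd') auto
      finally show ?thesis .
    qed
    ultimately have 2: "- (Y k s \<bullet> z) \<le> norm (Y k s) * \<delta> k" unfolding Yz by linarith
    have "\<zeta> \<bullet> z = \<zeta> \<bullet> (d + d')" using inner_H_proj[of C \<zeta> z] by (simp add: H\<zeta> Hz)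
    also have "\<dots> \<le> norm \<zeta> * norm (d + d')" by (rule norm_cauchy_schwarz)
    also have "\<dots> \<le> m s * \<rho> k"
      unfolding \<rho>_def using n\<zeta> nd nd' norm_triangle_ineq[of d d'] m0[of s] by (intro mult_mono) auto
    finally have 3: "\<zeta> \<bullet> z \<le> m s * \<rho> k" .
    have "penalised_rate (qs k) (ls k) (a k) (y k) s - x' s = \<eta> + \<zeta> - F - Y k s"
      unfolding penalised_rate_def F_def Y_def using sum by (simp add: algebra_simps)
    then have "(penalised_rate (qs k) (ls k) (a k) (y k) s - x' s) \<bullet> z = \<eta> \<bullet> z + \<zeta> \<bullet> z - F \<bullet> z - Y k s \<bullet> z"
      by (simp add: inner_add_left inner_diff_left)
    then show ?case using 1 2 3 unfolding z_def by linarith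
  qed
  define err where "err k = (c k - 1) * \<Phi> * T + sqrt (T * B) * \<delta> k + integral {0..T} m * \<rho> k" for k
  have est2: "(norm (y k t - x t))\<^sup>2 \<le> (\<delta> k)\<^sup>2 + 2 * err k" for k
  proof -
    have tt: "0 \<le> t" "t \<le> T" using t by auto
    have iz: "(\<lambda>s. (penalised_rate (qs k) (ls k) (a k) (y k) s - x' s) \<bullet> (y k s - x s)) integrable_on {0..t}"
      by (rule integrable_on_subsegment[OF _ order_refl tt(2)])
         (use L2_fun_inner_integrable[OF L2_primitive_fun[OF pz] L2_fun_continuous[OF L2_primitive_continuous[OF pz]]] in
           \<open>simp add: absolutely_integrable_on_def\<close>)
    have bnd: "((\<lambda>s. (c k - 1) * \<Phi> + norm (Y k s) * \<delta> k + m s * \<rho> k) has_integral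
        ((c k - 1) * \<Phi> * t + integral {0..t} (\<lambda>s. norm (Y k s)) * \<delta> k + integral {0..t} m * \<rho> k)) {0..t}"
      using has_integral_const_real[of "(c k - 1) * \<Phi>" 0 t] tt
      by (intro has_integral_add has_integral_mult_left integrable_integral
          integrable_on_subsegment[OF mi order_refl tt(2)]
          integrable_on_subsegment[OF L2_fun_norm_integrable_on[OF YL] order_refl tt(2)])
         (simp add: mult.commute mult.left_commute)
    have "integral {0..t} (\<lambda>s. (penalised_rate (qs k) (ls k) (a k) (y k) s - x' s) \<bullet> (y k s - x s))
       \<le> (c k - 1) * \<Phi> * t + integral {0..t} (\<lambda>s. norm (Y k s)) * \<delta> k + integral {0..t} m * \<rho> k"
      using integral_le_AE[OF diss tt iz has_integral_integrable[OF bnd]] unfolding integral_unique[OF bnd] .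
    also have "\<dots> \<le> (c k - 1) * \<Phi> * T + sqrt (T * B) * \<delta> k + integral {0..T} m * \<rho> k"
    proof (intro add_mono mult_right_mono)
      show "(c k - 1) * \<Phi> * t \<le> (c k - 1) * \<Phi> * T"
        using tt c1[of k] \<Phi>(1) by (intro mult_left_mono) auto
      have "integral {0..t} (\<lambda>s. norm (Y k s)) \<le> integral {0..T} (\<lambda>s. norm (Y k s))"
        using tt by (intro integral_subset_le integrable_on_subsegment[OF L2_fun_norm_integrable_on[OF YL] order_refl]
            L2_fun_norm_integrable_on[OF YL]) auto
      also have "\<dots> \<le> sqrt (T * B)"
        by (rule integral_norm_le_sqrt[OF YL]) (use est in \<open>simp only: Y_def\<close>)
      finally show "integral {0..t} (\<lambda>s. norm (Y k s)) \<le> sqrt (T * B)" .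
      show "integral {0..t} m \<le> integral {0..T} m"
        using tt m0 by (intro integral_subset_le integrable_on_subsegment[OF mi order_refl] mi) auto
    qed (use \<delta>0 \<rho>0 in auto)
    finally have I: "integral {0..t} (\<lambda>s. (penalised_rate (qs k) (ls k) (a k) (y k) s - x' s) \<bullet> (y k s - x s)) \<le> err k"
      by (simp add: err_def)
    have "y k 0 - x 0 = a k 0 - b 0"
    proof -
      have "y k 0 - x 0 = H_proj C (a k 0 - b 0)"
        unfolding y0 x0 by (auto simp: vec_eq_iff init_state_def H_proj_nth)
      then show ?thesis by (simp add: H_proj_diff Ha[OF T0] Hb[OF T0])
    qed
    then have "(norm (y k 0 - x 0))\<^sup>2 \<le> (\<delta> k)\<^sup>2" using \<delta>(2)[OF T0, of k] by (simp add: power_mono)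
    then show ?thesis using I L2_primitive_norm_sq[OF pz tt, of k] by linarith
  qed
  have "(\<lambda>k. sqrt ((\<delta> k)\<^sup>2 + 2 * err k)) \<longlonglongrightarrow> sqrt (0\<^sup>2 + 2 * ((1 - 1) * \<Phi> * T + sqrt (T * B) * 0
      + integral {0..T} m * (sqrt (0 * B) + 0)))"
    unfolding err_def \<rho>_def by (intro tendsto_intros clim \<delta>(1) ls(1))
  then have "(\<lambda>k. sqrt ((\<delta> k)\<^sup>2 + 2 * err k)) \<longlonglongrightarrow> 0" by simp
  moreover have "\<forall>\<^sub>F k in sequentially. norm (y k t - x t) \<le> sqrt ((\<delta> k)\<^sup>2 + 2 * err k)"
    by (intro always_eventually allI real_le_rsqrt est2)
  ultimately have "(\<lambda>k. y k t - x t) \<longlonglongrightarrow> 0" by (rule Lim_null_comparison[rotated])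
  then show ?thesis by (rule LIM_zero_cancel)
qed

end

lemma integral_norm_sq_diff_tendsto:
  fixes X :: "nat \<Rightarrow> real \<Rightarrow> 'a::euclidean_space"
  assumes X: "\<And>k. continuous_on {0..T} (X k)" and R: "\<And>k t. t \<in> {0..T} \<Longrightarrow> norm (X k t) \<le> R"
    and g: "L2_fun T g" and lim: "\<And>t. t \<in> {0..T} \<Longrightarrow> (\<lambda>k. X k t) \<longlonglongrightarrow> x t"
  shows "(\<lambda>k. integral {0..T} (\<lambda>t. (norm (X k t - g t))\<^sup>2)) \<longlonglongrightarrow> integral {0..T} (\<lambda>t. (norm (x t - g t))\<^sup>2)"
proof (rule dominated_convergence)
  show "(\<lambda>t. (norm (X k t - g t))\<^sup>2) integrable_on {0..T}" for k
    by (intro L2_fun_sq_integrable_on L2_fun_diff L2_fun_continuous X g)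
  show "(\<lambda>t. 2 * R\<^sup>2 + 2 * (norm (g t))\<^sup>2) integrable_on {0..T}"
    by (intro integrable_add integrable_on_mult_right L2_fun_sq_integrable_on g) auto
  show "norm ((norm (X k t - g t))\<^sup>2) \<le> 2 * R\<^sup>2 + 2 * (norm (g t))\<^sup>2" if t: "t \<in> {0..T}" for k t
  proof -
    have "(norm (X k t))\<^sup>2 \<le> R\<^sup>2" by (intro power_mono R[OF t]) auto
    then show ?thesis using norm_add_sq_le[of "X k t" "- g t"] by simp
  qed
  show "(\<lambda>k. (norm (X k t - g t))\<^sup>2) \<longlonglongrightarrow> (norm (x t - g t))\<^sup>2" if "t \<in> {0..T}" for t
    by (intro tendsto_intros lim that)
qed

lemma zero_adm_control:
  fixes C :: "'v::finite set"
  assumes "0 < T" "0 \<le> M" shows "(\<lambda>t. 0) \<in> adm_controls T C M"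
proof -
  have p0: "L2_primitive T (\<lambda>t. 0) (\<lambda>t. 0 :: real ^ 'v)"
    by (rule L2_primitiveI) (auto intro: L2_fun_continuous)
  have W: "W12 T (\<lambda>t. 0 :: real ^ 'v)" by (rule L2_primitive_imp_W12[OF assms(1) p0])
  note pw = W12_imp_L2_primitive[OF assms(1) W]
  have ae: "AE t in lebesgue_on {0..T}. wderiv T (\<lambda>t. 0 :: real ^ 'v) t = 0"
    by (rule L2_primitive_unique_AE[OF pw p0])
  then have "AE t in lebesgue_on {0..T}. (norm (wderiv T (\<lambda>t. 0 :: real ^ 'v) t))\<^sup>2 = 0"
    by eventually_elim simp
  then have "(LINT t|lebesgue_on {0..T}. (norm (wderiv T (\<lambda>t. 0 :: real ^ 'v) t))\<^sup>2) = 0"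
    by (rule integral_eq_zero_AE)
  then show ?thesis using W assms(2) by (simp add: adm_controls_def controls_def)
qed

text \<open>The value at the initial time is controlled by the mean square and the increments.\<close>

lemma L2_primitive_sup_bound:
  fixes u :: "real \<Rightarrow> 'a::euclidean_space"
  assumes T: "0 < T" and u: "L2_primitive T g u"
    and K: "integral {0..T} (\<lambda>t. (norm (u t))\<^sup>2) \<le> K" and M: "integral {0..T} (\<lambda>t. (norm (g t))\<^sup>2) \<le> M"
    and t: "t \<in> {0..T}"
  shows "norm (u t) \<le> sqrt (2 * K / T + 2 * (T * M)) + sqrt (T * M)"
proof -
  have M0: "0 \<le> M" by (rule order_trans[OF integral_nonneg[OF L2_fun_sq_integrable_on[OF L2_primitive_fun[OF u]]] M]) simp
  have inc: "(norm (u s - u 0))\<^sup>2 \<le> T * M" if "s \<in> {0..T}" for s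
  proof -
    have "(norm (u s - u 0))\<^sup>2 \<le> (s - 0) * integral {0..T} (\<lambda>r. (norm (g r))\<^sup>2)"
      by (rule L2_primitive_increment_sq_le[OF u]) (use that in auto)
    also have "\<dots> \<le> T * M" using that M M0 integral_nonneg[OF L2_fun_sq_integrable_on[OF L2_primitive_fun[OF u]]]
      by (intro mult_mono) auto
    finally show ?thesis .
  qed
  have "integral {0..T} (\<lambda>s. (norm (u 0))\<^sup>2) \<le> integral {0..T} (\<lambda>s. 2 * (norm (u s))\<^sup>2 + 2 * (T * M))"
  proof (rule integral_le)
    show "(\<lambda>s. 2 * (norm (u s))\<^sup>2 + 2 * (T * M)) integrable_on {0..T}"
      by (intro integrable_add integrable_on_mult_right L2_fun_sq_integrable_on L2_fun_continuous
          L2_primitive_continuous[OF u]) auto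
    show "(norm (u 0))\<^sup>2 \<le> 2 * (norm (u s))\<^sup>2 + 2 * (T * M)" if "s \<in> {0..T}" for s
      using norm_add_sq_le[of "u s" "- (u s - u 0)"] inc[OF that] unfolding norm_minus_cancel by simp
  qed auto
  also have "\<dots> = 2 * integral {0..T} (\<lambda>s. (norm (u s))\<^sup>2) + 2 * (T * M) * T"
    using has_integral_const_real[of "2 * (T * M)" 0 T] T
    by (intro integral_unique has_integral_add has_integral_mult_right integrable_integral
        L2_fun_sq_integrable_on L2_fun_continuous L2_primitive_continuous[OF u]) (simp add: mult.commute)
  also have "\<dots> \<le> 2 * K + 2 * (T * M) * T" using K by simp
  finally have "T * (norm (u 0))\<^sup>2 \<le> T * (2 * K / T + 2 * (T * M))" using T by (simp add: distrib_left mult.commute)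
  then have "(norm (u 0))\<^sup>2 \<le> 2 * K / T + 2 * (T * M)" using T by simp
  then have "norm (u 0) \<le> sqrt (2 * K / T + 2 * (T * M))" by (rule real_le_rsqrt)
  moreover have "norm (u t - u 0) \<le> sqrt (T * M)" by (rule real_le_rsqrt[OF inc[OF t]])
  moreover have "norm (u t) \<le> norm (u 0) + norm (u t - u 0)" by (metis add.commute norm_triangle_sub)
  ultimately show ?thesis by linarith
qed

text \<open>Admissible controls with bounded initial values are equicontinuous, and the constraint on the
  derivative survives uniform limits.\<close>

lemma adm_controls_compact:
  fixes C :: "'v::finite set"
  assumes T: "0 < T" and a: "\<And>k. a k \<in> adm_controls T C M" and A: "\<And>k. norm (a k 0) \<le> A"
  obtains r b where "strict_mono (r :: nat \<Rightarrow> nat)"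
    "uniform_limit {0..T} (\<lambda>k. a (r k)) b sequentially" "b \<in> adm_controls T C M"
proof -
  obtain r b g where sub: "strict_mono (r :: nat \<Rightarrow> nat)"
      and lim: "uniform_limit {0..T} (\<lambda>k. a (r k)) b sequentially"
      and pb: "L2_primitive T g b" and gM: "integral {0..T} (\<lambda>t. (norm (g t))\<^sup>2) \<le> M"
    by (rule L2_primitive_compactness[where U = a, OF T adm_control_primitive(1)[OF T a]
          adm_control_primitive(2)[OF T a] A]) (rule that)
  have W: "W12 T b" by (rule L2_primitive_imp_W12[OF T pb])
  note pw = W12_imp_L2_primitive[OF T W]
  have "AE t in lebesgue_on {0..T}. wderiv T b t = g t" by (rule L2_primitive_unique_AE[OF pw pb])
  then have "AE t in lebesgue_on {0..T}. (norm (wderiv T b t))\<^sup>2 = (norm (g t))\<^sup>2"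
    by eventually_elim simp
  from integral_cong_AE_lebesgue_on(1)[OF this order_refl order_refl]
  have "(LINT t|lebesgue_on {0..T}. (norm (wderiv T b t))\<^sup>2) \<le> M"
    using LINT_sq_eq_integral[OF L2_primitive_fun[OF pw]] gM by simp
  moreover have "b t $ i = 0" if t: "t \<in> {0..T}" and i: "i \<notin> C" for t i
  proof -
    have "(\<lambda>k. a (r k) t $ i) \<longlonglongrightarrow> b t $ i" by (intro tendsto_vec_nth tendsto_uniform_limitI[OF lim t])
    moreover have "a (r k) t $ i = 0" for k
      using adm_control_controls[OF a[of "r k"]] t i by (simp add: controls_def)
    ultimately show ?thesis by (simp add: LIMSEQ_const_iff)
  qed
  ultimately have "b \<in> adm_controls T C M" using W by (simp add: adm_controls_def controls_def)
  then show ?thesis using that sub lim by blast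
qed

context hypergraph_flow
begin

lemma is_state_q_state_q:
  assumes "1 < q" "0 < lam" "a \<in> adm_controls T C M"
  shows "is_state_q T C E w p h \<xi> q lam a (state_q T C E w p h \<xi> q lam a)"
  unfolding state_q_def
  by (rule someI_ex[OF state_q_exists[OF assms(1,2) control_continuous[OF adm_control_controls[OF assms(3)]]]])

lemma is_state_state:
  "a \<in> adm_controls T C M \<Longrightarrow> is_state T C E w p h \<xi> a (state T C E w p h \<xi> a)"
  unfolding state_def by (rule someI_ex[OF state_exists])

lemma state_q_continuous:
  assumes "1 < q" "0 < lam" "a \<in> adm_controls T C M"
  shows "continuous_on {0..T} (state_q T C E w p h \<xi> q lam a)"
  using is_state_q_state_q[OF assms] by (simp add: is_state_q_def W12_def)

lemma LINT_sq_diff_eq_integral: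
  "continuous_on {0..T} u \<Longrightarrow> L2_fun T g \<Longrightarrow>
    (LINT t|lebesgue_on {0..T}. (norm (u t - g t))\<^sup>2) = integral {0..T} (\<lambda>t. (norm (u t - g t))\<^sup>2)"
  by (rule LINT_sq_eq_integral[OF L2_fun_diff[OF L2_fun_continuous]])

text \<open>The penalised states converge boundedly, and the terms of the penalised cost that the original
  cost lacks carry a factor \<open>lam\<close>.\<close>

lemma cost_q_tendsto:
  assumes a: "\<And>k. a k \<in> adm_controls T C M" and b: "b \<in> adm_controls T C M"
    and A: "\<And>k t. t \<in> {0..T} \<Longrightarrow> norm (a k t) \<le> A"
    and lim: "uniform_limit {0..T} a b sequentially"
    and qs: "filterlim qs at_top sequentially" "\<And>k. 1 < qs k" and ls: "ls \<longlonglongrightarrow> 0" "\<And>k. 0 < ls k"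
    and xs: "L2_fun T xs"
  shows "(\<lambda>k. cost_q T C E w p h \<xi> xs zs (qs k) (ls k) (a k)) \<longlonglongrightarrow> cost T C E w p h \<xi> xs b"
proof -
  define y where "y k = state_q T C E w p h \<xi> (qs k) (ls k) (a k)" for k
  define x where "x = state T C E w p h \<xi> b"
  have y: "is_state_q T C E w p h \<xi> (qs k) (ls k) (a k) (y k)" for k
    unfolding y_def by (rule is_state_q_state_q[OF qs(2) ls(2) a])
  have cy: "continuous_on {0..T} (y k)" for k
    unfolding y_def by (rule state_q_continuous[OF qs(2) ls(2) a])
  have x: "is_state T C E w p h \<xi> b x" unfolding x_def by (rule is_state_state[OF b])
  have cx: "continuous_on {0..T} x" using x by (simp add: is_state_def W12_def)
  have ca: "continuous_on {0..T} (a k)" and cb: "continuous_on {0..T} b" for k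
    using control_continuous[OF adm_control_controls] a b by blast+
  have T0: "0 \<in> {0..T}" "T \<in> {0..T}" using T by auto
  obtain R B where est: "\<And>q lam a x. \<lbrakk>1 < q; 0 < lam; a \<in> adm_controls T C M;
        \<And>t. t \<in> {0..T} \<Longrightarrow> norm (a t) \<le> A; is_state_q T C E w p h \<xi> q lam a x\<rbrakk> \<Longrightarrow> uniform_bounds R B q lam a x"
    by (rule state_q_estimates[of M A]) blast
  have R: "norm (y k t) \<le> R" if "t \<in> {0..T}" for k t
    using est[OF qs(2) ls(2) a A y] that unfolding uniform_bounds_def by blast
  have ylim: "(\<lambda>k. y k t) \<longlonglongrightarrow> x t" if "t \<in> {0..T}" for t
    by (rule state_q_converges[OF a b A lim qs ls y x that])
  have 1: "(\<lambda>k. LINT t|lebesgue_on {0..T}. (norm (y k t - xs t))\<^sup>2)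
      \<longlonglongrightarrow> (LINT t|lebesgue_on {0..T}. (norm (x t - xs t))\<^sup>2)"
    using integral_norm_sq_diff_tendsto[OF cy R xs ylim]
    by (simp add: LINT_sq_diff_eq_integral[OF cy xs] LINT_sq_diff_eq_integral[OF cx xs])
  have 2: "(\<lambda>k. LINT t|lebesgue_on {0..T}. (norm (a k t))\<^sup>2) \<longlonglongrightarrow> (LINT t|lebesgue_on {0..T}. (norm (b t))\<^sup>2)"
    using integral_norm_sq_diff_tendsto[OF ca A L2_fun_continuous[OF continuous_on_const[of _ 0]]
        tendsto_uniform_limitI[OF lim]]
    by (simp add: LINT_sq_eq_integral[OF L2_fun_continuous[OF ca]] LINT_sq_eq_integral[OF L2_fun_continuous[OF cb]])
  have 3: "(\<lambda>k. ls k / 2 * (norm (y k T - zs))\<^sup>2) \<longlonglongrightarrow> 0 / 2 * (norm (x T - zs))\<^sup>2"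
    by (intro tendsto_intros ls(1) ylim T0) auto
  have 4: "(\<lambda>k. ls k / 2 * (norm (a k 0))\<^sup>2) \<longlonglongrightarrow> 0 / 2 * (norm (b 0))\<^sup>2"
    by (intro tendsto_intros ls(1) tendsto_uniform_limitI[OF lim] T0) auto
  from tendsto_add[OF tendsto_add[OF tendsto_add[OF tendsto_mult_left[OF 1, of "1/2"] tendsto_mult_left[OF 2, of "1/2"]] 3] 4]
  show ?thesis by (simp add: cost_q_def cost_def y_def x_def)
qed

lemma control_sq_le_cost_q:
  assumes "0 < lam"
  shows "(LINT t|lebesgue_on {0..T}. (norm (a t))\<^sup>2) \<le> 2 * cost_q T C E w p h \<xi> xs zs q lam a"
proof -
  have "0 \<le> (LINT t|lebesgue_on {0..T}. (norm (state_q T C E w p h \<xi> q lam a t - xs t))\<^sup>2)"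
    by (rule Bochner_Integration.integral_nonneg) simp
  moreover have "0 \<le> lam / 2 * (norm (state_q T C E w p h \<xi> q lam a T - zs))\<^sup>2" "0 \<le> lam / 2 * (norm (a 0))\<^sup>2"
    using assms by auto
  ultimately show ?thesis unfolding cost_q_def by argo
qed

lemma cost_q_zero_bounded:
  assumes xs: "L2_fun T xs" and M: "0 \<le> (M::real)"
  obtains K where "\<And>q lam. \<lbrakk>1 < q; 0 < lam; lam < 1\<rbrakk> \<Longrightarrow> cost_q T C E w p h \<xi> xs zs q lam (\<lambda>t. 0) \<le> K"
proof -
  note o = zero_adm_control[OF T M, of C]
  obtain R B where est: "\<And>q lam a x. \<lbrakk>1 < q; 0 < lam; a \<in> adm_controls T C M;
        \<And>t. t \<in> {0..T} \<Longrightarrow> norm (a t) \<le> 0; is_state_q T C E w p h \<xi> q lam a x\<rbrakk> \<Longrightarrow> uniform_bounds R B q lam a x"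
    by (rule state_q_estimates[of M 0]) blast
  show ?thesis
  proof (rule that)
    fix q lam :: real assume ql: "1 < q" "0 < lam" "lam < 1"
    define y where "y = state_q T C E w p h \<xi> q lam (\<lambda>t. 0)"
    have cy: "continuous_on {0..T} y" unfolding y_def by (rule state_q_continuous[OF ql(1,2) o])
    have R: "norm (y t) \<le> R" if "t \<in> {0..T}" for t
      using est[OF ql(1,2) o _ is_state_q_state_q[OF ql(1,2) o]] that
      unfolding uniform_bounds_def y_def by auto
    have "integral {0..T} (\<lambda>t. (norm (y t - xs t))\<^sup>2) \<le> integral {0..T} (\<lambda>t. 2 * R\<^sup>2 + 2 * (norm (xs t))\<^sup>2)"
    proof (rule integral_le)
      show "(norm (y t - xs t))\<^sup>2 \<le> 2 * R\<^sup>2 + 2 * (norm (xs t))\<^sup>2" if "t \<in> {0..T}" for t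
        using norm_add_sq_le[of "y t" "- xs t"] power_mono[OF R[OF that], of 2] by simp
    qed (intro L2_fun_sq_integrable_on L2_fun_diff L2_fun_continuous cy xs integrable_add
        integrable_on_mult_right integrable_const_ivl)+
    moreover have "lam / 2 * (norm (y T - zs))\<^sup>2 \<le> 1 / 2 * (R + norm zs)\<^sup>2"
      using ql norm_triangle_ineq4[of "y T" zs] R[of T] T by (intro mult_mono power_mono) auto
    ultimately show "cost_q T C E w p h \<xi> xs zs q lam (\<lambda>t. 0)
        \<le> 1 / 2 * integral {0..T} (\<lambda>t. 2 * R\<^sup>2 + 2 * (norm (xs t))\<^sup>2) + 1 / 2 * (R + norm zs)\<^sup>2"
      unfolding cost_q_def y_def[symmetric] LINT_sq_diff_eq_integral[OF cy xs] by simp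
  qed
qed

end

theorem theorem5:
  fixes E :: "'v::finite set set" and w :: "'v set \<Rightarrow> real" and C :: "'v set"
    and T p M :: real
    and h xs :: "real \<Rightarrow> real ^ 'v" and zs :: "real ^ 'v" and \<xi> :: "'v \<Rightarrow> real"
    and astar :: "real \<Rightarrow> real \<Rightarrow> real \<Rightarrow> real ^ 'v"
  assumes "weighted_hypergraph E w"
    and "0 < T" and "1 < p" and "0 < M"
    and "L2_fun T h" and "L2_fun T xs"
    and "\<And>q lam. 1 < q \<Longrightarrow> 0 < lam \<Longrightarrow> lam < 1 \<Longrightarrow>
           is_arg_min (cost_q T C E w p h \<xi> xs zs q lam) (\<lambda>a. a \<in> adm_controls T C M) (astar q lam)"
  shows "(\<exists>B. \<forall>q lam. 1 < q \<longrightarrow> 0 < lam \<longrightarrow> lam < 1 \<longrightarrow> W12_norm T (astar q lam) \<le> B) \<and>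
    (\<exists>(qs :: nat \<Rightarrow> real) (ls :: nat \<Rightarrow> real) a.
       (\<forall>i. 1 < qs i \<and> 0 < ls i \<and> ls i < 1) \<and>
       filterlim qs at_top sequentially \<and> ls \<longlonglongrightarrow> 0 \<and>
       uniform_limit {0..T} (\<lambda>i. astar (qs i) (ls i)) a sequentially \<and>
       is_arg_min (cost T C E w p h \<xi> xs) (\<lambda>a. a \<in> adm_controls T C M) a)"
proof -
  note T = assms(2)
  interpret hypergraph_flow E w p C T h \<xi>
    by unfold_locales (use assms in auto)
  let ?J = "cost T C E w p h \<xi> xs" and ?Jq = "cost_q T C E w p h \<xi> xs zs"
  have M: "0 \<le> M" using assms(4) by simp
  have ca: "continuous_on {0..T} a" if "a \<in> adm_controls T C M" for a
    by (rule control_continuous[OF adm_control_controls[OF that]])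
  have adm: "astar q lam \<in> adm_controls T C M" if "1 < q" "0 < lam" "lam < 1" for q lam
    using assms(7)[OF that] by (simp add: is_arg_min_def)
  have opt: "?Jq q lam (astar q lam) \<le> ?Jq q lam b"
    if "1 < q" "0 < lam" "lam < 1" "b \<in> adm_controls T C M" for q lam b
    using assms(7)[OF that(1-3)] that(4) by (auto simp: is_arg_min_def not_less)
  \<comment> \<open>Comparison with the zero control bounds all optimal controls in mean square at once.\<close>
  obtain K where K: "\<And>q lam. \<lbrakk>1 < q; 0 < lam; lam < 1\<rbrakk> \<Longrightarrow> ?Jq q lam (\<lambda>t. 0) \<le> K"
    by (rule cost_q_zero_bounded[OF assms(6) M]) blast
  have aK: "(LINT t|lebesgue_on {0..T}. (norm (astar q lam t))\<^sup>2) \<le> 2 * K"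
    if ql: "1 < q" "0 < lam" "lam < 1" for q lam
    using control_sq_le_cost_q[OF ql(2), of "astar q lam" xs zs q] opt[OF ql zero_adm_control[OF T M]] K[OF ql]
    by linarith
  have bounded: "W12_norm T (astar q lam) \<le> sqrt (2 * K + M)" if ql: "1 < q" "0 < lam" "lam < 1" for q lam
    unfolding W12_norm_def
    using aK[OF ql] adm[OF ql] by (intro real_sqrt_le_mono add_mono) (auto simp: adm_controls_def)
  define A where "A = sqrt (2 * (2 * K) / T + 2 * (T * M)) + sqrt (T * M)"
  have aA: "norm (astar q lam t) \<le> A" if ql: "1 < q" "0 < lam" "lam < 1" and t: "t \<in> {0..T}" for q lam t
  proof -
    have "integral {0..T} (\<lambda>t. (norm (astar q lam t))\<^sup>2) \<le> 2 * K"
      using aK[OF ql] LINT_sq_eq_integral[OF L2_fun_continuous[OF ca[OF adm[OF ql]]]] by simp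
    then show ?thesis unfolding A_def
      by (rule L2_primitive_sup_bound[OF T adm_control_primitive(1)[OF T adm[OF ql]] _
          adm_control_primitive(2)[OF T adm[OF ql]] t])
  qed
  \<comment> \<open>The shift by two keeps the parameters in the ranges \<open>q > 1\<close> and \<open>0 < lam < 1\<close> for every \<open>k\<close>.\<close>
  define q0 l0 where "q0 k = real k + 2" and "l0 k = inverse (real (Suc (Suc k)))" for k :: nat
  have ql0: "1 < q0 k" "0 < l0 k" "l0 k < 1" for k by (simp_all add: q0_def l0_def field_simps)
  have A0: "norm (astar (q0 k) (l0 k) 0) \<le> A" for k using aA[OF ql0] T by simp
  obtain r a where sub: "strict_mono (r :: nat \<Rightarrow> nat)"
     and lim: "uniform_limit {0..T} (\<lambda>k. astar (q0 (r k)) (l0 (r k))) a sequentially"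
     and a: "a \<in> adm_controls T C M"
    by (rule adm_controls_compact[where a = "\<lambda>k. astar (q0 k) (l0 k)", OF T adm[OF ql0] A0]) (rule that)
  define qs ls where "qs k = q0 (r k)" and "ls k = l0 (r k)" for k
  have ql: "1 < qs k" "0 < ls k" "ls k < 1" for k unfolding qs_def ls_def by (rule ql0)+
  have qsinf: "filterlim qs at_top sequentially"
  proof -
    have "filterlim q0 at_top sequentially"
      unfolding q0_def[abs_def] by (rule filterlim_at_top_mono[OF filterlim_real_sequentially]) auto
    from filterlim_compose[OF this filterlim_subseq[OF sub]] show ?thesis by (simp add: qs_def[abs_def])
  qed
  have lslim: "ls \<longlonglongrightarrow> 0"
  proof -
    have "l0 \<longlonglongrightarrow> 0" unfolding l0_def[abs_def]
      by (rule LIMSEQ_Suc[OF LIMSEQ_inverse_real_of_nat])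
    from LIMSEQ_subseq_LIMSEQ[OF this sub] show ?thesis by (simp add: ls_def[abs_def] o_def)
  qed
  have lim': "uniform_limit {0..T} (\<lambda>k. astar (qs k) (ls k)) a sequentially"
    using lim by (simp add: qs_def ls_def)
  have lhs: "(\<lambda>k. ?Jq (qs k) (ls k) (astar (qs k) (ls k))) \<longlonglongrightarrow> ?J a"
    by (rule cost_q_tendsto[OF adm[OF ql] a aA[OF ql] lim' qsinf ql(1) lslim ql(2) assms(6)])
  have "?J a \<le> ?J b" if b: "b \<in> adm_controls T C M" for b
  proof -
    have "bounded (b ` {0..T})" by (intro compact_imp_bounded compact_continuous_image ca[OF b] compact_Icc)
    then obtain A' where A': "\<And>t. t \<in> {0..T} \<Longrightarrow> norm (b t) \<le> A'" unfolding bounded_iff by blast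
    have "(\<lambda>k. ?Jq (qs k) (ls k) b) \<longlonglongrightarrow> ?J b"
      by (rule cost_q_tendsto[where a = "\<lambda>k. b", OF b b A' uniform_limit_const qsinf ql(1) lslim ql(2) assms(6)])
    moreover have "?Jq (qs k) (ls k) (astar (qs k) (ls k)) \<le> ?Jq (qs k) (ls k) b" for k
      by (rule opt[OF ql b])
    ultimately show ?thesis by (intro LIMSEQ_le[OF lhs]) blast+
  qed
  then have "is_arg_min ?J (\<lambda>a. a \<in> adm_controls T C M) a"
    using a by (auto simp: is_arg_min_def not_less)
  then have "\<exists>(qs :: nat \<Rightarrow> real) (ls :: nat \<Rightarrow> real) a.
       (\<forall>i. 1 < qs i \<and> 0 < ls i \<and> ls i < 1) \<and>
       filterlim qs at_top sequentially \<and> ls \<longlonglongrightarrow> 0 \<and>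
       uniform_limit {0..T} (\<lambda>i. astar (qs i) (ls i)) a sequentially \<and>
       is_arg_min ?J (\<lambda>a. a \<in> adm_controls T C M) a"
    using ql qsinf lslim lim' by blast
  then show ?thesis using bounded by blast
qed

end
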